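(* For each $n \ge 1$, let $\lambda_n$ be a partition of some positive integer $N_n$, with conjugate partition $\lambda_n'$, and let $\rho_n$ be an irreducible unitary representation of the symmetric group $\mathfrak{S}_{N_n}$ corresponding to $\lambda_n$, of dimension $f^{\lambda_n}$. Let $Z_{n,1}, Z_{n,2}, \ldots, Z_{n,N_n-1}$ be independent standard Gaussian random variables, and let $\Xi_n$ be the random probability measure on $\mathbb{R}$ that puts mass $1/f^{\lambda_n}$ at each of the $f^{\lambda_n}$ (real) eigenvalues, counted with multiplicity, of the random self-adjoint matrix $$\frac{1}{\sqrt{N_n-1}} \sum_{k=1}^{N_n-1} Z_{n,k}\, \rho_n((k,k+1)),$$ where $(k,k+1) \in \mathfrak{S}_{N_n}$ is the transposition interchanging $k$ and $k+1$. Suppose that $N_n \to \infty$ as $n \to \infty$ and that the limit $$\theta := \lim_{n\to\infty} \frac{\sum_{(i,j)\in\lambda_n}(j-i)}{\binom{N_n}{2}} = \lim_{n\to\infty} \frac{\sum_i \binom{\lambda_{n,i}}{2} - \sum_j \binom{\lambda'_{n,j}}{2}}{\binom{N_n}{2}}$$ exists (the two expressions under the limits are equal for every $n$). Then, as $n\to\infty$, $\Xi_n$ converges in distribution, as a sequence of random elements of the space of probability measures on $\mathbb{R}$ equipped with the topology of weak convergence, to a random probability measure $\Xi_\infty$ that is Gaussian with random mean $\theta Z$ and nonrandom variance $1-\theta^2$, where $Z$ is a standard Gaussian random variable. In particular, the (nonrandom) expectation measure $\mathbb{E}[\Xi_\infty]$ is standard Gaussian.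
   Context: A partition $\lambda$ of a positive integer $N$ is a sequence of integers $\lambda_1 \ge \lambda_2 \ge \cdots \ge \lambda_k > 0$ with sum $N$. Its Young diagram consists of $N$ boxes in $k$ left-justified rows with $\lambda_i$ boxes in row $i$ (rows numbered from top to bottom); $(i,j)\in\lambda$ means that there is a box in row $i$ and column $j$, i.e. $1\le i\le k$ and $1\le j\le \lambda_i$. The conjugate partition $\lambda'$ is the one whose Young diagram is the transpose: $(i,j)\in\lambda'$ if and only if $(j,i)\in\lambda$. The parts of $\lambda_n$ and $\lambda_n'$ are written $\lambda_{n,i}$ and $\lambda'_{n,j}$. Equivalence classes of irreducible (complex, finite-dimensional) unitary representations of $\mathfrak{S}_N$, the group of permutations of $\{1,\dots,N\}$, are indexed by partitions of $N$ in the usual way (the representation class of $\lambda$ is that of the Specht module $S^\lambda$, so that $(N)$ corresponds to the trivial representation). The dimension of the class indexed by $\lambda$ is $f^\lambda = N!/\prod_{(i,j)\in\lambda} h_{i,j}$, where $h_{i,j} = |\{(i,j')\in\lambda : j'\ge j\}\cup\{(i',j)\in\lambda : i'\ge i\}|$ is the hooklength. Since a transposition is its own inverse, each $\rho_n((k,k+1))$ is both unitary and self-adjoint. A Gaussian measure with variance $0$ is the point mass at its mean. The matrix in the claim makes sense once $N_n\ge 2$, which holds for all sufficiently large $n$. *)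

theory Defs
  imports
    "HOL-Probability.Probability"
    "HOL-Algebra.Sym_Groups"
    "Jordan_Normal_Form.Schur_Decomposition"
    "Jordan_Normal_Form.VS_Connect"
begin

section \<open>Partitions and Young diagrams\<close>

definition is_partition :: "nat \<Rightarrow> nat list \<Rightarrow> bool" where
  "is_partition N l \<longleftrightarrow> sorted_wrt (\<ge>) l \<and> (\<forall>p\<in>set l. 0 < p) \<and> sum_list l = N"

text \<open>Rows and columns are numbered from 1, list entries from 0.\<close>

definition young_diagram :: "nat list \<Rightarrow> (nat \<times> nat) set" where
  "young_diagram l = {(i, j). 1 \<le> i \<and> i \<le> length l \<and> 1 \<le> j \<and> j \<le> l ! (i - 1)}"

definition is_conjugate_partition :: "nat \<Rightarrow> nat list \<Rightarrow> nat list \<Rightarrow> bool" where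
  "is_conjugate_partition N l l' \<longleftrightarrow>
     is_partition N l' \<and> (\<forall>i j. (i, j) \<in> young_diagram l' \<longleftrightarrow> (j, i) \<in> young_diagram l)"

definition hook_length :: "nat list \<Rightarrow> nat \<Rightarrow> nat \<Rightarrow> nat" where
  "hook_length l i j =
     card ({(i, j') |j'. (i, j') \<in> young_diagram l \<and> j \<le> j'} \<union>
           {(i', j) |i'. (i', j) \<in> young_diagram l \<and> i \<le> i'})"

text \<open>The division is exact by the hook length formula.\<close>

definition partition_dim :: "nat list \<Rightarrow> nat" where
  "partition_dim l = fact (sum_list l) div (\<Prod>(i, j)\<in>young_diagram l. hook_length l i j)"


section \<open>Specht modules\<close>

definition is_tableau :: "nat list \<Rightarrow> (nat \<times> nat \<Rightarrow> nat) \<Rightarrow> bool" where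
  "is_tableau l t \<longleftrightarrow> bij_betw t (young_diagram l) {1..sum_list l}"

text \<open>The tabloid of \<open>t\<close>, i.e. its class under permutations of entries within rows, is
  represented by the map sending a row index to the set of entries in that row.\<close>

definition tabloid :: "nat list \<Rightarrow> (nat \<times> nat \<Rightarrow> nat) \<Rightarrow> (nat \<Rightarrow> nat set)" where
  "tabloid l t = (\<lambda>i. t ` {b \<in> young_diagram l. fst b = i})"

definition column_stabilizer :: "nat list \<Rightarrow> (nat \<times> nat \<Rightarrow> nat) \<Rightarrow> (nat \<Rightarrow> nat) set" where
  "column_stabilizer l t =
     {p. p permutes {1..sum_list l} \<and>
         (\<forall>j. p ` (t ` {b \<in> young_diagram l. snd b = j}) = t ` {b \<in> young_diagram l. snd b = j})}"

text \<open>An element of the permutation module on tabloids is represented by its coefficient function.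
  The polytabloid of \<open>t\<close> is the sum of \<open>sign p\<close> times the tabloid of \<open>p \<circ> t\<close> over the column
  stabilizer of \<open>t\<close>.\<close>

definition polytabloid :: "nat list \<Rightarrow> (nat \<times> nat \<Rightarrow> nat) \<Rightarrow> (nat \<Rightarrow> nat set) \<Rightarrow> complex" where
  "polytabloid l t = (\<lambda>T. \<Sum>p\<in>column_stabilizer l t.
     of_int (sign p) * (if T = tabloid l (p \<circ> t) then 1 else 0))"

definition specht_module :: "nat list \<Rightarrow> ((nat \<Rightarrow> nat set) \<Rightarrow> complex) set" where
  "specht_module l =
     {v. \<exists>E c. finite E \<and> E \<subseteq> {polytabloid l t |t. is_tableau l t} \<and>
               v = (\<lambda>T. \<Sum>e\<in>E. c e * e T)}"

text \<open>The action induced by \<open>g \<cdot> T = (\<lambda>i. g ` T i)\<close> on tabloids: the coefficient of \<open>g \<cdot> v\<close> at \<open>T\<close>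
  is that of \<open>v\<close> at \<open>g\<inverse> \<cdot> T\<close>.\<close>

definition tabloid_action ::
    "(nat \<Rightarrow> nat) \<Rightarrow> ((nat \<Rightarrow> nat set) \<Rightarrow> complex) \<Rightarrow> (nat \<Rightarrow> nat set) \<Rightarrow> complex" where
  "tabloid_action g v = (\<lambda>T. v (\<lambda>i. Hilbert_Choice.inv g ` T i))"


section \<open>Matrix representations of the symmetric group\<close>

definition unitary_group :: "nat \<Rightarrow> complex mat monoid" where
  "unitary_group d =
     \<lparr> carrier = {U \<in> carrier_mat d d. mat_adjoint U * U = 1\<^sub>m d}, mult = (*), one = 1\<^sub>m d \<rparr>"

definition unitary_rep :: "nat \<Rightarrow> nat \<Rightarrow> ((nat \<Rightarrow> nat) \<Rightarrow> complex mat) \<Rightarrow> bool" where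
  "unitary_rep N d r \<longleftrightarrow> r \<in> hom (sym_group N) (unitary_group d)"

definition irreducible_rep :: "nat \<Rightarrow> nat \<Rightarrow> ((nat \<Rightarrow> nat) \<Rightarrow> complex mat) \<Rightarrow> bool" where
  "irreducible_rep N d r \<longleftrightarrow> 0 < d \<and>
     (\<forall>W. VectorSpace.subspace class_ring W (module_vec TYPE(complex) d) \<and>
          (\<forall>g\<in>carrier (sym_group N). \<forall>w\<in>W. r g *\<^sub>v w \<in> W) \<longrightarrow>
          W = {0\<^sub>v d} \<or> W = carrier_vec d)"

text \<open>\<open>r\<close> is equivalent to the Specht module, via an intertwining linear isomorphism \<open>\<phi>\<close>.\<close>

definition corresponds_to_partition ::
    "nat \<Rightarrow> nat \<Rightarrow> ((nat \<Rightarrow> nat) \<Rightarrow> complex mat) \<Rightarrow> nat list \<Rightarrow> bool" where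
  "corresponds_to_partition N d r l \<longleftrightarrow>
     (\<exists>\<phi>. bij_betw \<phi> (carrier_vec d) (specht_module l) \<and>
          (\<forall>x\<in>carrier_vec d. \<forall>y\<in>carrier_vec d. \<phi> (x + y) = (\<lambda>T. \<phi> x T + \<phi> y T)) \<and>
          (\<forall>c. \<forall>x\<in>carrier_vec d. \<phi> (c \<cdot>\<^sub>v x) = (\<lambda>T. c * \<phi> x T)) \<and>
          (\<forall>g\<in>carrier (sym_group N). \<forall>x\<in>carrier_vec d. \<phi> (r g *\<^sub>v x) = tabloid_action g (\<phi> x)))"


section \<open>Random matrices and spectral measures\<close>

definition transposition_matrix ::
    "nat \<Rightarrow> nat \<Rightarrow> ((nat \<Rightarrow> nat) \<Rightarrow> complex mat) \<Rightarrow> (nat \<Rightarrow> real) \<Rightarrow> complex mat" where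
  "transposition_matrix N d r z = mat d d (\<lambda>(a, b).
     complex_of_real (1 / sqrt (real (N - 1))) *
     (\<Sum>k = 1..N - 1. complex_of_real (z k) * r (Transposition.transpose k (k + 1)) $$ (a, b)))"

text \<open>Multiplicity of an eigenvalue is its order as a root of the characteristic polynomial.  Only
  real eigenvalues are recorded; for a self-adjoint matrix these are all of them.\<close>

definition spectral_measure :: "nat \<Rightarrow> complex mat \<Rightarrow> real measure" where
  "spectral_measure d A = measure_of UNIV (sets borel) (\<lambda>B. ennreal (
     \<Sum>x\<in>{x. eigenvalue A (complex_of_real x)}.
       (1 / real d) * real (Polynomial.order (complex_of_real x) (char_poly A)) * indicator B x))"

text \<open>\<open>v\<close> is the variance, whereas \<open>normal_density\<close> takes the standard deviation.\<close>

definition gaussian_measure :: "real \<Rightarrow> real \<Rightarrow> real measure" where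
  "gaussian_measure m v =
     (if v = 0 then return borel m else density lborel (normal_density m (sqrt v)))"


section \<open>Convergence in distribution of random probability measures\<close>

definition weak_topology :: "real measure topology" where
  "weak_topology = topology_generated_by
     {{\<mu>. prob_space \<mu> \<and> sets \<mu> = sets borel \<and> (\<integral>x. f x \<partial>\<mu>) \<in> U} |f U.
        continuous_on UNIV f \<and> bounded (range f) \<and> open (U :: real set)}"

definition borel_algebra_of :: "'a topology \<Rightarrow> 'a measure" where
  "borel_algebra_of T = sigma (topspace T) {U. openin T U}"

text \<open>The sequence starts at index 1, and each of its terms may live on its own probability
  space.\<close>

definition converges_in_distribution ::
    "'c topology \<Rightarrow> (nat \<Rightarrow> 'a measure) \<Rightarrow> (nat \<Rightarrow> 'a \<Rightarrow> 'c) \<Rightarrow> 'b measure \<Rightarrow> ('b \<Rightarrow> 'c) \<Rightarrow> bool" where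
  "converges_in_distribution T M X P Y \<longleftrightarrow>
     (\<forall>n\<ge>1. X n \<in> measurable (M n) (borel_algebra_of T)) \<and>
     Y \<in> measurable P (borel_algebra_of T) \<and>
     (\<forall>F. continuous_map T euclideanreal F \<and> bounded (F ` topspace T) \<longrightarrow>
        (\<lambda>n. \<integral>\<omega>. F (X n \<omega>) \<partial>M n) \<longlonglongrightarrow> (\<integral>\<omega>. F (Y \<omega>) \<partial>P))"

end

theory Submission
  imports Defs
begin

text \<open>
  On the Specht module the sum of all transpositions acts as the content sum, as one sees on
  polytabloids: a transposition of two entries contributes \<open>1\<close>, \<open>- 1\<close> or \<open>0\<close> according to whether
  the two boxes share a row, share a column, or neither.  Multiplying a product of disjoint
  transpositions by this central element shows that the normalized character of a product of \<open>r\<close>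
  disjoint transpositions is \<open>\<theta>\<^sup>r + o(1)\<close>.

  Write \<open>s\<^sub>k\<close> for the transposition \<open>(k, k + 1)\<close>.  The moments of the random spectral measure are
  sums, over words in the \<open>s\<^sub>k\<close>, of Gaussian monomials times normalized characters.  All
  expectations of Gaussian monomials are nonnegative, so the words in which two neighbouring \<open>s\<^sub>k\<close>
  occur, or some \<open>s\<^sub>k\<close> occurs three times, are negligible in \<open>L\<^sup>2\<close>; on the remaining words the \<open>s\<^sub>k\<close>
  behave like independent random variables with mean \<open>\<theta>\<close> and second moment \<open>1\<close>.  Taking these to be
  Gaussian, the moments become those of a Gaussian measure with mean \<open>\<theta> Y\<close> and variance
  \<open>(1 - \<theta>\<^sup>2) V\<close>, where \<open>Y\<close> is the normalized sum of the coefficients, hence exactly standard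
  Gaussian, and \<open>V\<close> is the mean of their squares, which tends to \<open>1\<close>.  A compactness argument based
  on the method of moments turns this into convergence in distribution.
\<close>

section \<open>Content sums and Specht modules\<close>

text \<open>The limit is itself random, so control of the expected spectral measure would not be
  enough: for each realization the spectral measure is compared with the Gaussian measure of mean
  \<open>\<theta> * Y\<close> built from the same coefficients. Since \<open>Y\<close> is exactly
  standard Gaussian for every \<open>N\<close>, the limiting expectation can be written on each of
  the changing probability spaces, and only an L2 estimate for finitely many moments remains. That
  estimate must avoid enumerating pairings. The indicator of a bad word is therefore dominated by
  the number of neighbouring pairs and equal triples of positions in it. Summed against monomials,
  such counts have closed forms, a power of \<open>Y\<close> times one quadratic or cubic sum, whose
  second moment is at most of order \<open>1 / m\<close>. The comparison model has the same purpose: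
  its weights multiply over distinct letters and are expectations of monomials, so that the sum over
  all words is the expected power of one linear combination. On bad words the weights only have to
  stay bounded independently of \<open>N\<close>.\<close>

abbreviation swap :: "nat \<Rightarrow> nat \<Rightarrow> nat \<Rightarrow> nat" where
  "swap \<equiv> Transposition.transpose"

abbreviation content_sum :: "nat list \<Rightarrow> real" where
  "content_sum l \<equiv> (\<Sum>(i, j)\<in>young_diagram l. real j - real i)"

lemma finite_young_diagram: "finite (young_diagram l)"
proof (rule finite_subset)
  show "young_diagram l \<subseteq> {1..length l} \<times> {1..sum_list l}"
  proof
    fix u assume "u \<in> young_diagram l"
    then obtain i j where u: "u = (i, j)" and ij: "1 \<le> i" "i \<le> length l" "1 \<le> j" "j \<le> l ! (i - 1)"
      by (auto simp: young_diagram_def)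
    have "i - 1 < length l" using ij by linarith
    then have "l ! (i - 1) \<le> sum_list l"
      by (intro member_le_sum_list) auto
    then show "u \<in> {1..length l} \<times> {1..sum_list l}" using ij u by auto
  qed
qed auto

lemma young_diagram_down:
  assumes "is_partition N l" "(i', j') \<in> young_diagram l" "1 \<le> i" "i \<le> i'" "1 \<le> j" "j \<le> j'"
  shows "(i, j) \<in> young_diagram l"
proof -
  have s: "sorted_wrt (\<ge>) l" using assms by (simp add: is_partition_def)
  have b: "1 \<le> i'" "i' \<le> length l" "j' \<le> l ! (i' - 1)" using assms by (auto simp: young_diagram_def)
  have "l ! (i' - 1) \<le> l ! (i - 1)"
  proof (cases "i = i'")
    case False
    then have "i - 1 < i' - 1" "i' - 1 < length l" using assms b by auto
    then show ?thesis using s by (simp add: sorted_wrt_iff_nth_less)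
  qed simp
  then show ?thesis using assms b by (auto simp: young_diagram_def)
qed

section \<open>Contents as a count of pairs of boxes in a common row or column\<close>

lemma sum_sym_pairs:
  fixes less :: "'a \<Rightarrow> 'a \<Rightarrow> bool"
  assumes "\<And>u v. u \<in> D \<Longrightarrow> v \<in> D \<Longrightarrow> P u v \<longleftrightarrow> less u v \<or> less v u"
    and "\<And>u v. u \<in> D \<Longrightarrow> v \<in> D \<Longrightarrow> less u v \<Longrightarrow> \<not> less v u"
  shows "(\<Sum>u\<in>D. \<Sum>v\<in>D. of_bool (P u v)) = 2 * (\<Sum>u\<in>D. \<Sum>v\<in>D. (of_bool (less v u) :: real))"
proof -
  have "(\<Sum>u\<in>D. \<Sum>v\<in>D. of_bool (P u v)) =
      (\<Sum>u\<in>D. \<Sum>v\<in>D. (of_bool (less v u) :: real)) + (\<Sum>u\<in>D. \<Sum>v\<in>D. of_bool (less u v))"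
    unfolding sum.distrib[symmetric] by (intro sum.cong refl) (use assms in force)
  also have "(\<Sum>u\<in>D. \<Sum>v\<in>D. (of_bool (less u v) :: real)) = (\<Sum>u\<in>D. \<Sum>v\<in>D. of_bool (less v u))"
    by (rule sum.swap)
  finally show ?thesis by simp
qed

text \<open>A box in column \<open>j\<close> has \<open>j - 1\<close> boxes to its left; every
  unordered pair of boxes of a row appears in both orders, whence the factor 2.\<close>

lemma sum_same_row:
  assumes "is_partition N l"
  shows "(\<Sum>u\<in>young_diagram l. \<Sum>v\<in>young_diagram l. of_bool (fst u = fst v \<and> u \<noteq> v)) =
    2 * (\<Sum>(i, j)\<in>young_diagram l. real j - 1)"
proof -
  let ?D = "young_diagram l"
  have "(\<Sum>u\<in>?D. \<Sum>v\<in>?D. of_bool (fst u = fst v \<and> u \<noteq> v)) =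
    2 * (\<Sum>u\<in>?D. \<Sum>v\<in>?D. (of_bool (fst v = fst u \<and> snd v < snd u) :: real))"
    by (rule sum_sym_pairs[where less = "\<lambda>u v. fst u = fst v \<and> snd u < snd v"]) (auto simp: prod_eq_iff)
  also have "(\<Sum>u\<in>?D. \<Sum>v\<in>?D. (of_bool (fst v = fst u \<and> snd v < snd u) :: real)) =
     (\<Sum>(i, j)\<in>?D. real j - 1)"
  proof (intro sum.cong refl, clarify)
    fix i j assume ij: "(i, j) \<in> ?D"
    have "{v\<in>?D. fst v = i \<and> snd v < j} = (\<lambda>k. (i, k)) ` {1..<j}"
      using ij by (auto simp: young_diagram_def)
    then have "card {v\<in>?D. fst v = i \<and> snd v < j} = j - 1"
      by (simp add: card_image inj_on_def)
    moreover have "1 \<le> j" using ij by (auto simp: young_diagram_def)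
    ultimately show "(\<Sum>v\<in>?D. (of_bool (fst v = fst (i,j) \<and> snd v < snd (i,j)) :: real)) = real j - 1"
      by (simp add: sum_of_bool_eq finite_young_diagram Int_def)
  qed
  finally show ?thesis .
qed

text \<open>The column count depends on the shape: by \<open>young_diagram_down\<close> all
  \<open>i - 1\<close> positions above a box belong to the diagram.\<close>

lemma sum_same_column:
  assumes "is_partition N l"
  shows "(\<Sum>u\<in>young_diagram l. \<Sum>v\<in>young_diagram l. of_bool (snd u = snd v \<and> u \<noteq> v)) =
    2 * (\<Sum>(i, j)\<in>young_diagram l. real i - 1)"
proof -
  let ?D = "young_diagram l"
  have "(\<Sum>u\<in>?D. \<Sum>v\<in>?D. of_bool (snd u = snd v \<and> u \<noteq> v)) =
    2 * (\<Sum>u\<in>?D. \<Sum>v\<in>?D. (of_bool (snd v = snd u \<and> fst v < fst u) :: real))"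
    by (rule sum_sym_pairs[where less = "\<lambda>u v. snd u = snd v \<and> fst u < fst v"]) (auto simp: prod_eq_iff)
  also have "(\<Sum>u\<in>?D. \<Sum>v\<in>?D. (of_bool (snd v = snd u \<and> fst v < fst u) :: real)) =
     (\<Sum>(i, j)\<in>?D. real i - 1)"
  proof (intro sum.cong refl, clarify)
    fix i j assume ij: "(i, j) \<in> ?D"
    then have j: "1 \<le> j" and i: "1 \<le> i" by (auto simp: young_diagram_def)
    have "{v\<in>?D. snd v = j \<and> fst v < i} = (\<lambda>k. (k, j)) ` {1..<i}"
      using young_diagram_down[OF assms ij] j by (auto simp: young_diagram_def)
    then have "card {v\<in>?D. snd v = j \<and> fst v < i} = i - 1"
      by (simp add: card_image inj_on_def)
    then show "(\<Sum>v\<in>?D. (of_bool (snd v = snd (i,j) \<and> fst v < fst (i,j)) :: real)) = real i - 1"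
      using i by (simp add: sum_of_bool_eq finite_young_diagram Int_def)
  qed
  finally show ?thesis .
qed

lemma sum_young_diagram_rows:
  "(\<Sum>(i, j)\<in>young_diagram l. real j - 1) = (\<Sum>p\<leftarrow>l. real (p choose 2))"
proof -
  have eq: "young_diagram l = Sigma {1..length l} (\<lambda>i. {1..l ! (i - 1)})"
    by (auto simp: young_diagram_def)
  have row: "(\<Sum>j=1..n. real j - 1) = real (n choose 2)" for n
    by (induction n) (auto simp: numeral_2_eq_2)
  have "(\<Sum>(i, j)\<in>young_diagram l. real j - 1) = (\<Sum>i=1..length l. real (l ! (i - 1) choose 2))"
    unfolding eq by (subst sum.Sigma[symmetric]) (auto simp: row[simplified])
  also have "\<dots> = (\<Sum>i<length l. real (l ! i choose 2))"
    by (rule sum.reindex_bij_witness[of _ Suc "\<lambda>i. i - 1"]) auto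
  also have "\<dots> = (\<Sum>p\<leftarrow>l. real (p choose 2))"
    by (simp add: sum_list_sum_nth atLeast0LessThan)
  finally show ?thesis .
qed

text \<open>Write \<open>j - i\<close> as \<open>(j - 1) - (i - 1)\<close>: the first part sums
  along the rows of \<open>l\<close>, and transposing turns the second into the same row sum for
  \<open>l'\<close>.\<close>

lemma content_sum_eq_binomials:
  assumes "is_partition N l" "is_conjugate_partition N l l'"
  shows "content_sum l =
    (\<Sum>p\<leftarrow>l. real (p choose 2)) - (\<Sum>p\<leftarrow>l'. real (p choose 2))"
proof -
  have "content_sum l =
     (\<Sum>(i, j)\<in>young_diagram l. real j - 1) - (\<Sum>(i, j)\<in>young_diagram l. real i - 1)"
    by (simp add: sum_subtractf[symmetric] case_prod_unfold)
  also have "(\<Sum>(i, j)\<in>young_diagram l. real i - 1) = (\<Sum>(i, j)\<in>young_diagram l'. real j - 1)"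
    by (rule sum.reindex_bij_witness[of _ prod.swap prod.swap])
       (use assms in \<open>auto simp: is_conjugate_partition_def\<close>)
  finally show ?thesis by (simp add: sum_young_diagram_rows)
qed

section \<open>Transpositions acting on polytabloids\<close>

lemma tabloid_comp: "tabloid l (g \<circ> q) i = g ` tabloid l q i"
  by (auto simp: tabloid_def)

lemma tabloid_comp_cong: "tabloid l q = tabloid l q' \<Longrightarrow> tabloid l (g \<circ> q) = tabloid l (g \<circ> q')"
  by (simp add: fun_eq_iff tabloid_comp)

lemma tabloid_action_polytabloid:
  assumes "bij g"
  shows "tabloid_action g (polytabloid l t) T =
    (\<Sum>p\<in>column_stabilizer l t. of_int (sign p) * (if T = tabloid l (g \<circ> p \<circ> t) then 1 else 0))"
proof -
  have "(\<lambda>i. Hilbert_Choice.inv g ` T i) = tabloid l (p \<circ> t) \<longleftrightarrow> T = tabloid l (g \<circ> (p \<circ> t))" for p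
    unfolding fun_eq_iff tabloid_comp[of l g]
    using assms by (metis bij_is_inj bij_is_surj image_f_inv_f image_inv_f_f)
  then show ?thesis
    by (simp add: tabloid_action_def polytabloid_def comp_assoc)
qed

text \<open>Right translation by a transposition of the stabilizer is a sign-reversing bijection. It
  yields both the factor \<open>- 1\<close> for boxes in a common column and the cancellation for
  boxes in general position.\<close>

lemma column_stabilizer_reindex:
  fixes F :: "(nat \<Rightarrow> nat) \<Rightarrow> complex"
  assumes "a \<noteq> b" and s: "swap a b \<in> column_stabilizer l t"
  shows "(\<Sum>p\<in>column_stabilizer l t. of_int (sign p) * F (p \<circ> swap a b)) =
    - (\<Sum>p\<in>column_stabilizer l t. of_int (sign p) * F p)"
proof -
  let ?s = "swap a b" let ?C = "column_stabilizer l t"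
  have C: "p \<circ> ?s \<in> ?C" if "p \<in> ?C" for p
  proof -
    have "(p \<circ> ?s) ` X = p ` ?s ` X" for X by (rule image_comp[symmetric])
    with that s show ?thesis by (simp add: column_stabilizer_def permutes_compose del: o_apply)
  qed
  have sg: "sign (p \<circ> ?s) = - sign p" if "p \<in> ?C" for p
  proof -
    have "permutation p" using that permutation_permutes by (auto simp: column_stabilizer_def)
    then show ?thesis using assms by (simp add: sign_compose permutation_swap_id sign_swap_id)
  qed
  have "(\<Sum>p\<in>?C. of_int (sign p) * F (p \<circ> ?s)) = (\<Sum>p\<in>?C. - (of_int (sign p) * F p))"
  proof (rule sum.reindex_bij_witness[of _ "\<lambda>p. p \<circ> ?s" "\<lambda>p. p \<circ> ?s"])
  qed (auto simp: C sg comp_assoc)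
  then show ?thesis by (simp add: sum_negf)
qed

lemma transpose_in_column_stabilizer:
  assumes t: "is_tableau l t" and "u \<in> young_diagram l" "v \<in> young_diagram l" "snd u = snd v"
  shows "swap (t u) (t v) \<in> column_stabilizer l t"
proof -
  have inj: "inj_on t (young_diagram l)" and im: "t ` young_diagram l = {1..sum_list l}"
    using t by (auto simp: is_tableau_def bij_betw_def)
  have "t u \<in> {1..sum_list l}" "t v \<in> {1..sum_list l}" using im assms by auto
  then have "swap (t u) (t v) permutes {1..sum_list l}"
    by (rule permutes_swap_id)
  moreover have "(t u \<in> t ` {b \<in> young_diagram l. snd b = j}) =
      (t v \<in> t ` {b \<in> young_diagram l. snd b = j})" for j
    using inj assms by (auto simp: inj_on_def)
  ultimately show ?thesis by (simp add: column_stabilizer_def transpose_image_eq)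
qed

text \<open>Here \<open>s\<close> stands to the right of \<open>p\<close>. Conjugating a
  transposition past \<open>p\<close> brings its action on the polytabloid into this form, in which
  the two moved entries are those of fixed boxes, independent of \<open>p\<close>.\<close>

abbreviation twisted_polytabloid :: "nat list \<Rightarrow> (nat \<times> nat \<Rightarrow> nat) \<Rightarrow> (nat \<Rightarrow> nat) \<Rightarrow> (nat \<Rightarrow> nat set) \<Rightarrow> complex" where
  "twisted_polytabloid l t s T \<equiv> (\<Sum>p\<in>column_stabilizer l t. of_int (sign p) * (if T = tabloid l (p \<circ> s \<circ> t) then 1 else 0))"

text \<open>Let \<open>x\<close> be the box in the row of \<open>u\<close> and the column of
  \<open>v\<close>; it exists because \<open>u\<close> is the higher box. Once the entries of
  \<open>u\<close> and \<open>v\<close> are exchanged, \<open>t v\<close> shares a row with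
  \<open>t x\<close>, so exchanging these two entries does not change the tabloid. In
  \<open>t\<close> itself they share a column, so the same exchange reverses the sign of the sum,
  which therefore equals its own negative.\<close>

lemma polytabloid_transposition_vanish:
  assumes P: "is_partition N l" and t: "is_tableau l t" and u: "u \<in> young_diagram l" and v: "v \<in> young_diagram l"
    and r: "fst u < fst v" and c: "snd u \<noteq> snd v"
  shows "twisted_polytabloid l t (swap (t u) (t v)) T = 0"
    (is "?S = 0")
proof -
  have inj: "inj_on t (young_diagram l)" using t by (auto simp: is_tableau_def bij_betw_def)
  define x where "x = (fst u, snd v)"
  have x: "x \<in> young_diagram l"
    unfolding x_def using young_diagram_down[OF P, of "fst v" "snd v" "fst u" "snd v"] u v r
    by (auto simp: young_diagram_def)
  let ?q = "swap (t u) (t v) \<circ> t"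
  let ?s = "swap (t x) (t v)"
  have xne: "x \<noteq> u" "x \<noteq> v" using r c by (auto simp: x_def prod_eq_iff)
  then have tne: "t x \<noteq> t u" "t x \<noteq> t v" "t u \<noteq> t v"
    using inj x u v c by (auto simp: inj_on_def)
  have q: "?q u = t v" "?q x = t x" using tne by (auto simp: transpose_def)
  have injq: "inj_on ?q (young_diagram l)" 
    by (rule comp_inj_on[OF inj]) (rule inj_on_subset[OF bij_is_inj[OF bij_transpose]], simp)
  have tab: "tabloid l (?s \<circ> ?q) = tabloid l ?q"
  proof
    fix i
    have "t x \<in> tabloid l ?q i \<longleftrightarrow> fst u = i"
    proof -
      have "?q x \<in> ?q ` {b \<in> young_diagram l. fst b = i} \<longleftrightarrow> x \<in> {b \<in> young_diagram l. fst b = i}"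
        by (rule inj_on_image_mem_iff[OF injq x]) auto
      then show ?thesis unfolding q using x by (simp add: tabloid_def x_def)
    qed
    moreover have "t v \<in> tabloid l ?q i \<longleftrightarrow> fst u = i"
    proof -
      have "?q u \<in> ?q ` {b \<in> young_diagram l. fst b = i} \<longleftrightarrow> u \<in> {b \<in> young_diagram l. fst b = i}"
        by (rule inj_on_image_mem_iff[OF injq u]) auto
      then show ?thesis unfolding q using u by (simp add: tabloid_def)
    qed
    ultimately show "tabloid l (?s \<circ> ?q) i = tabloid l ?q i"
      unfolding tabloid_comp by (intro transpose_image_eq) auto
  qed
  have "?S = (\<Sum>p\<in>column_stabilizer l t. of_int (sign p) *
      (if T = tabloid l ((p \<circ> ?s) \<circ> ?q) then 1 else 0))"
    using tabloid_comp_cong[OF tab] by (simp add: comp_assoc)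
  also have "\<dots> = - (\<Sum>p\<in>column_stabilizer l t. of_int (sign p) * (if T = tabloid l (p \<circ> ?q) then 1 else 0))"
    by (rule column_stabilizer_reindex[where F = "\<lambda>p. if T = tabloid l (p \<circ> ?q) then 1 else 0", OF tne(2)])
       (rule transpose_in_column_stabilizer[OF t x v], simp add: x_def)
  finally show ?thesis by (simp add: comp_assoc)
qed

lemma polytabloid_transposition:
  assumes P: "is_partition N l" and t: "is_tableau l t" and u: "u \<in> young_diagram l" and v: "v \<in> young_diagram l"
    and uv: "u \<noteq> v"
  shows "twisted_polytabloid l t (swap (t u) (t v)) T =
    (of_bool (fst u = fst v) - of_bool (snd u = snd v)) * polytabloid l t T" (is "?S = _")
proof -
  have inj: "inj_on t (young_diagram l)" using t by (auto simp: is_tableau_def bij_betw_def)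
  consider "fst u = fst v" "snd u \<noteq> snd v" | "fst u \<noteq> fst v" "snd u = snd v" |
    "fst u \<noteq> fst v" "snd u \<noteq> snd v" using uv by (auto simp: prod_eq_iff)
  then show ?thesis
  proof cases
    case 1
    have "tabloid l (swap (t u) (t v) \<circ> t) = tabloid l t"
    proof
      fix i
      have "(t u \<in> tabloid l t i) = (t v \<in> tabloid l t i)"
        using inj u v 1 by (auto simp: inj_on_def tabloid_def)
      then show "tabloid l (swap (t u) (t v) \<circ> t) i = tabloid l t i"
        unfolding tabloid_comp by (rule transpose_image_eq)
    qed
    from tabloid_comp_cong[OF this] show ?thesis using 1 by (simp add: comp_assoc polytabloid_def)
  next
    case 2
    have "t u \<noteq> t v" using inj u v uv by (auto simp: inj_on_def)
    from column_stabilizer_reindex[OF this transpose_in_column_stabilizer[OF t u v 2(2)],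
        where F = "\<lambda>p. if T = tabloid l (p \<circ> t) then 1 else 0"]
    show ?thesis using 2 by (simp add: polytabloid_def)
  next
    case 3
    then consider "fst u < fst v" | "fst v < fst u" by linarith
    then have "?S = 0"
      using polytabloid_transposition_vanish[OF P t u v, of T] polytabloid_transposition_vanish[OF P t v u, of T]
        3 by cases (auto simp: transpose_commute[of "t u"])
    with 3 show ?thesis by simp
  qed
qed

lemma transpose_comp_inj:
  assumes "inj p"
  shows "swap (p a) (p b) \<circ> p = p \<circ> swap a b"
  by (simp add: fun_eq_iff Transposition.transpose_def inj_eq[OF assms])

lemma sum_pairs_reindex:
  assumes "bij_betw h A B"
  shows "(\<Sum>a\<in>B. \<Sum>b\<in>B. f a b) = (\<Sum>u\<in>A. \<Sum>v\<in>A. f (h u) (h v))"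
  using sum.reindex_bij_betw[OF assms, of "\<lambda>a. \<Sum>b\<in>B. f a b"]
    sum.reindex_bij_betw[OF assms, of "f (h u)" for u] by simp

abbreviation transposition_sum :: "nat \<Rightarrow> ((nat \<Rightarrow> nat set) \<Rightarrow> complex) \<Rightarrow> (nat \<Rightarrow> nat set) \<Rightarrow> complex" where
  "transposition_sum N v T \<equiv> (\<Sum>a\<in>{1..N}. \<Sum>b\<in>{1..N}. if a \<noteq> b then tabloid_action (swap a b) v T else 0)"

abbreviation distinct_pairs :: "nat \<Rightarrow> (nat \<times> nat) set" where
  "distinct_pairs N \<equiv> {(a, b). a \<in> {1..N} \<and> b \<in> {1..N} \<and> a \<noteq> b}"

lemma polytabloid_transposition_sum:
  assumes P: "is_partition N l" and t: "is_tableau l t"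
  shows "transposition_sum N (polytabloid l t) T =
    of_real (2 * content_sum l) * polytabloid l t T"
proof -
  let ?D = "young_diagram l" let ?C = "column_stabilizer l t"
  have N: "sum_list l = N" using P by (simp add: is_partition_def)
  have inj: "inj_on t ?D" and bij: "bij_betw t ?D {1..N}"
    using t by (auto simp: is_tableau_def bij_betw_def N)
  define H :: "(nat \<Rightarrow> nat) \<Rightarrow> (nat \<Rightarrow> nat) \<Rightarrow> complex" where
    "H = (\<lambda>p s. of_int (sign p) * (if T = tabloid l (p \<circ> s \<circ> t) then 1 else 0))"
  have "transposition_sum N (polytabloid l t) T
     = (\<Sum>a\<in>{1..N}. \<Sum>b\<in>{1..N}. \<Sum>p\<in>?C. if a \<noteq> b then of_int (sign p) * (if T = tabloid l (swap a b \<circ> p \<circ> t) then 1 else 0) else 0)"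
    by (intro sum.cong refl) (simp add: tabloid_action_polytabloid)
  also have "\<dots> = (\<Sum>a\<in>{1..N}. \<Sum>p\<in>?C. \<Sum>b\<in>{1..N}. if a \<noteq> b then of_int (sign p) * (if T = tabloid l (swap a b \<circ> p \<circ> t) then 1 else 0) else 0)"
    by (rule sum.cong[OF refl], rule sum.swap)
  also have "\<dots> = (\<Sum>p\<in>?C. \<Sum>a\<in>{1..N}. \<Sum>b\<in>{1..N}. if a \<noteq> b then of_int (sign p) * (if T = tabloid l (swap a b \<circ> p \<circ> t) then 1 else 0) else 0)"
    by (rule sum.swap)
  \<comment> \<open>For fixed \<open>p\<close>, renaming \<open>(a, b)\<close> to
    \<open>(p a, p b)\<close> moves the transposition from the left of \<open>p\<close> to its
    right, by \<open>transpose_comp_inj\<close>. Afterwards the pairs can be indexed by boxes, with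
    the sum over \<open>p\<close> innermost.\<close>
  also have "\<dots> = (\<Sum>p\<in>?C. \<Sum>a\<in>{1..N}. \<Sum>b\<in>{1..N}. if a \<noteq> b then H p (swap a b) else 0)"
  proof (rule sum.cong[OF refl])
    fix p assume "p \<in> ?C"
    then have p: "p permutes {1..N}" by (simp add: column_stabilizer_def N)
    note ip = permutes_inj[OF p] and bp = permutes_imp_bij[OF p]
    show "(\<Sum>a\<in>{1..N}. \<Sum>b\<in>{1..N}. if a \<noteq> b then of_int (sign p) * (if T = tabloid l (swap a b \<circ> p \<circ> t) then 1 else 0) else 0)
      = (\<Sum>a\<in>{1..N}. \<Sum>b\<in>{1..N}. if a \<noteq> b then H p (swap a b) else 0)"
      by (rule trans[OF sum_pairs_reindex[OF bp]], intro sum.cong refl) (simp add: H_def inj_eq[OF ip] transpose_comp_inj[OF ip])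
  qed
  also have "\<dots> = (\<Sum>a\<in>{1..N}. \<Sum>p\<in>?C. \<Sum>b\<in>{1..N}. if a \<noteq> b then H p (swap a b) else 0)"
    by (rule sum.swap)
  also have "\<dots> = (\<Sum>a\<in>{1..N}. \<Sum>b\<in>{1..N}. \<Sum>p\<in>?C. if a \<noteq> b then H p (swap a b) else 0)"
    by (rule sum.cong[OF refl], rule sum.swap)
  also have "\<dots> = (\<Sum>a\<in>{1..N}. \<Sum>b\<in>{1..N}. if a \<noteq> b then (\<Sum>p\<in>?C. H p (swap a b)) else 0)"
    by (rule sum.cong[OF refl], rule sum.cong[OF refl]) auto
  also have "\<dots> = (\<Sum>u\<in>?D. \<Sum>v\<in>?D. if t u \<noteq> t v then (\<Sum>p\<in>?C. H p (swap (t u) (t v))) else 0)"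
    by (rule sum_pairs_reindex[OF bij])
  also have "\<dots> = (\<Sum>u\<in>?D. \<Sum>v\<in>?D. of_real (of_bool (fst u = fst v \<and> u \<noteq> v) - of_bool (snd u = snd v \<and> u \<noteq> v)) * polytabloid l t T)"
  proof (intro sum.cong refl)
    fix u v assume uv: "u \<in> ?D" "v \<in> ?D"
    show "(if t u \<noteq> t v then (\<Sum>p\<in>?C. H p (swap (t u) (t v))) else 0) =
      of_real (of_bool (fst u = fst v \<and> u \<noteq> v) - of_bool (snd u = snd v \<and> u \<noteq> v)) * polytabloid l t T"
      using polytabloid_transposition[OF P t uv, of T] inj_on_eq_iff[OF inj uv]
      by (cases "u = v") (auto simp: H_def)
  qed
  also have "\<dots> = of_real ((\<Sum>u\<in>?D. \<Sum>v\<in>?D. of_bool (fst u = fst v \<and> u \<noteq> v)) - (\<Sum>u\<in>?D. \<Sum>v\<in>?D. of_bool (snd u = snd v \<and> u \<noteq> v))) * polytabloid l t T"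
    by (simp add: sum_subtractf sum_distrib_right sum_distrib_left left_diff_distrib)
  also have "(\<Sum>u\<in>?D. \<Sum>v\<in>?D. (of_bool (fst u = fst v \<and> u \<noteq> v) :: real)) - (\<Sum>u\<in>?D. \<Sum>v\<in>?D. of_bool (snd u = snd v \<and> u \<noteq> v))
      = 2 * content_sum l"
    by (simp only: sum_same_row[OF P] sum_same_column[OF P])
       (simp add: sum_subtractf[symmetric] right_diff_distrib[symmetric] case_prod_unfold)
  finally show ?thesis .
qed

lemma specht_transposition_sum:
  assumes P: "is_partition N l" and v: "v \<in> specht_module l"
  shows "transposition_sum N v T =
    of_real (2 * content_sum l) * v T"
proof -
  let ?c = "complex_of_real (2 * content_sum l)"
  obtain E c where E: "finite E" "E \<subseteq> {polytabloid l t |t. is_tableau l t}" and v: "v = (\<lambda>T. \<Sum>e\<in>E. c e * e T)"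
    using v by (auto simp: specht_module_def)
  have "transposition_sum N v T =
     (\<Sum>a\<in>{1..N}. \<Sum>b\<in>{1..N}. \<Sum>e\<in>E. c e * (if a \<noteq> b then tabloid_action (swap a b) e T else 0))"
    by (intro sum.cong refl) (simp add: tabloid_action_def v)
  also have "\<dots> = (\<Sum>a\<in>{1..N}. \<Sum>e\<in>E. \<Sum>b\<in>{1..N}. c e * (if a \<noteq> b then tabloid_action (swap a b) e T else 0))"
    by (rule sum.cong[OF refl], rule sum.swap)
  also have "\<dots> = (\<Sum>e\<in>E. \<Sum>a\<in>{1..N}. \<Sum>b\<in>{1..N}. c e * (if a \<noteq> b then tabloid_action (swap a b) e T else 0))"
    by (rule sum.swap)
  also have "\<dots> = (\<Sum>e\<in>E. c e * (?c * e T))"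
  proof (rule sum.cong[OF refl])
    fix e assume "e \<in> E"
    then obtain t where "is_tableau l t" "e = polytabloid l t" using E by auto
    then have "transposition_sum N e T = ?c * e T"
      by (simp only: polytabloid_transposition_sum[OF P])
    then show "(\<Sum>a\<in>{1..N}. \<Sum>b\<in>{1..N}. c e * (if a \<noteq> b then tabloid_action (swap a b) e T else 0)) = c e * (?c * e T)"
      by (simp add: sum_distrib_left[symmetric])
  qed
  also have "\<dots> = ?c * v T" unfolding v sum_distrib_left[of ?c] by (intro sum.cong refl) (simp only: mult_ac)
  finally show ?thesis .
qed


section \<open>Normalized characters of unitary representations\<close>

lemma mat_adjoint_index:
  assumes "A \<in> carrier_mat n m" "i < m" "j < n"
  shows "mat_adjoint A $$ (i, j) = conjugate (A $$ (j, i))"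
  using assms by (simp add: mat_adjoint_def mat_of_rows_def)

lemma mat_adjoint_carrier: "A \<in> carrier_mat n m \<Longrightarrow> mat_adjoint A \<in> carrier_mat m n"
  by (auto simp: mat_adjoint_def)

definition mat_trace :: "'a :: comm_ring_1 mat \<Rightarrow> 'a" where
  "mat_trace A = (\<Sum>i<dim_row A. A $$ (i, i))"

lemma mat_trace_comm:
  assumes "A \<in> carrier_mat n m" "B \<in> carrier_mat m n"
  shows "mat_trace (A * B) = mat_trace (B * A)"
proof -
  have "mat_trace (A * B) = (\<Sum>i<n. \<Sum>j<m. A $$ (i, j) * B $$ (j, i))"
    using assms by (simp add: mat_trace_def scalar_prod_def atLeast0LessThan)
  also have "\<dots> = (\<Sum>j<m. \<Sum>i<n. B $$ (j, i) * A $$ (i, j))"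
    by (subst sum.swap) (simp add: mult.commute)
  also have "\<dots> = mat_trace (B * A)"
    using assms by (simp add: mat_trace_def scalar_prod_def atLeast0LessThan)
  finally show ?thesis .
qed

text \<open>Passing to real parts loses nothing for the moments: traces of powers of a Hermitian
  matrix are real, and so is the scalar by which the class sum acts.\<close>

definition normalized_character :: "nat \<Rightarrow> ((nat \<Rightarrow> nat) \<Rightarrow> complex mat) \<Rightarrow> (nat \<Rightarrow> nat) \<Rightarrow> real" where
  "normalized_character d r g = Re (mat_trace (r g)) / real d"

lemma unitary_diagonal_entry_le_1:
  assumes U: "U \<in> carrier_mat d d" "mat_adjoint U * U = (1\<^sub>m d :: complex mat)" and i: "i < d"
  shows "norm (U $$ (i, i)) \<le> 1"
proof -
  have "(mat_adjoint U * U) $$ (i, i) = (\<Sum>k<d. cnj (U $$ (k, i)) * U $$ (k, i))"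
    using U(1) i mat_adjoint_carrier[OF U(1)]
    by (simp add: scalar_prod_def atLeast0LessThan mat_adjoint_index[OF U(1)])
  then have "(\<Sum>k<d. cnj (U $$ (k, i)) * U $$ (k, i)) = 1"
    using U(2) i by simp
  also have "(\<Sum>k<d. cnj (U $$ (k, i)) * U $$ (k, i)) = of_real (\<Sum>k<d. (norm (U $$ (k, i)))\<^sup>2)"
    by (simp add: complex_norm_square mult.commute del: of_real_power)
  finally have "(\<Sum>k<d. (norm (U $$ (k, i)))\<^sup>2) = 1"
    using of_real_eq_1_iff by blast
  moreover have "(norm (U $$ (i, i)))\<^sup>2 \<le> (\<Sum>k<d. (norm (U $$ (k, i)))\<^sup>2)"
    using i by (intro member_le_sum) auto
  ultimately show ?thesis by (simp add: abs_square_le_1)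
qed

context
  fixes N d :: nat and r :: "(nat \<Rightarrow> nat) \<Rightarrow> complex mat"
  assumes r: "unitary_rep N d r"
begin

lemma unitary_rep_carrier: "g permutes {1..N} \<Longrightarrow> r g \<in> carrier_mat d d"
  and unitary_rep_adjoint: "g permutes {1..N} \<Longrightarrow> mat_adjoint (r g) * r g = 1\<^sub>m d"
  and unitary_rep_comp: "g permutes {1..N} \<Longrightarrow> h permutes {1..N} \<Longrightarrow> r (g \<circ> h) = r g * r h"
  using r by (auto simp: unitary_rep_def hom_def sym_group_def unitary_group_def)

text \<open>Multiplicativity makes \<open>r id\<close> idempotent; an idempotent with a left
  inverse, here its adjoint, is the identity.\<close>

lemma unitary_rep_id: "r id = 1\<^sub>m d"
proof -
  have id: "id permutes {1..N}" by (rule permutes_id)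
  note U = unitary_rep_carrier[OF id] and a = unitary_rep_adjoint[OF id]
  have "r id = mat_adjoint (r id) * r id * r id" using U a by simp
  also have "\<dots> = mat_adjoint (r id) * (r id * r id)"
    using U mat_adjoint_carrier[OF U] by simp
  also have "r id * r id = r id" using unitary_rep_comp[OF id id] by (metis comp_id)
  finally show ?thesis using a by argo
qed

lemma unitary_rep_involution_hermitian:
  assumes g: "g permutes {1..N}" and gg: "g \<circ> g = id"
  shows "mat_adjoint (r g) = r g"
proof -
  note U = unitary_rep_carrier[OF g] and a = unitary_rep_adjoint[OF g]
  have "mat_adjoint (r g) = mat_adjoint (r g) * (r g * r g)"
    using U mat_adjoint_carrier[OF U] by (simp add: unitary_rep_comp[OF g g, symmetric] gg unitary_rep_id)
  also have "\<dots> = mat_adjoint (r g) * r g * r g"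
    using U mat_adjoint_carrier[OF U] by simp
  finally show ?thesis using a U by simp
qed

lemma normalized_character_bound:
  assumes "g permutes {1..N}"
  shows "\<bar>normalized_character d r g\<bar> \<le> 1"
proof -
  note U = unitary_rep_carrier[OF assms] unitary_rep_adjoint[OF assms]
  have "\<bar>Re (mat_trace (r g))\<bar> \<le> norm (\<Sum>i<d. r g $$ (i, i))"
    using U(1) abs_Re_le_cmod[of "\<Sum>i<d. r g $$ (i, i)"] by (simp add: mat_trace_def)
  also have "\<dots> \<le> (\<Sum>i<d. 1)"
    by (rule sum_norm_le) (use unitary_diagonal_entry_le_1[OF U] in auto)
  finally show ?thesis by (simp add: normalized_character_def divide_simps)
qed

lemma normalized_character_comm:
  assumes "g permutes {1..N}" "h permutes {1..N}"
  shows "normalized_character d r (g \<circ> h) = normalized_character d r (h \<circ> g)"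
  using mat_trace_comm[OF unitary_rep_carrier[OF assms(1)] unitary_rep_carrier[OF assms(2)]]
  by (simp add: normalized_character_def unitary_rep_comp[OF assms] unitary_rep_comp[OF assms(2,1)])

lemma normalized_character_id: "0 < d \<Longrightarrow> normalized_character d r id = 1"
  by (simp add: normalized_character_def unitary_rep_id mat_trace_def)

end

lemma intertwiner_sum:
  assumes add: "\<forall>x\<in>carrier_vec d. \<forall>y\<in>carrier_vec d. \<phi> (x + y) = (\<lambda>T. \<phi> x T + \<phi> y T)"
    and scale: "\<forall>c. \<forall>x\<in>carrier_vec d. \<phi> (c \<cdot>\<^sub>v x) = (\<lambda>T. c * \<phi> x T)"
    and "finite Q" "\<And>q. q \<in> Q \<Longrightarrow> M q \<in> carrier_mat d d" and x: "x \<in> carrier_vec d"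
  shows "\<phi> (mat d d (\<lambda>ij. \<Sum>q\<in>Q. M q $$ ij) *\<^sub>v x) T = (\<Sum>q\<in>Q. \<phi> (M q *\<^sub>v x) T :: complex)"
  using assms(3,4)
proof (induction Q rule: finite_induct)
  case empty
  have "mat d d (\<lambda>ij. \<Sum>q\<in>{}. M q $$ ij) *\<^sub>v x = 0 \<cdot>\<^sub>v x"
    using x by (auto simp: scalar_prod_def)
  then show ?case using scale x by simp
next
  case (insert q Q)
  have "mat d d (\<lambda>ij. \<Sum>q\<in>insert q Q. M q $$ ij) = M q + mat d d (\<lambda>ij. \<Sum>q\<in>Q. M q $$ ij)"
    using insert by (intro eq_matI) auto
  then have "mat d d (\<lambda>ij. \<Sum>q\<in>insert q Q. M q $$ ij) *\<^sub>v x = M q *\<^sub>v x + mat d d (\<lambda>ij. \<Sum>q\<in>Q. M q $$ ij) *\<^sub>v x"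
    using insert.prems x by (simp add: add_mult_distrib_mat_vec[of _ d d])
  then show ?case using insert add x by (simp add: mult_mat_vec_carrier[of _ d d])
qed

text \<open>The scalar action on the Specht module is pulled back along the injective
  \<open>\<phi>\<close> and read off entrywise on unit vectors. Ordered pairs count each
  transposition twice, which explains the factor 2.\<close>

lemma class_sum_scalar:
  assumes r: "unitary_rep N d r" and P: "is_partition N l" and co: "corresponds_to_partition N d r l"
    and ij: "i < d" "j < d"
  shows "(\<Sum>(a, b)\<in>distinct_pairs N. r (swap a b) $$ (i, j)) =
    of_real (2 * content_sum l) * of_bool (i = j)"
proof -
  define Q where "Q = distinct_pairs N"
  define C where "C = complex_of_real (2 * content_sum l)"
  have fQ: "finite Q" by (rule finite_subset[of _ "{1..N} \<times> {1..N}"]) (auto simp: Q_def)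
  obtain \<phi> where bij: "bij_betw \<phi> (carrier_vec d) (specht_module l)"
    and add: "\<forall>x\<in>carrier_vec d. \<forall>y\<in>carrier_vec d. \<phi> (x + y) = (\<lambda>T. \<phi> x T + \<phi> y T)"
    and scale: "\<forall>c. \<forall>x\<in>carrier_vec d. \<phi> (c \<cdot>\<^sub>v x) = (\<lambda>T. c * \<phi> x T)"
    and act: "\<forall>g\<in>carrier (sym_group N). \<forall>x\<in>carrier_vec d. \<phi> (r g *\<^sub>v x) = tabloid_action g (\<phi> x)"
    using co unfolding corresponds_to_partition_def by blast
  define S where "S = mat d d (\<lambda>ij. \<Sum>q\<in>Q. (case q of (a, b) \<Rightarrow> r (swap a b)) $$ ij)"
  have perm: "swap a b permutes {1..N}" if "(a, b) \<in> Q" for a b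
    using that by (intro permutes_swap_id) (auto simp: Q_def)
  have Sx: "S *\<^sub>v x = C \<cdot>\<^sub>v x" if x: "x \<in> carrier_vec d" for x
  proof -
    have "\<phi> (S *\<^sub>v x) = \<phi> (C \<cdot>\<^sub>v x)"
    proof
      fix T
      have "\<phi> (S *\<^sub>v x) T = (\<Sum>q\<in>Q. \<phi> ((case q of (a, b) \<Rightarrow> r (swap a b)) *\<^sub>v x) T)"
        unfolding S_def using unitary_rep_carrier[OF r perm]
        by (intro intertwiner_sum[OF add scale fQ _ x]) auto
      also have "\<dots> = (\<Sum>(a, b)\<in>Q. tabloid_action (swap a b) (\<phi> x) T)"
        using act x perm by (intro sum.cong refl) (auto simp: sym_group_def)
      also have "\<dots> = (\<Sum>(a, b)\<in>{1..N} \<times> {1..N}. if a \<noteq> b then tabloid_action (swap a b) (\<phi> x) T else 0)"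
        unfolding Q_def by (intro sum.mono_neutral_cong_left) auto
      also have "\<dots> = transposition_sum N (\<phi> x) T"
        by (rule sum.cartesian_product[symmetric])
      also have "\<dots> = C * \<phi> x T"
        unfolding C_def by (rule specht_transposition_sum[OF P]) (use bij x in \<open>auto simp: bij_betw_def\<close>)
      also have "\<dots> = \<phi> (C \<cdot>\<^sub>v x) T" using scale x by simp
      finally show "\<phi> (S *\<^sub>v x) T = \<phi> (C \<cdot>\<^sub>v x) T" .
    qed
    moreover have "S *\<^sub>v x \<in> carrier_vec d" "C \<cdot>\<^sub>v x \<in> carrier_vec d"
      using x mult_mat_vec_carrier[of S d d x] by (auto simp: S_def)
    ultimately show ?thesis using bij by (auto simp: bij_betw_def inj_on_def)
  qed
  have "S $$ (i, j) = (S *\<^sub>v unit_vec d j) $ i"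
    using ij by (simp add: S_def)
  also have "\<dots> = C * of_bool (i = j)" using ij by (simp add: Sx unit_vec_def)
  finally show ?thesis using ij by (simp add: S_def Q_def C_def case_prod_unfold)
qed

text \<open>Tracing the scalar action against \<open>r g\<close> gives an averaging identity for the
  character, the recursion behind the estimates for products of disjoint transpositions.\<close>

lemma normalized_character_class_sum:
  assumes r: "unitary_rep N d r" and P: "is_partition N l" and co: "corresponds_to_partition N d r l"
    and g: "g permutes {1..N}"
  shows "(\<Sum>(a, b)\<in>distinct_pairs N. normalized_character d r (g \<circ> swap a b)) =
    2 * content_sum l * normalized_character d r g"
proof -
  define Q where "Q = distinct_pairs N"
  define C where "C = 2 * content_sum l"
  note U = unitary_rep_carrier[OF r g]
  have perm: "swap a b permutes {1..N}" if "(a, b) \<in> Q" for a b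
    using that by (intro permutes_swap_id) (auto simp: Q_def)
  have tr: "mat_trace (r (g \<circ> swap a b)) =
      (\<Sum>i<d. \<Sum>k<d. r g $$ (i, k) * r (swap a b) $$ (k, i))" if "(a, b) \<in> Q" for a b
    using U unitary_rep_carrier[OF r perm[OF that]]
    by (simp add: unitary_rep_comp[OF r g perm[OF that]] mat_trace_def scalar_prod_def atLeast0LessThan)
  have "(\<Sum>q\<in>Q. mat_trace (r (g \<circ> (case q of (a, b) \<Rightarrow> swap a b)))) =
      (\<Sum>q\<in>Q. \<Sum>i<d. \<Sum>k<d. r g $$ (i, k) * r (case q of (a, b) \<Rightarrow> swap a b) $$ (k, i))"
    using tr by (intro sum.cong refl) auto
  also have "\<dots> = (\<Sum>i<d. \<Sum>q\<in>Q. \<Sum>k<d. r g $$ (i, k) * r (case q of (a, b) \<Rightarrow> swap a b) $$ (k, i))"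
    by (rule sum.swap)
  also have "\<dots> = (\<Sum>i<d. \<Sum>k<d. \<Sum>q\<in>Q. r g $$ (i, k) * r (case q of (a, b) \<Rightarrow> swap a b) $$ (k, i))"
    by (rule sum.cong[OF refl], rule sum.swap)
  also have "\<dots> = (\<Sum>i<d. \<Sum>k<d. r g $$ (i, k) * (of_real C * of_bool (k = i)))"
  proof (intro sum.cong refl)
    fix i k assume "i \<in> {..<d}" "k \<in> {..<d}"
    then show "(\<Sum>q\<in>Q. r g $$ (i, k) * r (case q of (a, b) \<Rightarrow> swap a b) $$ (k, i)) =
      r g $$ (i, k) * (of_real C * of_bool (k = i))"
      using class_sum_scalar[OF r P co, of k i, folded Q_def C_def]
      by (simp add: sum_distrib_left[symmetric] case_prod_unfold)
  qed
  also have "\<dots> = (\<Sum>i<d. of_real C * r g $$ (i, i))"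
    by (intro sum.cong refl) (simp add: of_bool_def if_distrib sum.delta cong: if_cong)
  also have "\<dots> = of_real C * mat_trace (r g)" using U by (simp add: mat_trace_def sum_distrib_left)
  finally have *: "(\<Sum>q\<in>Q. mat_trace (r (g \<circ> (case q of (a, b) \<Rightarrow> swap a b)))) = of_real C * mat_trace (r g)" .
  have "(\<Sum>q\<in>Q. normalized_character d r (g \<circ> (case q of (a, b) \<Rightarrow> swap a b))) =
      Re (\<Sum>q\<in>Q. mat_trace (r (g \<circ> (case q of (a, b) \<Rightarrow> swap a b)))) / real d"
    unfolding normalized_character_def by (simp add: sum_divide_distrib)
  also have "\<dots> = C * normalized_character d r g"
    unfolding * by (simp add: normalized_character_def)
  finally show ?thesis by (simp add: Q_def C_def case_prod_unfold)
qed


section \<open>Characters of products of disjoint transpositions\<close>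

lemma real_choose_two: "real (n choose 2) = real n * (real n - 1) / 2"
  by (induction n) (auto simp: numeral_2_eq_2 field_simps)

section \<open>Words in adjacent transpositions\<close>

lemma transpose_conj:
  assumes "a \<noteq> b" "a' \<noteq> b" "a \<noteq> a'"
  shows "swap a a' \<circ> swap a b \<circ> swap a a' =
    swap a' b"
  using assms by (auto simp: fun_eq_iff Transposition.transpose_def)

definition adjacent_word :: "nat list \<Rightarrow> nat \<Rightarrow> nat" where
  "adjacent_word xs = foldr (\<lambda>k g. swap k (Suc k) \<circ> g) xs id"

lemma adjacent_word_Nil [simp]: "adjacent_word [] = id"
  and adjacent_word_Cons [simp]: "adjacent_word (k # xs) = swap k (Suc k) \<circ> adjacent_word xs"
  by (simp_all add: adjacent_word_def)

lemma adjacent_word_append: "adjacent_word (xs @ ys) = adjacent_word xs \<circ> adjacent_word ys"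
  by (induction xs) (simp_all add: comp_assoc)

lemma adjacent_word_permutes:
  "set xs \<subseteq> {1..N - 1} \<Longrightarrow> adjacent_word xs permutes {1..N}"
proof (induction xs)
  case Nil
  show ?case unfolding adjacent_word_Nil by (rule permutes_id)
next
  case (Cons k xs)
  have "swap k (Suc k) permutes {1..N}"
    using Cons.prems by (intro permutes_swap_id) auto
  with Cons show ?case unfolding adjacent_word_Cons by (intro permutes_compose) auto
qed

lemma adjacent_word_fixes:
  "x \<notin> set xs \<Longrightarrow> x \<notin> Suc ` set xs \<Longrightarrow> adjacent_word xs x = x"
  by (induction xs) (auto simp: Transposition.transpose_def)

text \<open>Equal letters may repeat; only consecutive ones are excluded, so the condition says
  precisely that the adjacent transpositions of the word commute pairwise.\<close>

definition spaced :: "nat list \<Rightarrow> bool" where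
  "spaced xs \<longleftrightarrow> (\<forall>x\<in>set xs. Suc x \<notin> set xs)"

lemma adjacent_word_commute:
  assumes "Suc k \<notin> set xs" "k \<notin> Suc ` set xs"
  shows "swap k (Suc k) \<circ> adjacent_word xs = adjacent_word xs \<circ> swap k (Suc k)"
  using assms
proof (induction xs)
  case (Cons x xs)
  have "swap k (Suc k) \<circ> swap x (Suc x) = swap x (Suc x) \<circ> swap k (Suc k)"
    using Cons.prems by (cases "x = k") (auto simp: fun_eq_iff Transposition.transpose_def)
  then have "swap k (Suc k) \<circ> adjacent_word (x # xs) =
      swap x (Suc x) \<circ> (swap k (Suc k) \<circ> adjacent_word xs)"
    by (simp only: adjacent_word_Cons comp_assoc[symmetric])
  also have "swap k (Suc k) \<circ> adjacent_word xs = adjacent_word xs \<circ> swap k (Suc k)"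
    by (rule Cons.IH) (use Cons.prems in auto)
  finally show ?case by (simp only: adjacent_word_Cons comp_assoc)
qed simp

text \<open>In a word of spaced letters the letters commute and square to the identity, so only the
  letters occurring once survive, provided that no letter occurs more than twice.\<close>

lemma adjacent_word_reduce:
  assumes "spaced xs" "\<And>x. count_list xs x \<le> 2"
  shows "\<exists>ys. distinct ys \<and> set ys = {x. count_list xs x = 1} \<and> adjacent_word xs = adjacent_word ys"
  using assms
proof (induction xs rule: length_induct)
  case (1 xs)
  show ?case
  proof (cases xs)
    case Nil
    then show ?thesis by (intro exI[of _ "[]"]) auto
  next
    case (Cons k zs)
    show ?thesis
    proof (cases "k \<in> set zs")
      case False
      have "spaced zs" using 1(2) Cons by (auto simp: spaced_def)
      moreover have "count_list zs x \<le> 2" for x using 1(3)[of x] Cons by (auto split: if_splits)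
      ultimately obtain ys where ys: "distinct ys" "set ys = {x. count_list zs x = 1}" "adjacent_word zs = adjacent_word ys"
        using 1(1)[rule_format, of zs] Cons by auto
      have "count_list zs k = 0" using False by simp
      then show ?thesis using ys Cons by (intro exI[of _ "k # ys"]) (auto split: if_splits)
    next
      case True
      then obtain as bs where zs: "zs = as @ k # bs" by (meson split_list)
      have "spaced (as @ bs)" using 1(2) Cons zs by (auto simp: spaced_def)
      moreover have cle: "count_list (as @ bs) x \<le> 2" for x using 1(3)[of x] Cons zs by (auto split: if_splits)
      ultimately obtain ys where ys: "distinct ys" "set ys = {x. count_list (as @ bs) x = 1}" "adjacent_word (as @ bs) = adjacent_word ys"
        using 1(1)[rule_format, of "as @ bs"] Cons zs by auto
      \<comment> \<open>The two copies of \<open>k\<close> exhaust its allowed multiplicity.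
        Deleting both makes its count zero, so the set of letters occurring exactly once is
        unchanged.\<close>
      have k0: "count_list (as @ bs) k = 0" using 1(3)[of k] Cons zs by auto
      have "adjacent_word xs = swap k (Suc k) \<circ> adjacent_word as \<circ> swap k (Suc k) \<circ> adjacent_word bs"
        by (simp add: Cons zs adjacent_word_append comp_assoc)
      also have "swap k (Suc k) \<circ> adjacent_word as = adjacent_word as \<circ> swap k (Suc k)"
        by (rule adjacent_word_commute) (use 1(2) Cons zs in \<open>auto simp: spaced_def\<close>)
      also have "adjacent_word as \<circ> swap k (Suc k) \<circ> swap k (Suc k) = adjacent_word as"
        by (simp add: comp_assoc)
      finally have "adjacent_word xs = adjacent_word ys" using ys by (simp only: adjacent_word_append)
      moreover have "{x. count_list xs x = 1} = {x. count_list (as @ bs) x = 1}"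
        using k0 by (auto simp: Cons zs split: if_splits)
      ultimately show ?thesis using ys by blast
    qed
  qed
qed

text \<open>This isolates what the asymptotics use about the character: it is bounded, tracial,
  normalized, and satisfies the class sum identity, with \<open>c\<close> the content sum.\<close>

locale central_trace =
  fixes N :: nat and \<tau> :: "(nat \<Rightarrow> nat) \<Rightarrow> real" and c :: real
  assumes bound: "g permutes {1..N} \<Longrightarrow> \<bar>\<tau> g\<bar> \<le> 1"
    and comm: "g permutes {1..N} \<Longrightarrow> h permutes {1..N} \<Longrightarrow> \<tau> (g \<circ> h) = \<tau> (h \<circ> g)"
    and unit: "\<tau> id = 1"
    and class_sum: "g permutes {1..N} \<Longrightarrow>
      (\<Sum>(a, b)\<in>distinct_pairs N. \<tau> (g \<circ> swap a b)) = 2 * c * \<tau> g"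
begin

text \<open>Taking \<open>id\<close> for \<open>g\<close> in \<open>class_sum\<close> shows that,
  for \<open>N\<close> at least 2, this is the average of \<open>\<tau>\<close> over transpositions.
  As \<open>\<tau>\<close> is constant on conjugacy classes, it is the normalized character of a
  single transposition.\<close>

definition \<kappa> :: real where "\<kappa> = c / real (N choose 2)"

text \<open>Conjugation by \<open>swap a a'\<close> commutes with \<open>w\<close>, which fixes both
  points, and carries \<open>swap a b\<close> to \<open>swap a' b\<close>; traciality does the
  rest.\<close>

lemma transposition_off_support_aux:
  assumes w: "w permutes {1..N}" and fxd: "\<forall>x. x \<notin> S \<longrightarrow> w x = x"
    and a: "a \<in> {1..N} - S" "a' \<in> {1..N} - S" "b \<in> {1..N} - S" "a \<noteq> b" "a' \<noteq> b"
  shows "\<tau> (w \<circ> swap a b) = \<tau> (w \<circ> swap a' b)"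
proof (cases "a = a'")
  case False
  let ?h = "swap a a'" let ?s = "swap a b"
  have h: "?h permutes {1..N}" and s: "?s permutes {1..N}"
    using a by (auto intro!: permutes_swap_id)
  have "w (?h x) = ?h (w x)" for x
  proof (cases "x = a \<or> x = a'")
    case True
    then show ?thesis using fxd a by (auto simp: Transposition.transpose_def)
  next
    case False
    moreover have "w x \<noteq> a" "w x \<noteq> a'"
      using False fxd a permutes_inj[OF w] by (metis DiffD2 injD)+
    ultimately show ?thesis by (simp add: Transposition.transpose_def)
  qed
  then have hw: "?h \<circ> w = w \<circ> ?h" by (simp add: fun_eq_iff)
  have "w \<circ> swap a' b = w \<circ> (?h \<circ> ?s \<circ> ?h)"
    using a False by (simp add: transpose_conj)
  also have "\<dots> = ?h \<circ> (w \<circ> ?s \<circ> ?h)" by (simp add: comp_assoc[symmetric] hw)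
  finally have "\<tau> (w \<circ> swap a' b) = \<tau> (w \<circ> ?s \<circ> ?h \<circ> ?h)"
    using comm[OF h, of "w \<circ> ?s \<circ> ?h"] w s h by (simp add: permutes_compose del: One_nat_def)
  then show ?thesis by (simp add: comp_assoc)
qed simp

text \<open>The endpoints are moved one at a time. If \<open>a'\<close> equals \<open>b\<close>, the
  intermediate transposition would be degenerate, and a single move suffices.\<close>

lemma transposition_off_support:
  assumes w: "w permutes {1..N}" and fxd: "\<forall>x. x \<notin> S \<longrightarrow> w x = x"
    and a: "a \<in> {1..N} - S" "b \<in> {1..N} - S" "a \<noteq> b" and a': "a' \<in> {1..N} - S" "b' \<in> {1..N} - S" "a' \<noteq> b'"
  shows "\<tau> (w \<circ> swap a b) = \<tau> (w \<circ> swap a' b')"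
proof -
  note aux = transposition_off_support_aux[OF w fxd]
  show ?thesis
  proof (cases "a' = b")
    case True
    then show ?thesis using aux[of a b' b] a a' by (simp add: transpose_commute[of b b'])
  next
    case False
    have "\<tau> (w \<circ> swap a b) = \<tau> (w \<circ> swap a' b)"
      using aux[of a a' b] a a' False by simp
    also have "\<dots> = \<tau> (w \<circ> swap b' a')"
      using aux[of b b' a'] a a' False by (simp add: transpose_commute[of a'])
    finally show ?thesis by (simp add: transpose_commute[of a'])
  qed
qed

lemma sum_distinct_pairs_const:
  "(\<Sum>(a, b)\<in>distinct_pairs N. x) = real N * (real N - 1) * x"
proof -
  have "distinct_pairs N = Sigma {1..N} (\<lambda>a. {1..N} - {a})" by auto
  then have "(\<Sum>(a, b)\<in>distinct_pairs N. x) = (\<Sum>a\<in>{1..N}. \<Sum>b\<in>{1..N} - {a}. x)"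
    by (simp only:) (subst sum.Sigma, auto)
  also have "\<dots> = (\<Sum>a\<in>{1..N}. (real N - 1) * x)"
    by (intro sum.cong refl) (auto simp: card_Diff_singleton of_nat_diff)
  finally show ?thesis by simp
qed

text \<open>An average of values in \<open>[-1, 1]\<close>. The bound prevents errors from growing
  along a word and, in the limit, gives that \<open>\<theta>\<close> lies in
  \<open>[-1, 1]\<close>.\<close>

lemma \<kappa>_bound: assumes "N \<ge> 2" shows "\<bar>\<kappa>\<bar> \<le> 1"
proof -
  let ?Q = "distinct_pairs N"
  have n2: "real (N choose 2) = real N * (real N - 1) / 2"
    using assms by (simp add: real_choose_two)
  have "\<bar>2 * c\<bar> = \<bar>\<Sum>(a, b)\<in>?Q. \<tau> (id \<circ> swap a b)\<bar>"
    by (simp only: class_sum[OF permutes_id] unit)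
  also have "\<dots> \<le> (\<Sum>(a, b)\<in>?Q. 1)"
    unfolding case_prod_unfold
    by (rule order_trans[OF sum_abs], rule sum_mono) (auto intro!: bound permutes_swap_id)
  finally have "\<bar>2 * c\<bar> \<le> real N * (real N - 1)" unfolding sum_distinct_pairs_const by simp
  moreover have "real N * (real N - 1) > 0" using assms by simp
  ultimately show ?thesis unfolding \<kappa>_def n2 by (simp add: abs_if divide_simps split: if_splits)
qed

text \<open>In \<open>class_sum\<close> all pairs avoiding \<open>S\<close> contribute the same
  value as \<open>(a, b)\<close>. At most \<open>2 * (N - 1) * card S\<close> ordered pairs meet
  \<open>S\<close>, each with an error of at most 2; dividing by the \<open>N * (N - 1)\<close>
  pairs leaves the factor 4.\<close>

lemma transposition_step:
  assumes N: "N \<ge> 2" and w: "w permutes {1..N}" and fxd: "\<forall>x. x \<notin> S \<longrightarrow> w x = x" and S: "S \<subseteq> {1..N}"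
    and a: "a \<in> {1..N} - S" "b \<in> {1..N} - S" "a \<noteq> b"
  shows "\<bar>\<tau> (w \<circ> swap a b) - \<kappa> * \<tau> w\<bar> \<le> 4 * real (card S) / real N"
proof -
  let ?Q = "distinct_pairs N"
  let ?x = "\<tau> (w \<circ> swap a b)"
  have finS: "finite S" using S finite_subset by blast
  have Qp: "?Q = Sigma {1..N} (\<lambda>a. {1..N} - {a})" by auto
  have Ssum: "(\<Sum>a\<in>{1..N}. of_bool (a \<in> S)) = real (card S)"
    using S by (simp add: sum_of_bool_eq Int_absorb1)
  have t: "\<bar>?x - \<tau> (w \<circ> swap a' b')\<bar> \<le> 2 * (of_bool (a' \<in> S) + of_bool (b' \<in> S))"
    if "a' \<in> {1..N}" "b' \<in> {1..N}" "a' \<noteq> b'" for a' b'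
  proof (cases "a' \<in> S \<or> b' \<in> S")
    case True
    have "\<bar>?x\<bar> \<le> 1" "\<bar>\<tau> (w \<circ> swap a' b')\<bar> \<le> 1"
      using that a by (auto intro!: bound permutes_compose w permutes_swap_id)
    then have "\<bar>?x - \<tau> (w \<circ> swap a' b')\<bar> \<le> 2" by linarith
    also have "\<dots> \<le> 2 * (of_bool (a' \<in> S) + of_bool (b' \<in> S))" using True by auto
    finally show ?thesis .
  next
    case False
    then show ?thesis using transposition_off_support[OF w fxd a, of a' b'] that by simp
  qed
  have "\<bar>real N * (real N - 1) * ?x - 2 * c * \<tau> w\<bar> =
      \<bar>\<Sum>(a', b')\<in>?Q. ?x - \<tau> (w \<circ> swap a' b')\<bar>"
    unfolding class_sum[OF w, symmetric] sum_distinct_pairs_const[symmetric] by (simp add: sum_subtractf case_prod_unfold)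
  also have "\<dots> \<le> (\<Sum>(a', b')\<in>?Q. 2 * (of_bool (a' \<in> S) + of_bool (b' \<in> S)))"
    unfolding case_prod_unfold
    by (rule order_trans[OF sum_abs], rule sum_mono) (use t in auto)
  also have "\<dots> = (\<Sum>(a', b')\<in>?Q. 2 * of_bool (a' \<in> S)) + (\<Sum>(a', b')\<in>?Q. 2 * of_bool (b' \<in> S))"
    unfolding sum.distrib[symmetric] by (intro sum.cong refl) (auto simp: distrib_left)
  also have "(\<Sum>(a', b')\<in>?Q. 2 * (of_bool (b' \<in> S) :: real)) = (\<Sum>(a', b')\<in>?Q. 2 * of_bool (a' \<in> S))"
    by (rule sum.reindex_bij_witness[of _ prod.swap prod.swap]) auto
  also have "(\<Sum>(a', b')\<in>?Q. 2 * (of_bool (a' \<in> S) :: real)) = (\<Sum>a\<in>{1..N}. \<Sum>b\<in>{1..N} - {a}. 2 * of_bool (a \<in> S))"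
    unfolding Qp by (subst sum.Sigma) auto
  also have "\<dots> = (\<Sum>a\<in>{1..N}. (2 * (real N - 1)) * of_bool (a \<in> S))"
    by (intro sum.cong refl) (auto simp: card_Diff_singleton of_nat_diff)
  also have "\<dots> = 2 * (real N - 1) * real (card S)" unfolding sum_distrib_left[symmetric] Ssum ..
  also have "2 * (real N - 1) * real (card S) + 2 * (real N - 1) * real (card S) = 4 * (real N - 1) * real (card S)"
    by (simp add: algebra_simps)
  finally have *: "\<bar>real N * (real N - 1) * ?x - 2 * c * \<tau> w\<bar> \<le> 4 * (real N - 1) * real (card S)" .
  have n2: "real (N choose 2) = real N * (real N - 1) / 2"
    using N by (simp add: real_choose_two)
  have pos: "real N * (real N - 1) > 0" using N by simp
  have "\<bar>?x - \<kappa> * \<tau> w\<bar> = \<bar>real N * (real N - 1) * ?x - 2 * c * \<tau> w\<bar> / (real N * (real N - 1))"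
    unfolding \<kappa>_def n2 using pos N by (simp add: abs_if divide_simps algebra_simps)
  also have "\<dots> \<le> 4 * (real N - 1) * real (card S) / (real N * (real N - 1))"
    using * pos by (intro divide_right_mono) auto
  also have "\<dots> = 4 * real (card S) / real N" using N by (auto simp: divide_simps)
  finally show ?thesis .
qed

text \<open>The head of the word is disjoint from the support of the tail, which has at most twice
  as many points as the tail has letters. Each step thus costs \<open>8 * n / N\<close> for a tail
  of length \<open>n\<close>, and \<open>n\<^sup>2 + n\<close> is at most
  \<open>(n + 1)\<^sup>2\<close>.\<close>

lemma distinct_word:
  assumes N: "N \<ge> 2" and xs: "distinct xs" "spaced xs" "set xs \<subseteq> {1..N - 1}"
  shows "\<bar>\<tau> (adjacent_word xs) - \<kappa> ^ length xs\<bar> \<le> 8 * (real (length xs))\<^sup>2 / real N"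
  using xs
proof (induction xs)
  case Nil
  show ?case by (simp only: adjacent_word_Nil unit) simp
next
  case (Cons k xs)
  let ?w = "adjacent_word xs" let ?n = "real (length xs)"
  define S where "S = set xs \<union> Suc ` set xs"
  have IH: "\<bar>\<tau> ?w - \<kappa> ^ length xs\<bar> \<le> 8 * ?n\<^sup>2 / real N"
    using Cons by (auto simp: spaced_def)
  have w: "?w permutes {1..N}" by (rule adjacent_word_permutes) (use Cons in auto)
  have s: "swap k (Suc k) permutes {1..N}"
    using Cons.prems by (intro permutes_swap_id) auto
  have "\<bar>\<tau> (?w \<circ> swap k (Suc k)) - \<kappa> * \<tau> ?w\<bar> \<le> 4 * real (card S) / real N"
  proof (rule transposition_step[OF N w])
    show "\<forall>x. x \<notin> S \<longrightarrow> ?w x = x" using adjacent_word_fixes by (simp add: S_def)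
    show "S \<subseteq> {1..N}" using Cons.prems by (fastforce simp: S_def)
    show "k \<in> {1..N} - S" "Suc k \<in> {1..N} - S"
      using Cons.prems by (auto simp: S_def spaced_def)
  qed simp
  also have "\<tau> (?w \<circ> swap k (Suc k)) = \<tau> (adjacent_word (k # xs))"
    by (simp only: comm[OF s w] adjacent_word_Cons)
  also have "4 * real (card S) / real N \<le> 8 * ?n / real N"
  proof -
    have "card S \<le> card (set xs) + card (Suc ` set xs)" unfolding S_def by (rule card_Un_le)
    also have "\<dots> \<le> length xs + length xs"
      by (intro add_mono card_length order_trans[OF card_image_le card_length]) auto
    finally show ?thesis by (intro divide_right_mono) auto
  qed
  finally have 1: "\<bar>\<tau> (adjacent_word (k # xs)) - \<kappa> * \<tau> ?w\<bar> \<le> 8 * ?n / real N" .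
  have tri: "\<bar>a - c\<bar> \<le> \<bar>a - b\<bar> + \<bar>b - c\<bar>" for a b c :: real by linarith
  have "\<bar>\<kappa> * \<tau> ?w - \<kappa> ^ length (k # xs)\<bar> = \<bar>\<kappa>\<bar> * \<bar>\<tau> ?w - \<kappa> ^ length xs\<bar>"
    by (simp add: abs_mult[symmetric] right_diff_distrib)
  also have "\<dots> \<le> 1 * \<bar>\<tau> ?w - \<kappa> ^ length xs\<bar>"
    by (intro mult_right_mono \<kappa>_bound N) auto
  finally have 2: "\<bar>\<kappa> * \<tau> ?w - \<kappa> ^ length (k # xs)\<bar> \<le> 8 * ?n\<^sup>2 / real N"
    using IH by simp
  have "\<bar>\<tau> (adjacent_word (k # xs)) - \<kappa> ^ length (k # xs)\<bar> \<le> 8 * ?n / real N + 8 * ?n\<^sup>2 / real N"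
    by (rule order_trans[OF tri add_mono[OF 1 2]])
  also have "\<dots> = 8 * (?n + ?n\<^sup>2) / real N" by (simp add: add_divide_distrib)
  also have "\<dots> \<le> 8 * (real (length (k # xs)))\<^sup>2 / real N"
    by (intro divide_right_mono) (auto simp: power2_eq_square algebra_simps)
  finally show ?case .
qed

lemma generic_word:
  assumes N: "N \<ge> 2" and xs: "spaced xs" "\<And>x. count_list xs x \<le> 2" "set xs \<subseteq> {1..N - 1}"
  shows "\<bar>\<tau> (adjacent_word xs) - \<kappa> ^ card {x. count_list xs x = 1}\<bar> \<le> 8 * (real (length xs))\<^sup>2 / real N"
proof -
  obtain ys where ys: "distinct ys" "set ys = {x. count_list xs x = 1}" "adjacent_word xs = adjacent_word ys"
    using adjacent_word_reduce[OF xs(1,2)] by blast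
  have sub: "set ys \<subseteq> set xs" unfolding ys(2) using count_notin by force
  have "card {x. count_list xs x = 1} = length ys" using distinct_card[OF ys(1)] ys(2) by simp
  moreover have "length ys \<le> length xs"
    using distinct_card[OF ys(1)] card_mono[OF _ sub] card_length[of xs] by simp
  moreover have "\<bar>\<tau> (adjacent_word ys) - \<kappa> ^ length ys\<bar> \<le> 8 * (real (length ys))\<^sup>2 / real N"
    by (rule distinct_word[OF N ys(1)]) (use xs sub in \<open>auto simp: spaced_def\<close>)
  moreover have "8 * (real (length ys))\<^sup>2 / real N \<le> 8 * (real (length xs))\<^sup>2 / real N" if "length ys \<le> length xs"
    using that by (intro divide_right_mono mult_left_mono power_mono) auto
  ultimately show ?thesis using ys(3) by simp
qed

end


section \<open>Gaussian words\<close>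

definition words :: "'a set \<Rightarrow> nat \<Rightarrow> 'a list set" where
  "words I p = {xs. set xs \<subseteq> I \<and> length xs = p}"

lemma words_0 [simp]: "words I 0 = {[]}"
  by (auto simp: words_def)

lemma sum_words_Suc: "(\<Sum>xs\<in>words I (Suc p). f xs) = (\<Sum>k\<in>I. \<Sum>xs\<in>words I p. f (k # xs))"
proof -
  have "(\<Sum>xs\<in>words I (Suc p). f xs) = (\<Sum>(k, xs)\<in>I \<times> words I p. f (k # xs))"
    by (rule sum.reindex_bij_witness[of _ "\<lambda>(k, xs). k # xs" "\<lambda>xs. (hd xs, tl xs)"])
       (auto simp: words_def length_Suc_conv)
  then show ?thesis by (simp add: sum.cartesian_product)
qed

definition monomial :: "('a \<Rightarrow> 'b) \<Rightarrow> 'a list \<Rightarrow> 'b :: comm_monoid_mult" where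
  "monomial z xs = prod_list (map z xs)"

lemma monomial_Nil [simp]: "monomial z [] = 1"
  and monomial_Cons [simp]: "monomial z (x # xs) = z x * monomial z xs"
  and monomial_append: "monomial z (xs @ ys) = monomial z xs * monomial z ys"
  by (simp_all add: monomial_def)

lemma monomial_count:
  assumes "finite I" "set xs \<subseteq> I"
  shows "monomial z xs = (\<Prod>v\<in>I. z v ^ count_list xs v)"
  using assms(2)
proof (induction xs)
  case (Cons x xs)
  have "(\<Prod>v\<in>I. z v ^ count_list (x # xs) v) = (\<Prod>v\<in>I. (if v = x then z x else 1) * z v ^ count_list xs v)"
    by (intro prod.cong) auto
  also have "\<dots> = z x * (\<Prod>v\<in>I. z v ^ count_list xs v)"
    using Cons.prems assms(1) by (simp add: prod.distrib)
  finally show ?case using Cons by simp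
qed simp

lemma monomial_scale: "monomial (\<lambda>k. a * z k) xs = (a :: 'b :: comm_semiring_1) ^ length xs * monomial z xs"
  by (induction xs) (simp_all add: mult_ac)

lemma sum_monomial:
  fixes z :: "'a \<Rightarrow> 'b :: comm_semiring_1"
  shows "(\<Sum>xs\<in>words I p. monomial z xs) = (\<Sum>k\<in>I. z k) ^ p"
proof (induction p)
  case (Suc p)
  then show ?case by (simp add: sum_words_Suc sum_distrib_left[symmetric] sum_distrib_right)
qed simp

section \<open>Counting letters, pairs and triples of positions in a word\<close>

fun letter_sum :: "('a \<Rightarrow> real) \<Rightarrow> 'a list \<Rightarrow> real" where
  "letter_sum h [] = 0"
| "letter_sum h (x # xs) = h x + letter_sum h xs"

text \<open>The sum of \<open>G\<close> over the letters at all pairs of positions, the earlier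
  position first.\<close>

fun pair_sum :: "('a \<Rightarrow> 'a \<Rightarrow> real) \<Rightarrow> 'a list \<Rightarrow> real" where
  "pair_sum G [] = 0"
| "pair_sum G (x # xs) = letter_sum (G x) xs + pair_sum G xs"

text \<open>The number of triples of positions that carry the same letter. Unlike the indicator that
  some letter occurs three times, it is additive over positions and so has a closed form when summed
  over words.\<close>

fun triple_count :: "'a list \<Rightarrow> real" where
  "triple_count [] = 0"
| "triple_count (x # xs) = pair_sum (\<lambda>a b. of_bool (a = x \<and> b = x)) xs + triple_count xs"

text \<open>Mark one of the \<open>p\<close> positions: the marked letter contributes its weighted
  sum, the remaining positions range freely and contribute a power of the plain sum.\<close>

lemma sum_monomial_letter:
  "(\<Sum>xs\<in>words I p. monomial z xs * letter_sum h xs) = real p * (\<Sum>k\<in>I. z k) ^ (p - 1) * (\<Sum>k\<in>I. z k * h k)"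
proof (induction p)
  case (Suc p)
  let ?s = "\<Sum>k\<in>I. z k" let ?W = "words I p"
  have "(\<Sum>xs\<in>words I (Suc p). monomial z xs * letter_sum h xs) =
      (\<Sum>k\<in>I. (z k * h k) * (\<Sum>xs\<in>?W. monomial z xs) + z k * (\<Sum>xs\<in>?W. monomial z xs * letter_sum h xs))"
    unfolding sum_words_Suc sum_distrib_left sum.distrib[symmetric]
    by (intro sum.cong refl) (simp add: algebra_simps)
  also have "\<dots> = (\<Sum>k\<in>I. z k * h k) * ?s ^ p + ?s * (real p * ?s ^ (p - 1) * (\<Sum>k\<in>I. z k * h k))"
    by (simp add: sum_monomial Suc.IH sum.distrib sum_distrib_right)
  also have "\<dots> = real (Suc p) * ?s ^ (Suc p - 1) * (\<Sum>k\<in>I. z k * h k)"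
    by (cases p) (simp_all add: algebra_simps)
  finally show ?case .
qed simp

text \<open>The same with two marked positions. The truncated exponent \<open>p - 2\<close> is
  harmless, as the binomial coefficient vanishes for \<open>p\<close> below 2.\<close>

lemma sum_monomial_pair:
  "(\<Sum>xs\<in>words I p. monomial z xs * pair_sum G xs) =
    real (p choose 2) * (\<Sum>k\<in>I. z k) ^ (p - 2) * (\<Sum>a\<in>I. \<Sum>b\<in>I. z a * z b * G a b)"
proof (induction p)
  case (Suc p)
  let ?s = "\<Sum>k\<in>I. z k" let ?W = "words I p" let ?Q = "\<Sum>a\<in>I. \<Sum>b\<in>I. z a * z b * G a b"
  have "(\<Sum>xs\<in>words I (Suc p). monomial z xs * pair_sum G xs) =
      (\<Sum>k\<in>I. z k * (\<Sum>xs\<in>?W. monomial z xs * letter_sum (G k) xs) + z k * (\<Sum>xs\<in>?W. monomial z xs * pair_sum G xs))"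
    unfolding sum_words_Suc sum_distrib_left sum.distrib[symmetric]
    by (intro sum.cong refl) (simp add: algebra_simps)
  also have "\<dots> = (\<Sum>k\<in>I. z k * (real p * ?s ^ (p - 1) * (\<Sum>b\<in>I. z b * G k b))) + ?s * (real (p choose 2) * ?s ^ (p - 2) * ?Q)"
    by (simp only: sum_monomial_letter Suc.IH sum.distrib sum_distrib_right)
  also have "(\<Sum>k\<in>I. z k * (real p * ?s ^ (p - 1) * (\<Sum>b\<in>I. z b * G k b))) = real p * ?s ^ (p - 1) * ?Q"
    unfolding sum_distrib_left by (intro sum.cong refl) (simp only: mult_ac)
  also have "real p * ?s ^ (p - 1) * ?Q + ?s * (real (p choose 2) * ?s ^ (p - 2) * ?Q) = real (Suc p choose 2) * ?s ^ (Suc p - 2) * ?Q"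
  proof -
    consider "p = 0" | "p = 1" | q where "p = Suc (Suc q)" by (metis One_nat_def not0_implies_Suc)
    then show ?thesis by cases (simp_all add: numeral_2_eq_2 algebra_simps)
  qed
  finally show ?case .
qed simp

lemma sum_monomial_triple:
  assumes "finite I"
  shows "(\<Sum>xs\<in>words I p. monomial z xs * triple_count xs) =
    real (p choose 3) * (\<Sum>k\<in>I. z k) ^ (p - 3) * (\<Sum>a\<in>I. z a ^ 3)"
proof (induction p)
  case (Suc p)
  let ?s = "\<Sum>k\<in>I. z k" let ?W = "words I p" let ?T = "\<Sum>a\<in>I. z a ^ 3"
  let ?G = "\<lambda>k a b. of_bool (a = k \<and> b = k)"
  have sq: "(\<Sum>a\<in>I. \<Sum>b\<in>I. z a * z b * ?G k a b) = (z k)\<^sup>2" if "k \<in> I" for k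
  proof -
    have "(\<Sum>a\<in>I. \<Sum>b\<in>I. z a * z b * ?G k a b) = (\<Sum>a\<in>I. \<Sum>b\<in>I. if b = k then (if a = k then z k * z k else 0) else 0)"
      by (intro sum.cong refl) auto
    also have "\<dots> = (z k)\<^sup>2" using assms that by (simp add: power2_eq_square)
    finally show ?thesis .
  qed
  have "(\<Sum>xs\<in>words I (Suc p). monomial z xs * triple_count xs) =
      (\<Sum>k\<in>I. z k * (\<Sum>xs\<in>?W. monomial z xs * pair_sum (?G k) xs) + z k * (\<Sum>xs\<in>?W. monomial z xs * triple_count xs))"
    unfolding sum_words_Suc sum_distrib_left sum.distrib[symmetric]
    by (intro sum.cong refl) (simp add: algebra_simps)
  also have "\<dots> = (\<Sum>k\<in>I. z k * (real (p choose 2) * ?s ^ (p - 2) * (\<Sum>a\<in>I. \<Sum>b\<in>I. z a * z b * ?G k a b))) + ?s * (real (p choose 3) * ?s ^ (p - 3) * ?T)"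
    by (simp only: sum_monomial_pair Suc.IH sum.distrib sum_distrib_right)
  also have "(\<Sum>k\<in>I. z k * (real (p choose 2) * ?s ^ (p - 2) * (\<Sum>a\<in>I. \<Sum>b\<in>I. z a * z b * ?G k a b))) = real (p choose 2) * ?s ^ (p - 2) * ?T"
    unfolding sum_distrib_left[of _ "\<lambda>a. z a ^ 3"]
    by (rule sum.cong[OF refl], subst sq, assumption) (simp add: power2_eq_square power3_eq_cube)
  also have "real (p choose 2) * ?s ^ (p - 2) * ?T + ?s * (real (p choose 3) * ?s ^ (p - 3) * ?T) = real (Suc p choose 3) * ?s ^ (Suc p - 3) * ?T"
  proof -
    consider "p = 0" | "p = 1" | "p = 2" | q where "p = Suc (Suc (Suc q))"
      by (metis One_nat_def Suc_1 not0_implies_Suc)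
    then show ?thesis by cases (simp_all add: numeral_2_eq_2 numeral_3_eq_3 algebra_simps)
  qed
  finally show ?case .
qed simp

definition neighbour :: "nat \<Rightarrow> nat \<Rightarrow> real" where
  "neighbour a b = of_bool (b = Suc a) + of_bool (a = Suc b)"

lemma letter_sum_nonneg: "(\<And>x. 0 \<le> h x) \<Longrightarrow> 0 \<le> letter_sum h xs"
  by (induction xs) auto

lemma letter_sum_member: "(\<And>x. 0 \<le> h x) \<Longrightarrow> x \<in> set xs \<Longrightarrow> h x \<le> letter_sum h xs"
  by (induction xs) (auto simp: letter_sum_nonneg add_increasing add_increasing2)

lemma letter_sum_count: "letter_sum (\<lambda>b. of_bool (b = x)) xs = real (count_list xs x)"
  by (induction xs) auto

lemma letter_sum_zero: "letter_sum (\<lambda>b. 0) xs = 0"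
  by (induction xs) auto

lemma pair_sum_nonneg: "(\<And>x y. 0 \<le> G x y) \<Longrightarrow> 0 \<le> pair_sum G xs"
  by (induction xs) (auto simp: letter_sum_nonneg)

lemma pair_sum_count: "pair_sum (\<lambda>a b. of_bool (a = x \<and> b = x)) xs = real (count_list xs x choose 2)"
proof (induction xs)
  case (Cons y xs)
  then show ?case
    by (cases "y = x") (simp_all add: letter_sum_count letter_sum_zero numeral_2_eq_2)
qed simp

lemma triple_count_nonneg: "0 \<le> triple_count xs"
  by (induction xs) (auto simp: pair_sum_nonneg)

lemma pair_sum_neighbour_ge_1: "\<not> spaced xs \<Longrightarrow> 1 \<le> pair_sum neighbour xs"
proof (induction xs)
  case (Cons x xs)
  have nn: "0 \<le> neighbour a b" for a b by (simp add: neighbour_def)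
  show ?case
  proof (cases "spaced xs")
    case True
    then obtain y where y: "y \<in> set xs" "y = Suc x \<or> x = Suc y"
      using Cons.prems by (auto simp: spaced_def)
    then have "1 \<le> neighbour x y" by (auto simp: neighbour_def)
    also have "\<dots> \<le> letter_sum (neighbour x) xs" by (rule letter_sum_member) (use nn y in auto)
    finally show ?thesis using pair_sum_nonneg[of neighbour xs, OF nn] by simp
  next
    case False
    then show ?thesis using Cons.IH letter_sum_nonneg[of "neighbour x" xs, OF nn] by simp
  qed
qed (simp add: spaced_def)

lemma triple_count_ge_1: "count_list xs x > 2 \<Longrightarrow> 1 \<le> triple_count xs"
proof (induction xs)
  case (Cons y xs)
  show ?case
  proof (cases "count_list xs x > 2")
    case True
    then show ?thesis using Cons.IH by (simp add: pair_sum_nonneg add_increasing)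
  next
    case False
    then have "y = x" "count_list xs x = 2" using Cons.prems by (auto split: if_splits)
    then have "pair_sum (\<lambda>a b. of_bool (a = y \<and> b = y)) xs = 1" by (simp add: pair_sum_count)
    then show ?thesis using triple_count_nonneg[of xs] by simp
  qed
qed simp

section \<open>Moments and linear combinations of independent standard Gaussian variables\<close>

abbreviation gauss_moment :: "nat \<Rightarrow> real" where
  "gauss_moment j \<equiv> (\<integral>x. x ^ j \<partial>std_normal_distribution)"

lemma gauss_moment_nonneg: "0 \<le> gauss_moment j"
proof (cases "even j")
  case True
  then show ?thesis by (auto elim!: evenE simp: std_normal_distribution_even_moments)
next
  case False
  then show ?thesis by (simp add: integral_std_normal_distribution_moment_odd)
qed

lemma gauss_moment_values:
  "gauss_moment 0 = 1" "gauss_moment (Suc 0) = 0" "gauss_moment 2 = 1" "gauss_moment 3 = 0" "gauss_moment 4 = 3" "gauss_moment 6 = 15"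
  using std_normal_distribution_even_moments(1)[of 0] std_normal_distribution_even_moments(1)[of 1]
    std_normal_distribution_even_moments(1)[of 2] std_normal_distribution_even_moments(1)[of 3]
    integral_std_normal_distribution_moment_odd[of "Suc 0"] integral_std_normal_distribution_moment_odd[of 3]
  by (simp_all add: fact_numeral)

context prob_space begin

lemma expectation_monomial:
  fixes X :: "'i \<Rightarrow> 'a \<Rightarrow> real"
  assumes "finite I" "indep_vars (\<lambda>_. borel) X I" "\<And>k j. k \<in> I \<Longrightarrow> integrable M (\<lambda>\<omega>. X k \<omega> ^ j)" "set xs \<subseteq> I"
  shows "integrable M (\<lambda>\<omega>. monomial (\<lambda>k. X k \<omega>) xs)"
    and "expectation (\<lambda>\<omega>. monomial (\<lambda>k. X k \<omega>) xs) = (\<Prod>k\<in>I. expectation (\<lambda>\<omega>. X k \<omega> ^ count_list xs k))"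
proof -
  have "indep_vars (\<lambda>_. borel) (\<lambda>k \<omega>. X k \<omega> ^ count_list xs k) I"
    by (rule indep_vars_compose2[OF assms(2)]) auto
  from indep_vars_integrable[OF assms(1) this assms(3)] indep_vars_lebesgue_integral[OF assms(1) this assms(3)]
  show "integrable M (\<lambda>\<omega>. monomial (\<lambda>k. X k \<omega>) xs)"
    and "expectation (\<lambda>\<omega>. monomial (\<lambda>k. X k \<omega>) xs) = (\<Prod>k\<in>I. expectation (\<lambda>\<omega>. X k \<omega> ^ count_list xs k))"
    by (simp_all add: monomial_count[OF assms(1,4)])
qed

lemma expectation_std_normal:
  assumes X: "X \<in> borel_measurable M" "distr M borel X = std_normal_distribution"
    and f: "f \<in> borel_measurable borel"
  shows "expectation (\<lambda>\<omega>. f (X \<omega>) :: real) = (\<integral>x. f x \<partial>std_normal_distribution)"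
    and "integrable std_normal_distribution f \<Longrightarrow> integrable M (\<lambda>\<omega>. f (X \<omega>))"
  unfolding X(2)[symmetric] using X(1) f by (simp_all add: integral_distr integrable_distr_eq)

lemma char_scaled:
  assumes "X \<in> borel_measurable M"
  shows "char (distr M borel (\<lambda>\<omega>. a * X \<omega>)) t = char (distr M borel X) (t * a)"
  using assms by (simp add: char_def integral_distr mult_ac)

text \<open>Both sides have the same characteristic function. Stating the law as a scaled standard
  normal covers the degenerate case in which all \<open>a k\<close> vanish.\<close>

lemma gaussian_linear_combination:
  assumes I: "finite I" and ind: "indep_vars (\<lambda>_. borel) X I"
    and N: "\<And>k. k \<in> I \<Longrightarrow> distr M borel (X k) = std_normal_distribution"
  shows "distr M borel (\<lambda>\<omega>. \<Sum>k\<in>I. a k * X k \<omega>) = distr std_normal_distribution borel (\<lambda>x. sqrt (\<Sum>k\<in>I. (a k)\<^sup>2) * x)"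
proof (rule Levy_uniqueness)
  have rv: "X k \<in> borel_measurable M" if "k \<in> I" for k using ind that by (auto simp: indep_vars_def)
  interpret N: prob_space std_normal_distribution by (rule prob_space_normal_density) simp
  have ind': "indep_vars (\<lambda>_. borel) (\<lambda>k \<omega>. a k * X k \<omega>) I"
    by (rule indep_vars_compose2[OF ind]) auto
  show "real_distribution (distr M borel (\<lambda>\<omega>. \<Sum>k\<in>I. a k * X k \<omega>))"
    using rv by (intro real_distribution_distr) auto
  show "real_distribution (distr std_normal_distribution borel (\<lambda>x. sqrt (\<Sum>k\<in>I. (a k)\<^sup>2) * x))"
    by (intro N.real_distribution_distr) auto
  show "char (distr M borel (\<lambda>\<omega>. \<Sum>k\<in>I. a k * X k \<omega>)) = char (distr std_normal_distribution borel (\<lambda>x. sqrt (\<Sum>k\<in>I. (a k)\<^sup>2) * x))"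
  proof
    fix t
    have idd: "distr std_normal_distribution borel (\<lambda>x. x) = std_normal_distribution"
      by (rule distr_id2) simp
    have "char (distr M borel (\<lambda>\<omega>. \<Sum>k\<in>I. a k * X k \<omega>)) t = (\<Prod>k\<in>I. char (distr M borel (\<lambda>\<omega>. a k * X k \<omega>)) t)"
      by (rule char_distr_sum[OF ind'])
    also have "\<dots> = (\<Prod>k\<in>I. of_real (exp (- (t * a k)\<^sup>2 / 2)))"
      by (intro prod.cong refl) (simp add: char_scaled rv N char_std_normal_distribution)
    also have "\<dots> = of_real (exp (\<Sum>k\<in>I. - (t * a k)\<^sup>2 / 2))"
      by (simp add: exp_sum I)
    also have "(\<Sum>k\<in>I. - (t * a k)\<^sup>2 / 2) = - (t\<^sup>2 * (\<Sum>k\<in>I. (a k)\<^sup>2)) / 2"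
      by (simp add: sum_distrib_left sum_divide_distrib sum_negf power_mult_distrib)
    also have "of_real (exp \<dots>) = char (distr std_normal_distribution borel (\<lambda>x. sqrt (\<Sum>k\<in>I. (a k)\<^sup>2) * x)) t"
      using N.char_scaled[of "\<lambda>x. x" "sqrt (\<Sum>k\<in>I. (a k)\<^sup>2)" t]
      by (simp add: idd char_std_normal_distribution power_mult_distrib sum_nonneg)
    finally show "char (distr M borel (\<lambda>\<omega>. \<Sum>k\<in>I. a k * X k \<omega>)) t = char (distr std_normal_distribution borel (\<lambda>x. sqrt (\<Sum>k\<in>I. (a k)\<^sup>2) * x)) t" .
  qed
qed

end


lemma monomial_mult: "monomial (\<lambda>k. a k * b k) xs = monomial a xs * (monomial b xs :: 'b :: comm_monoid_mult)"
  by (induction xs) (simp_all add: mult_ac)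

lemma neighbour_nonneg: "0 \<le> neighbour a b"
  by (simp add: neighbour_def)

lemma neighbour_cases: "neighbour a b = 0 \<or> neighbour a b = 1 \<and> a \<noteq> b"
  by (cases "b = Suc a"; cases "a = Suc b") (auto simp: neighbour_def)

section \<open>Second moments of polynomials in the scaled coefficients\<close>

locale gaussian_family = prob_space M for M :: "'a measure" +
  fixes I :: "nat set" and X :: "nat \<Rightarrow> 'a \<Rightarrow> real"
  assumes finI: "finite I" and neI: "I \<noteq> {}"
    and indep: "indep_vars (\<lambda>_. borel) X I"
    and std: "k \<in> I \<Longrightarrow> distr M borel (X k) = std_normal_distribution"
begin

lemma rv: "k \<in> I \<Longrightarrow> X k \<in> borel_measurable M"
  using indep by (auto simp: indep_vars_def)

lemma integrable_X_power: "k \<in> I \<Longrightarrow> integrable M (\<lambda>\<omega>. X k \<omega> ^ j)"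
  by (rule expectation_std_normal(2)[OF rv std]) (auto simp: integrable_std_normal_distribution_moment)

lemma expectation_X_power: "k \<in> I \<Longrightarrow> expectation (\<lambda>\<omega>. X k \<omega> ^ j) = gauss_moment j"
  by (rule expectation_std_normal(1)[OF rv std]) auto

abbreviation m :: real where "m \<equiv> real (card I)"

lemma m_pos: "0 < m"
  using finI neI by (simp add: card_gt_0_iff)

text \<open>With this scaling \<open>Y\<close> has variance exactly 1 and \<open>V\<close> has mean
  1. For the matrix model \<open>m\<close> will be \<open>N - 1\<close>.\<close>

definition y :: "'a \<Rightarrow> nat \<Rightarrow> real" where
  "y \<omega> k = 1 / sqrt m * X k \<omega>"

lemma integrable_monomial: "set xs \<subseteq> I \<Longrightarrow> integrable M (\<lambda>\<omega>. monomial (y \<omega>) xs)"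
  unfolding y_def[abs_def] monomial_scale
  by (intro integrable_mult_right expectation_monomial(1)[OF finI indep integrable_X_power])

lemma expectation_monomial_y:
  "set xs \<subseteq> I \<Longrightarrow> expectation (\<lambda>\<omega>. monomial (y \<omega>) xs) = (1 / sqrt m) ^ length xs * (\<Prod>k\<in>I. gauss_moment (count_list xs k))"
  unfolding y_def[abs_def] monomial_scale
  by (simp add: expectation_monomial(2)[OF finI indep integrable_X_power] expectation_X_power)

lemma expectation_monomial_nonneg: "set xs \<subseteq> I \<Longrightarrow> 0 \<le> expectation (\<lambda>\<omega>. monomial (y \<omega>) xs)"
  by (simp add: expectation_monomial_y prod_nonneg gauss_moment_nonneg)

lemma expectation_monomial_zero:
  assumes "set xs \<subseteq> I" "k \<in> set xs" "count_list xs k = 1 \<or> count_list xs k = 3"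
  shows "expectation (\<lambda>\<omega>. monomial (y \<omega>) xs) = 0"
proof -
  have "gauss_moment (count_list xs k) = 0" using assms(3) gauss_moment_values by auto
  then have "(\<Prod>k\<in>I. gauss_moment (count_list xs k)) = 0" using finI assms by (intro prod_zero) auto
  then show ?thesis using assms(1) by (simp add: expectation_monomial_y)
qed

lemma expectation_product_sums:
  assumes "\<And>i. i \<in> A \<Longrightarrow> set (u i) \<subseteq> I" "\<And>j. j \<in> B \<Longrightarrow> set (v j) \<subseteq> I"
  shows "integrable M (\<lambda>\<omega>. (\<Sum>i\<in>A. f i * monomial (y \<omega>) (u i)) * (\<Sum>j\<in>B. g j * monomial (y \<omega>) (v j)))" (is ?i)
    and "expectation (\<lambda>\<omega>. (\<Sum>i\<in>A. f i * monomial (y \<omega>) (u i)) * (\<Sum>j\<in>B. g j * monomial (y \<omega>) (v j))) =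
      (\<Sum>i\<in>A. \<Sum>j\<in>B. f i * g j * expectation (\<lambda>\<omega>. monomial (y \<omega>) (u i @ v j)))" (is ?e)
proof -
  have eq: "(\<Sum>i\<in>A. f i * monomial (y \<omega>) (u i)) * (\<Sum>j\<in>B. g j * monomial (y \<omega>) (v j)) =
     (\<Sum>i\<in>A. \<Sum>j\<in>B. f i * g j * monomial (y \<omega>) (u i @ v j))" for \<omega>
    unfolding sum_product monomial_append by (intro sum.cong refl) (simp only: mult_ac)
  have int: "integrable M (\<lambda>\<omega>. f i * g j * monomial (y \<omega>) (u i @ v j))" if "i \<in> A" "j \<in> B" for i j
    using assms that by (intro integrable_mult_right integrable_monomial) auto
  show ?i unfolding eq using int by (intro Bochner_Integration.integrable_sum)
  show ?e unfolding eq using int by (simp add: Bochner_Integration.integral_sum Bochner_Integration.integrable_sum)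
qed

text \<open>\<open>Y\<close> and \<open>V\<close> become the parameters of the approximating
  Gaussian measure. \<open>Q\<close> and \<open>T\<close> are the factors that
  \<open>sum_monomial_pair\<close> with \<open>neighbour\<close> and
  \<open>sum_monomial_triple\<close> leave behind.\<close>

definition Y :: "'a \<Rightarrow> real" where "Y \<omega> = (\<Sum>k\<in>I. y \<omega> k)"
definition V :: "'a \<Rightarrow> real" where "V \<omega> = (\<Sum>k\<in>I. (y \<omega> k)\<^sup>2)"
definition Q :: "'a \<Rightarrow> real" where "Q \<omega> = (\<Sum>a\<in>I. \<Sum>b\<in>I. y \<omega> a * y \<omega> b * neighbour a b)"
definition T :: "'a \<Rightarrow> real" where "T \<omega> = (\<Sum>a\<in>I. y \<omega> a ^ 3)"

lemma y_measurable [measurable]: "k \<in> I \<Longrightarrow> (\<lambda>\<omega>. y \<omega> k) \<in> borel_measurable M"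
  unfolding y_def using rv by simp

lemma Y_measurable [measurable]: "Y \<in> borel_measurable M"
  and V_measurable [measurable]: "V \<in> borel_measurable M"
  and Q_measurable [measurable]: "Q \<in> borel_measurable M"
  and T_measurable [measurable]: "T \<in> borel_measurable M"
  unfolding Y_def[abs_def] V_def[abs_def] Q_def[abs_def] T_def[abs_def] by simp_all

lemma distr_Y: "distr M borel Y = std_normal_distribution"
proof -
  have Y: "Y = (\<lambda>\<omega>. \<Sum>k\<in>I. 1 / sqrt m * X k \<omega>)" by (auto simp: Y_def y_def)
  have "sqrt (\<Sum>k\<in>I. (1 / sqrt m)\<^sup>2) = 1" using m_pos by (simp add: power_divide)
  then have "distr M borel Y = distr std_normal_distribution borel (\<lambda>x. x)"
    unfolding Y using gaussian_linear_combination[OF finI indep std, of "\<lambda>_. 1 / sqrt m"] by simp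
  then show ?thesis by (simp add: distr_id2)
qed

lemma integrable_Y_power: "integrable M (\<lambda>\<omega>. Y \<omega> ^ j)"
  by (rule expectation_std_normal(2)[OF Y_measurable distr_Y]) (auto simp: integrable_std_normal_distribution_moment)

lemma expectation_Y_power: "expectation (\<lambda>\<omega>. Y \<omega> ^ j) = gauss_moment j"
  by (rule expectation_std_normal(1)[OF Y_measurable distr_Y]) auto

lemma Q_alt: "Q \<omega> = (\<Sum>i\<in>I \<times> I. neighbour (fst i) (snd i) * monomial (y \<omega>) [fst i, snd i])"
  unfolding Q_def sum.cartesian_product by (intro sum.cong refl) auto

lemma T_alt: "T \<omega> = (\<Sum>a\<in>I. 1 * monomial (y \<omega>) [a, a, a])"
  unfolding T_def by (simp add: power3_eq_cube mult_ac)

text \<open>A product over two pairs of distinct indices has nonzero mean only if the pairs agree up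
  to order, and then its mean is \<open>1 / m\<^sup>2\<close>. Two orders and at most
  \<open>2 * m\<close> neighbouring pairs give \<open>4 / m\<close>.\<close>

lemma Q_second_moment: "integrable M (\<lambda>\<omega>. (Q \<omega>)\<^sup>2)" "expectation (\<lambda>\<omega>. (Q \<omega>)\<^sup>2) \<le> 4 / m"
proof -
  let ?u = "\<lambda>i. [fst i, snd i :: nat]" and ?f = "\<lambda>i. neighbour (fst i) (snd i)"
  have Q: "(Q \<omega>)\<^sup>2 = (\<Sum>i\<in>I \<times> I. ?f i * monomial (y \<omega>) (?u i)) * (\<Sum>j\<in>I \<times> I. ?f j * monomial (y \<omega>) (?u j))" for \<omega>
    unfolding Q_alt power2_eq_square ..
  have sub: "set (?u i) \<subseteq> I" if "i \<in> I \<times> I" for i using that by auto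
  note ps = expectation_product_sums[where A = "I \<times> I" and B = "I \<times> I" and u = ?u and v = ?u and f = ?f and g = ?f, OF sub sub]
  show "integrable M (\<lambda>\<omega>. (Q \<omega>)\<^sup>2)" unfolding Q by (rule ps(1)) auto
  have summand: "neighbour a b * neighbour c d * expectation (\<lambda>\<omega>. monomial (y \<omega>) ([a, b] @ [c, d])) \<le>
      neighbour a b * (1 / m\<^sup>2) * (of_bool (c = a \<and> d = b) + of_bool (c = b \<and> d = a))"
    if "a \<in> I" "b \<in> I" "c \<in> I" "d \<in> I" for a b c d
  proof -
    have nn: "0 \<le> neighbour a b * (1 / m\<^sup>2) * (of_bool (c = a \<and> d = b) + of_bool (c = b \<and> d = a))"
      by (intro mult_nonneg_nonneg add_nonneg_nonneg neighbour_nonneg) simp_all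
    show ?thesis
    proof (cases "neighbour a b = 0 \<or> neighbour c d = 0")
      case True
      note nn
      moreover have "neighbour a b * neighbour c d = 0" using True by simp
      ultimately show ?thesis by (simp only: mult_zero_left)
    next
      case False
      then have ne: "a \<noteq> b" "c \<noteq> d" and n1: "neighbour a b = 1" "neighbour c d = 1"
        using neighbour_cases[of a b] neighbour_cases[of c d] by auto
      have subs: "set [a, b, c, d] \<subseteq> I" using that by auto
      show ?thesis
      proof (cases "(c = a \<and> d = b) \<or> (c = b \<and> d = a)")
        case True
        have "(\<Prod>k\<in>I. gauss_moment (count_list [a, b, c, d] k)) = 1"
        proof (rule prod.neutral, rule ballI)
          fix k
          have "count_list [a, b, c, d] k = 0 \<or> count_list [a, b, c, d] k = 2"
            using True ne by auto
          then show "gauss_moment (count_list [a, b, c, d] k) = 1"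
            using gauss_moment_values(1,3) by (elim disjE) (simp_all only:)
        qed
        then have "expectation (\<lambda>\<omega>. monomial (y \<omega>) ([a, b] @ [c, d])) = 1 / m\<^sup>2"
          using expectation_monomial_y[OF subs] m_pos
          by (simp add: power_divide numeral_eq_Suc)
        moreover have "1 \<le> of_bool (c = a \<and> d = b) + (of_bool (c = b \<and> d = a) :: real)" using True by auto
        ultimately show ?thesis using m_pos by (simp add: n1 divide_right_mono del: monomial_Cons)
      next
        case False
        then have "count_list [a, b, c, d] a = 1 \<or> count_list [a, b, c, d] b = 1" using ne by auto
        then obtain k where k: "k \<in> set [a, b, c, d]" "count_list [a, b, c, d] k = 1 \<or> count_list [a, b, c, d] k = 3"
          by (meson list.set_intros)
        have "expectation (\<lambda>\<omega>. monomial (y \<omega>) ([a, b] @ [c, d])) = 0"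
          using expectation_monomial_zero[OF subs k] by simp
        with nn show ?thesis by (simp only: mult_zero_right)
        qed
  qed
  qed
  have "expectation (\<lambda>\<omega>. (Q \<omega>)\<^sup>2) = (\<Sum>i\<in>I \<times> I. \<Sum>j\<in>I \<times> I. ?f i * ?f j * expectation (\<lambda>\<omega>. monomial (y \<omega>) (?u i @ ?u j)))"
    unfolding Q by (rule ps(2)) auto
  also have "\<dots> \<le> (\<Sum>i\<in>I \<times> I. \<Sum>j\<in>I \<times> I. ?f i * (1 / m\<^sup>2) * (of_bool (j = i) + of_bool (j = prod.swap i)))"
  proof (intro sum_mono)
    fix i j assume "i \<in> I \<times> I" "j \<in> I \<times> I"
    then obtain a b c d where "i = (a, b)" "j = (c, d)" "a \<in> I" "b \<in> I" "c \<in> I" "d \<in> I" by blast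
    then show "?f i * ?f j * expectation (\<lambda>\<omega>. monomial (y \<omega>) (?u i @ ?u j)) \<le> ?f i * (1 / m\<^sup>2) * (of_bool (j = i) + of_bool (j = prod.swap i))"
      using summand[of a b c d] by (simp only: prod.swap_def fst_conv snd_conv prod.inject)
  qed
  also have "\<dots> = (\<Sum>i\<in>I \<times> I. ?f i * (1 / m\<^sup>2) * 2)"
  proof (intro sum.cong refl)
    fix i assume i: "i \<in> I \<times> I"
    then have "prod.swap i \<in> I \<times> I" by (cases i) auto
    with i have "(\<Sum>j\<in>I \<times> I. of_bool (j = i) + (of_bool (j = prod.swap i) :: real)) = 2"
      using finI by (simp add: sum.distrib of_bool_def sum.delta)
    then show "(\<Sum>j\<in>I \<times> I. ?f i * (1 / m\<^sup>2) * (of_bool (j = i) + of_bool (j = prod.swap i))) = ?f i * (1 / m\<^sup>2) * 2"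
      unfolding sum_distrib_left[symmetric] by simp
  qed
  also have "\<dots> = 2 / m\<^sup>2 * (\<Sum>a\<in>I. \<Sum>b\<in>I. neighbour a b)"
    unfolding sum.cartesian_product sum_distrib_left by (intro sum.cong refl) auto
  also have "\<dots> \<le> 2 / m\<^sup>2 * (\<Sum>a\<in>I. 2)"
  proof (intro mult_left_mono sum_mono)
    fix a
    have 1: "(\<Sum>b\<in>I. of_bool (b = Suc a)) \<le> (1 :: real)" using finI by (simp add: of_bool_def sum.delta)
    have "(\<Sum>b\<in>I. of_bool (a = Suc b)) = (\<Sum>b\<in>I. (if b = a - 1 then of_bool (0 < a) else 0) :: real)"
      by (intro sum.cong refl) auto
    also have "\<dots> \<le> 1" using finI by simp
    finally show "(\<Sum>b\<in>I. neighbour a b) \<le> 2" using 1 by (simp add: neighbour_def sum.distrib)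
  qed auto
  also have "\<dots> = 4 / m" using m_pos by (simp add: power2_eq_square)
  finally show "expectation (\<lambda>\<omega>. (Q \<omega>)\<^sup>2) \<le> 4 / m" .
qed

text \<open>Odd moments kill the off-diagonal terms, and the sixth moment 15 gives
  \<open>15 / m\<^sup>2\<close>. The weaker \<open>15 / m\<close> has the form expected by
  \<open>expectation_Y_power_times\<close>.\<close>

lemma T_second_moment: "integrable M (\<lambda>\<omega>. (T \<omega>)\<^sup>2)" "expectation (\<lambda>\<omega>. (T \<omega>)\<^sup>2) \<le> 15 / m"
proof -
  let ?u = "\<lambda>a. [a, a, a :: nat]" and ?f = "\<lambda>_ :: nat. 1 :: real"
  have T: "(T \<omega>)\<^sup>2 = (\<Sum>i\<in>I. ?f i * monomial (y \<omega>) (?u i)) * (\<Sum>j\<in>I. ?f j * monomial (y \<omega>) (?u j))" for \<omega>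
    unfolding T_alt power2_eq_square ..
  have sub: "set (?u i) \<subseteq> I" if "i \<in> I" for i using that by auto
  note ps = expectation_product_sums[where A = I and B = I and u = ?u and v = ?u and f = ?f and g = ?f, OF sub sub]
  show "integrable M (\<lambda>\<omega>. (T \<omega>)\<^sup>2)" unfolding T by (rule ps(1)) auto
  have summand: "?f a * ?f b * expectation (\<lambda>\<omega>. monomial (y \<omega>) (?u a @ ?u b)) = (if b = a then 15 / m ^ 3 else 0)"
    if "a \<in> I" "b \<in> I" for a b
  proof (cases "a = b")
    case True
    have "(\<Prod>k\<in>I. gauss_moment (count_list (?u a @ ?u b) k)) = (\<Prod>k\<in>I. if k = a then 15 else 1)"
      using gauss_moment_values(1,6) True by (intro prod.cong refl) (auto simp: numeral_eq_Suc)
    also have "\<dots> = 15" using that finI by simp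
    finally have "expectation (\<lambda>\<omega>. monomial (y \<omega>) (?u a @ ?u b)) = (1 / sqrt m) ^ 6 * 15"
      using expectation_monomial_y[of "?u a @ ?u b"] that
      by (simp only: length_append list.size) (simp add: eval_nat_numeral del: monomial_Cons count_list.simps)
    also have "(1 / sqrt m) ^ 6 = 1 / m ^ 3"
    proof -
      have "(1 / sqrt m) ^ 6 = ((1 / sqrt m)\<^sup>2) ^ 3" by (simp add: power_mult[symmetric])
      then show ?thesis using m_pos by (simp add: power_divide)
    qed
    finally show ?thesis using True by simp
  next
    case False
    then have "expectation (\<lambda>\<omega>. monomial (y \<omega>) (?u a @ ?u b)) = 0"
      using that by (intro expectation_monomial_zero[of _ a]) auto
    with False show ?thesis by simp
  qed
  have "expectation (\<lambda>\<omega>. (T \<omega>)\<^sup>2) = (\<Sum>i\<in>I. \<Sum>j\<in>I. ?f i * ?f j * expectation (\<lambda>\<omega>. monomial (y \<omega>) (?u i @ ?u j)))"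
    unfolding T by (rule ps(2)) auto
  also have "\<dots> = (\<Sum>i\<in>I. \<Sum>j\<in>I. if j = i then 15 / m ^ 3 else 0)"
    by (intro sum.cong refl) (rule summand)
  also have "\<dots> = m * (15 / m ^ 3)" using finI by simp
  also have "\<dots> = 15 / m / m" using m_pos by (simp add: power3_eq_cube)
  also have "\<dots> \<le> 15 / m"
  proof -
    have "1 \<le> card I" using finI neI by (simp add: Suc_leI card_gt_0_iff)
    then have "1 \<le> m" by simp
    then show ?thesis by (simp add: divide_le_eq)
  qed
  finally show "expectation (\<lambda>\<omega>. (T \<omega>)\<^sup>2) \<le> 15 / m" .
qed

text \<open>The second moment of \<open>V\<close> exceeds 1 only through the diagonal, where the
  fourth moment 3 replaces 1; its \<open>m\<close> terms contribute \<open>2 / m\<^sup>2\<close>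
  each.\<close>

lemma V_second_moment: "integrable M (\<lambda>\<omega>. (V \<omega> - 1)\<^sup>2)" "expectation (\<lambda>\<omega>. (V \<omega> - 1)\<^sup>2) = 2 / m"
proof -
  let ?u = "\<lambda>a. [a, a :: nat]" and ?f = "\<lambda>_ :: nat. 1 :: real"
  have V: "V \<omega> = (\<Sum>i\<in>I. ?f i * monomial (y \<omega>) (?u i))" for \<omega>
    by (simp add: V_def power2_eq_square)
  have sub: "set (?u i) \<subseteq> I" if "i \<in> I" for i using that by auto
  note ps = expectation_product_sums[where A = I and B = I and u = ?u and v = ?u and f = ?f and g = ?f, OF sub sub]
  have mom2: "expectation (\<lambda>\<omega>. monomial (y \<omega>) (?u a)) = 1 / m" if "a \<in> I" for a
  proof -
    have "(\<Prod>k\<in>I. gauss_moment (count_list (?u a) k)) = (\<Prod>k\<in>I. 1)"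
      using gauss_moment_values(1,3) by (intro prod.cong refl) (auto simp: numeral_eq_Suc)
    then have "expectation (\<lambda>\<omega>. monomial (y \<omega>) (?u a)) = (1 / sqrt m) ^ length (?u a) * 1"
      using expectation_monomial_y[of "?u a"] that by (simp del: monomial_Cons)
    then show ?thesis using m_pos by (simp del: monomial_Cons)
  qed
  have summand: "?f a * ?f b * expectation (\<lambda>\<omega>. monomial (y \<omega>) (?u a @ ?u b)) = 1 / m\<^sup>2 + (if b = a then 2 / m\<^sup>2 else 0)"
    if "a \<in> I" "b \<in> I" for a b
  proof -
    have "(\<Prod>k\<in>I. gauss_moment (count_list (?u a @ ?u b) k)) = (\<Prod>k\<in>I. if k = a \<and> a = b then 3 else 1)"
      using gauss_moment_values(1,3,5) by (intro prod.cong refl) (auto simp: numeral_eq_Suc)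
    also have "\<dots> = (if a = b then 3 else 1)" using that finI by (cases "a = b") auto
    finally have "expectation (\<lambda>\<omega>. monomial (y \<omega>) (?u a @ ?u b)) = (1 / sqrt m) ^ length (?u a @ ?u b) * (if a = b then 3 else 1)"
      using expectation_monomial_y[of "?u a @ ?u b"] that by (simp del: monomial_Cons)
    also have "(1 / sqrt m) ^ length (?u a @ ?u b) = 1 / m\<^sup>2"
      using m_pos by (simp add: power_divide numeral_eq_Suc)
    finally show ?thesis by (simp add: field_simps del: monomial_Cons)
  qed
  have intV: "integrable M V" unfolding V[abs_def] by (intro Bochner_Integration.integrable_sum integrable_mult_right integrable_monomial sub)
  have EV: "expectation V = 1"
  proof -
    have "expectation V = (\<Sum>i\<in>I. ?f i * expectation (\<lambda>\<omega>. monomial (y \<omega>) (?u i)))"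
      unfolding V[abs_def]
      by (subst Bochner_Integration.integral_sum) (auto intro!: integrable_mult_right integrable_monomial simp del: monomial_Cons)
    also have "\<dots> = (\<Sum>i\<in>I. 1 / m)" by (intro sum.cong refl) (simp only: mom2 mult_1)
    finally show ?thesis using m_pos by simp
  qed
  have intV2: "integrable M (\<lambda>\<omega>. V \<omega> * V \<omega>)" unfolding V by (rule ps(1)) auto
  have "expectation (\<lambda>\<omega>. V \<omega> * V \<omega>) = (\<Sum>i\<in>I. \<Sum>j\<in>I. ?f i * ?f j * expectation (\<lambda>\<omega>. monomial (y \<omega>) (?u i @ ?u j)))"
    unfolding V by (rule ps(2)) auto
  also have "\<dots> = (\<Sum>i\<in>I. \<Sum>j\<in>I. 1 / m\<^sup>2 + (if j = i then 2 / m\<^sup>2 else 0))"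
    by (intro sum.cong refl) (rule summand)
  also have "\<dots> = 1 + 2 / m" using finI m_pos neI by (simp add: sum.distrib power2_eq_square distrib_left)
  finally have EV2: "expectation (\<lambda>\<omega>. V \<omega> * V \<omega>) = 1 + 2 / m" .
  have sq: "(V \<omega> - 1)\<^sup>2 = V \<omega> * V \<omega> - 2 * V \<omega> + 1" for \<omega> by (simp add: power2_eq_square algebra_simps)
  show "integrable M (\<lambda>\<omega>. (V \<omega> - 1)\<^sup>2)" unfolding sq using intV intV2 by simp
  show "expectation (\<lambda>\<omega>. (V \<omega> - 1)\<^sup>2) = 2 / m"
    unfolding sq using intV intV2 by (simp add: EV EV2 prob_space)
qed

text \<open>The inequality between arithmetic and geometric mean, with weight \<open>sqrt m\<close>,
  balances the bounded moments of \<open>Y\<close> against a second moment of \<open>W\<close> of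
  order \<open>1 / m\<close>; both halves become of order \<open>1 / sqrt m\<close>.\<close>

lemma expectation_Y_power_times:
  assumes W: "W \<in> borel_measurable M" "integrable M (\<lambda>\<omega>. (W \<omega>)\<^sup>2)" "expectation (\<lambda>\<omega>. (W \<omega>)\<^sup>2) \<le> K / m"
  shows "integrable M (\<lambda>\<omega>. Y \<omega> ^ j * W \<omega>)"
    and "expectation (\<lambda>\<omega>. Y \<omega> ^ j * W \<omega>) \<le> (gauss_moment (2 * j) + K) / 2 / sqrt m"
proof -
  note sm = m_pos
  have amgm: "\<bar>a * b\<bar> \<le> (a\<^sup>2 / s + b\<^sup>2 * s) / 2" if "0 < s" for a b s :: real
  proof -
    have "0 \<le> (\<bar>a\<bar> / sqrt s - \<bar>b\<bar> * sqrt s)\<^sup>2" by simp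
    also have "\<dots> = a\<^sup>2 / s + b\<^sup>2 * s - 2 * \<bar>a * b\<bar>"
      using that by (simp add: power2_diff power_divide power_mult_distrib abs_mult)
    finally show ?thesis by simp
  qed
  have b: "\<bar>Y \<omega> ^ j * W \<omega>\<bar> \<le> (Y \<omega> ^ (2 * j) / sqrt m + (W \<omega>)\<^sup>2 * sqrt m) / 2" for \<omega>
    using amgm[of "sqrt m" "Y \<omega> ^ j" "W \<omega>"] sm by (simp add: power_mult[symmetric] mult.commute)
  have int: "integrable M (\<lambda>\<omega>. (Y \<omega> ^ (2 * j) / sqrt m + (W \<omega>)\<^sup>2 * sqrt m) / 2)"
    using integrable_Y_power W by simp
  show i: "integrable M (\<lambda>\<omega>. Y \<omega> ^ j * W \<omega>)"
  proof (rule Bochner_Integration.integrable_bound[OF int _ AE_I2])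
    show "(\<lambda>\<omega>. Y \<omega> ^ j * W \<omega>) \<in> borel_measurable M" using W(1) by simp
    show "norm (Y \<omega> ^ j * W \<omega>) \<le> norm ((Y \<omega> ^ (2 * j) / sqrt m + (W \<omega>)\<^sup>2 * sqrt m) / 2)" for \<omega>
      unfolding real_norm_def by (rule order_trans[OF b abs_ge_self])
  qed
  have "expectation (\<lambda>\<omega>. Y \<omega> ^ j * W \<omega>) \<le> expectation (\<lambda>\<omega>. (Y \<omega> ^ (2 * j) / sqrt m + (W \<omega>)\<^sup>2 * sqrt m) / 2)"
    by (intro integral_mono i int order_trans[OF abs_ge_self b])
  also have "\<dots> = (gauss_moment (2 * j) / sqrt m + expectation (\<lambda>\<omega>. (W \<omega>)\<^sup>2) * sqrt m) / 2"
    using integrable_Y_power W(2) by (simp add: expectation_Y_power)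
  also have "\<dots> \<le> (gauss_moment (2 * j) / sqrt m + K / m * sqrt m) / 2"
    using W(3) by (intro divide_right_mono add_left_mono mult_right_mono) auto
  also have "K / m * sqrt m = K / sqrt m" using sm by (simp add: real_div_sqrt divide_simps)
  also have "(gauss_moment (2 * j) / sqrt m + K / sqrt m) / 2 = (gauss_moment (2 * j) + K) / 2 / sqrt m"
    by (simp add: add_divide_distrib)
  finally show "expectation (\<lambda>\<omega>. Y \<omega> ^ j * W \<omega>) \<le> (gauss_moment (2 * j) + K) / 2 / sqrt m" .
qed

end


text \<open>One term for neighbouring pairs and one for equal triples; 4 and 15 are the constants in
  the second moments of \<open>Q\<close> and \<open>T\<close>.\<close>

abbreviation error_constant :: "nat \<Rightarrow> real" where
  "error_constant p \<equiv> real (p choose 2) * ((gauss_moment (2 * (p - 2 + p)) + 4) / 2) +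
     real (p choose 3) * ((gauss_moment (2 * (p - 3 + p)) + 15) / 2)"

text \<open>Expanding the square gives Gaussian monomials of nonnegative mean, so coefficients may
  be replaced by upper bounds. The weight \<open>b\<close> of bad words is kept in one factor only
  and the other is bounded by \<open>C\<close>; this already makes the bad part small and leaves
  just \<open>Q\<close> and \<open>T\<close>, each times a power of \<open>Y\<close>.\<close>

lemma (in gaussian_family) polynomial_second_moment:
  assumes C: "\<And>xs. xs \<in> words I p \<Longrightarrow> \<bar>c xs\<bar> \<le> C"
    and gen: "\<And>xs. xs \<in> words I p \<Longrightarrow> spaced xs \<Longrightarrow> (\<And>x. count_list xs x \<le> 2) \<Longrightarrow> \<bar>c xs\<bar> \<le> \<eta>"
    and \<eta>: "0 \<le> \<eta>" and C0: "0 \<le> C"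
  shows "integrable M (\<lambda>\<omega>. (\<Sum>xs\<in>words I p. c xs * monomial (y \<omega>) xs)\<^sup>2)" (is ?i)
    and "expectation (\<lambda>\<omega>. (\<Sum>xs\<in>words I p. c xs * monomial (y \<omega>) xs)\<^sup>2) \<le>
      C * \<eta> * gauss_moment (2 * p) + C\<^sup>2 * error_constant p / sqrt m" (is ?e)
proof -
  let ?W = "words I p"
  define b where "b xs = pair_sum neighbour xs + triple_count xs" for xs
  have b0: "0 \<le> b xs" for xs
    unfolding b_def by (intro add_nonneg_nonneg pair_sum_nonneg triple_count_nonneg neighbour_nonneg)
  have sub: "set xs \<subseteq> I" if "xs \<in> ?W" for xs using that by (simp add: words_def)
  \<comment> \<open>A bad word contains a neighbouring pair or an equal triple, so \<open>b\<close>
    is at least 1 there and \<open>C * b xs\<close> dominates; on the other words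
    \<open>\<eta>\<close> does.\<close>
  have cb: "\<bar>c xs\<bar> \<le> \<eta> + C * b xs" if xs: "xs \<in> ?W" for xs
  proof (cases "spaced xs \<and> (\<forall>x. count_list xs x \<le> 2)")
    case True
    then have "\<bar>c xs\<bar> \<le> \<eta>" using gen[OF xs] by blast
    moreover have "0 \<le> C * b xs" using C0 b0 by simp
    ultimately show ?thesis by linarith
  next
    case False
    have "1 \<le> b xs"
    proof (cases "spaced xs")
      case True
      with False obtain x where "count_list xs x > 2" by (auto simp: not_le)
      then show ?thesis
        using triple_count_ge_1 pair_sum_nonneg[of neighbour xs, OF neighbour_nonneg] by (force simp: b_def)
    next
      case False
      then show ?thesis
        using pair_sum_neighbour_ge_1 triple_count_nonneg[of xs] by (force simp: b_def)
    qed
    then have "C * 1 \<le> C * b xs" using C0 by (rule mult_left_mono)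
    then show ?thesis using C[OF xs] \<eta> by linarith
  qed
  have sq: "(\<Sum>xs\<in>?W. c xs * monomial (y \<omega>) xs)\<^sup>2 =
      (\<Sum>xs\<in>?W. c xs * monomial (y \<omega>) xs) * (\<Sum>xs\<in>?W. c xs * monomial (y \<omega>) xs)" for \<omega>
    by (simp add: power2_eq_square)
  note ps = expectation_product_sums[where u = "\<lambda>xs. xs" and v = "\<lambda>xs. xs", OF sub sub]
  show ?i unfolding sq by (rule ps(1))
  have "expectation (\<lambda>\<omega>. (\<Sum>xs\<in>?W. c xs * monomial (y \<omega>) xs)\<^sup>2) =
      (\<Sum>xs\<in>?W. \<Sum>ys\<in>?W. c xs * c ys * expectation (\<lambda>\<omega>. monomial (y \<omega>) (xs @ ys)))"
    unfolding sq by (rule ps(2))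
  \<comment> \<open>This is where nonnegativity of the expectations enters: the inequality between
    coefficients survives multiplication by them.\<close>
  also have "\<dots> \<le> (\<Sum>xs\<in>?W. \<Sum>ys\<in>?W. (\<eta> + C * b xs) * C * expectation (\<lambda>\<omega>. monomial (y \<omega>) (xs @ ys)))"
  proof (intro sum_mono mult_right_mono)
    fix xs ys assume xs: "xs \<in> ?W" and ys: "ys \<in> ?W"
    show "0 \<le> expectation (\<lambda>\<omega>. monomial (y \<omega>) (xs @ ys))"
      using sub[OF xs] sub[OF ys] by (intro expectation_monomial_nonneg) auto
    have "c xs * c ys \<le> \<bar>c xs\<bar> * \<bar>c ys\<bar>" unfolding abs_mult[symmetric] by (rule abs_ge_self)
    also have "\<dots> \<le> (\<eta> + C * b xs) * C"
      using cb[OF xs] C[OF ys] \<eta> C0 b0 by (intro mult_mono add_nonneg_nonneg) auto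
    finally show "c xs * c ys \<le> (\<eta> + C * b xs) * C" .
  qed
  also have "\<dots> = expectation (\<lambda>\<omega>. (\<Sum>xs\<in>?W. (\<eta> + C * b xs) * monomial (y \<omega>) xs) * (\<Sum>xs\<in>?W. C * monomial (y \<omega>) xs))"
    by (rule ps(2)[symmetric])
  also have "\<dots> = expectation (\<lambda>\<omega>. C * \<eta> * Y \<omega> ^ (2 * p) + C\<^sup>2 * (real (p choose 2) * (Y \<omega> ^ (p - 2 + p) * Q \<omega>) +
      real (p choose 3) * (Y \<omega> ^ (p - 3 + p) * T \<omega>)))"
  proof (rule Bochner_Integration.integral_cong[OF refl])
    fix \<omega>
    have "(\<Sum>xs\<in>?W. (\<eta> + C * b xs) * monomial (y \<omega>) xs) =
        \<eta> * (\<Sum>xs\<in>?W. monomial (y \<omega>) xs) + C * ((\<Sum>xs\<in>?W. monomial (y \<omega>) xs * pair_sum neighbour xs) + (\<Sum>xs\<in>?W. monomial (y \<omega>) xs * triple_count xs))"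
      unfolding sum_distrib_left sum.distrib[symmetric] b_def
      by (intro sum.cong refl) (simp add: algebra_simps)
    also have "\<dots> = \<eta> * Y \<omega> ^ p + C * (real (p choose 2) * Y \<omega> ^ (p - 2) * Q \<omega> + real (p choose 3) * Y \<omega> ^ (p - 3) * T \<omega>)"
      by (simp only: sum_monomial sum_monomial_pair sum_monomial_triple[OF finI] Y_def Q_def T_def)
    finally have 1: "(\<Sum>xs\<in>?W. (\<eta> + C * b xs) * monomial (y \<omega>) xs) = \<dots>" .
    have 2: "(\<Sum>xs\<in>?W. C * monomial (y \<omega>) xs) = C * Y \<omega> ^ p"
      unfolding sum_distrib_left[symmetric] by (simp only: sum_monomial Y_def)
    show "(\<Sum>xs\<in>?W. (\<eta> + C * b xs) * monomial (y \<omega>) xs) * (\<Sum>xs\<in>?W. C * monomial (y \<omega>) xs) =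
      C * \<eta> * Y \<omega> ^ (2 * p) + C\<^sup>2 * (real (p choose 2) * (Y \<omega> ^ (p - 2 + p) * Q \<omega>) + real (p choose 3) * (Y \<omega> ^ (p - 3 + p) * T \<omega>))"
      unfolding 1 2 power_add mult_2 power2_eq_square by (simp only: distrib_left distrib_right mult_ac)
  qed
  also have "\<dots> = C * \<eta> * gauss_moment (2 * p) + C\<^sup>2 * (real (p choose 2) * expectation (\<lambda>\<omega>. Y \<omega> ^ (p - 2 + p) * Q \<omega>) +
      real (p choose 3) * expectation (\<lambda>\<omega>. Y \<omega> ^ (p - 3 + p) * T \<omega>))"
  proof -
    have "integrable M (\<lambda>\<omega>. Y \<omega> ^ (p - 2 + p) * Q \<omega>)"
      by (rule expectation_Y_power_times(1)[OF Q_measurable Q_second_moment])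
    moreover have "integrable M (\<lambda>\<omega>. Y \<omega> ^ (p - 3 + p) * T \<omega>)"
      by (rule expectation_Y_power_times(1)[OF T_measurable T_second_moment])
    ultimately show ?thesis
      using integrable_Y_power[of "2 * p"] by (simp add: expectation_Y_power)
  qed
  also have "\<dots> \<le> C * \<eta> * gauss_moment (2 * p) + C\<^sup>2 * (real (p choose 2) * ((gauss_moment (2 * (p - 2 + p)) + 4) / 2 / sqrt m) +
      real (p choose 3) * ((gauss_moment (2 * (p - 3 + p)) + 15) / 2 / sqrt m))"
    by (intro add_left_mono mult_left_mono add_mono expectation_Y_power_times(2)[OF Q_measurable Q_second_moment]
        expectation_Y_power_times(2)[OF T_measurable T_second_moment]) auto
  also have "\<dots> = C * \<eta> * gauss_moment (2 * p) + C\<^sup>2 * error_constant p / sqrt m"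
    by (simp add: add_divide_distrib distrib_left)
  finally show ?e .
qed

section \<open>The Gaussian comparison model\<close>

lemma integrable_std_normal_affine_power: "integrable std_normal_distribution (\<lambda>x. (a + b * x) ^ j)"
proof -
  have "(a + b * x) ^ j = (\<Sum>k\<le>j. real (j choose k) * a ^ k * b ^ (j - k) * x ^ (j - k))" for x :: real
    unfolding binomial_ring by (intro sum.cong refl) (simp add: power_mult_distrib)
  then show ?thesis
    by (simp only:) (intro Bochner_Integration.integrable_sum integrable_mult_right integrable_std_normal_distribution_moment)
qed

lemma integral_std_normal_affine_power:
  "(\<integral>x. (a + b * x) ^ j \<partial>std_normal_distribution) = (\<Sum>k\<le>j. real (j choose k) * a ^ k * b ^ (j - k) * gauss_moment (j - k))"
proof -
  have eq: "(a + b * x) ^ j = (\<Sum>k\<le>j. real (j choose k) * a ^ k * b ^ (j - k) * x ^ (j - k))" for x :: real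
    unfolding binomial_ring by (intro sum.cong refl) (simp add: power_mult_distrib)
  show ?thesis unfolding eq
    by (subst Bochner_Integration.integral_sum) (simp_all add: integrable_std_normal_distribution_moment)
qed

text \<open>The comparison model replaces the transpositions by independent Gaussian variables of mean
  \<open>\<theta>\<close> and second moment \<open>1\<close>: words without neighbouring letters and without letters of
  multiplicity three or more then have asymptotically the right expectation.\<close>

definition mix_moment :: "real \<Rightarrow> nat \<Rightarrow> real" where
  "mix_moment \<theta> j = (\<integral>x. (\<theta> + sqrt (1 - \<theta>\<^sup>2) * x) ^ j \<partial>std_normal_distribution)"

text \<open>By independence this is the expectation of the word evaluated at the comparison
  variables, which is how \<open>sum_mix_weight\<close> uses it.\<close>

definition mix_weight :: "real \<Rightarrow> 'a list \<Rightarrow> real" where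
  "mix_weight \<theta> xs = (\<Prod>v\<in>set xs. mix_moment \<theta> (count_list xs v))"

text \<open>The moment of order \<open>p\<close> of a Gaussian law with mean
  \<open>\<theta> * a\<close> and variance \<open>(1 - \<theta>\<^sup>2) * v\<close>, for
  \<open>\<bar>\<theta>\<bar> \<le> 1\<close> and \<open>v \<ge> 0\<close>. By the binomial
  expansion it is a polynomial in \<open>a\<close> and \<open>sqrt v\<close>, hence continuous in
  both.\<close>

definition limit_moment :: "real \<Rightarrow> nat \<Rightarrow> real \<Rightarrow> real \<Rightarrow> real" where
  "limit_moment \<theta> p a v = (\<integral>x. (\<theta> * a + sqrt (1 - \<theta>\<^sup>2) * sqrt v * x) ^ p \<partial>std_normal_distribution)"

lemma mix_moment_0: "mix_moment \<theta> 0 = 1"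
  and mix_moment_1: "mix_moment \<theta> (Suc 0) = \<theta>"
  unfolding mix_moment_def integral_std_normal_affine_power using gauss_moment_values(1,2) by simp_all

lemma mix_moment_2:
  assumes "\<bar>\<theta>\<bar> \<le> 1"
  shows "mix_moment \<theta> 2 = 1"
proof -
  have "(sqrt (1 - \<theta>\<^sup>2))\<^sup>2 = 1 - \<theta>\<^sup>2" using assms by (simp add: abs_square_le_1)
  then show ?thesis
    unfolding mix_moment_def integral_std_normal_affine_power using gauss_moment_values(1-3)
    by (simp add: numeral_2_eq_2)
qed

text \<open>The summand 1 keeps the base at least 1, so that the exponent can be raised from the
  number of distinct letters to \<open>p\<close>.\<close>

definition mix_bound :: "real \<Rightarrow> nat \<Rightarrow> real" where
  "mix_bound \<theta> p = (1 + (\<Sum>j\<le>p. \<bar>mix_moment \<theta> j\<bar>)) ^ p"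

lemma mix_weight_bound:
  assumes "length xs = p"
  shows "\<bar>mix_weight \<theta> xs\<bar> \<le> mix_bound \<theta> p"
proof -
  let ?B = "1 + (\<Sum>j\<le>p. \<bar>mix_moment \<theta> j\<bar>)"
  have B1: "1 \<le> ?B" by (simp add: sum_nonneg)
  have "\<bar>mix_weight \<theta> xs\<bar> = (\<Prod>v\<in>set xs. \<bar>mix_moment \<theta> (count_list xs v)\<bar>)"
    unfolding mix_weight_def by (rule abs_prod)
  also have "\<dots> \<le> (\<Prod>v\<in>set xs. ?B)"
  proof (intro prod_mono conjI)
    fix v
    have "count_list xs v \<le> p" using assms count_le_length[of xs v] by simp
    then have "\<bar>mix_moment \<theta> (count_list xs v)\<bar> \<le> (\<Sum>j\<le>p. \<bar>mix_moment \<theta> j\<bar>)"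
      by (intro member_le_sum[of _ _ "\<lambda>j. \<bar>mix_moment \<theta> j\<bar>"]) auto
    then show "\<bar>mix_moment \<theta> (count_list xs v)\<bar> \<le> ?B" by linarith
  qed auto
  also have "\<dots> = ?B ^ card (set xs)" by simp
  also have "\<dots> \<le> ?B ^ p"
    using B1 card_length[of xs] assms by (intro power_increasing) auto
  finally show ?thesis by (simp add: mix_bound_def)
qed

lemma mix_weight_generic:
  assumes "\<bar>\<theta>\<bar> \<le> 1" "\<And>x. count_list xs x \<le> 2"
  shows "mix_weight \<theta> xs = \<theta> ^ card {x. count_list xs x = 1}"
proof -
  have "mix_weight \<theta> xs = (\<Prod>v\<in>set xs. if v \<in> {x. count_list xs x = 1} then \<theta> else 1)"
    unfolding mix_weight_def
  proof (intro prod.cong refl)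
    fix v assume "v \<in> set xs"
    then have "count_list xs v \<noteq> 0" by (simp add: count_list_0_iff)
    with assms(2)[of v] have "count_list xs v = Suc 0 \<or> count_list xs v = 2" by linarith
    then show "mix_moment \<theta> (count_list xs v) = (if v \<in> {x. count_list xs x = 1} then \<theta> else 1)"
      using mix_moment_1 mix_moment_2[OF assms(1)] by auto
  qed
  also have "\<dots> = \<theta> ^ card (set xs \<inter> {x. count_list xs x = 1})"
    by (simp add: prod.If_cases)
  also have "set xs \<inter> {x. count_list xs x = 1} = {x. count_list xs x = 1}"
    using count_notin by force
  finally show ?thesis .
qed

text \<open>The variables \<open>X k\<close> serve here merely as a source of independent Gaussians
  for the comparison model, while \<open>z\<close> is deterministic. The sum over words is the
  expectation of a power of one linear combination, and the variance of
  \<open>\<Sum>k\<in>I. z k * X k \<omega>\<close> is the sum of the squares of \<open>z\<close>.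
  Only later is \<open>z\<close> set to a realization \<open>y \<omega>\<close>.\<close>

lemma (in gaussian_family) sum_mix_weight:
  "(\<Sum>xs\<in>words I p. mix_weight \<theta> xs * monomial z xs) = limit_moment \<theta> p (\<Sum>k\<in>I. z k) (\<Sum>k\<in>I. (z k)\<^sup>2)"
proof -
  let ?s = "sqrt (1 - \<theta>\<^sup>2)"
  define e where "e k \<omega> = \<theta> + ?s * X k \<omega>" for k \<omega>
  have ind: "indep_vars (\<lambda>_. borel) e I"
    unfolding e_def[abs_def] by (rule indep_vars_compose2[OF indep]) auto
  have inte: "integrable M (\<lambda>\<omega>. e k \<omega> ^ j)" if "k \<in> I" for k j
    unfolding e_def by (rule expectation_std_normal(2)[OF rv[OF that] std[OF that]]) (auto intro: integrable_std_normal_affine_power)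
  have Ee: "expectation (\<lambda>\<omega>. e k \<omega> ^ j) = mix_moment \<theta> j" if "k \<in> I" for k j
    unfolding e_def mix_moment_def by (rule expectation_std_normal(1)[OF rv[OF that] std[OF that]]) auto
  have w: "mix_weight \<theta> xs = expectation (\<lambda>\<omega>. monomial (\<lambda>k. e k \<omega>) xs)" if "xs \<in> words I p" for xs
  proof -
    have sub: "set xs \<subseteq> I" using that by (simp add: words_def)
    have "expectation (\<lambda>\<omega>. monomial (\<lambda>k. e k \<omega>) xs) = (\<Prod>k\<in>I. mix_moment \<theta> (count_list xs k))"
      by (simp add: expectation_monomial(2)[OF finI ind inte sub] Ee)
    also have "\<dots> = mix_weight \<theta> xs"
      unfolding mix_weight_def using sub finI
      by (intro prod.mono_neutral_right) (auto simp: mix_moment_0)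
    finally show ?thesis ..
  qed
  have intm: "integrable M (\<lambda>\<omega>. monomial (\<lambda>k. e k \<omega>) xs)" if "xs \<in> words I p" for xs
    by (rule expectation_monomial(1)[OF finI ind inte]) (use that in \<open>auto simp: words_def\<close>)
  have "(\<Sum>xs\<in>words I p. mix_weight \<theta> xs * monomial z xs) = (\<Sum>xs\<in>words I p. expectation (\<lambda>\<omega>. monomial (\<lambda>k. e k \<omega>) xs * monomial z xs))"
    by (intro sum.cong refl) (simp add: w)
  also have "\<dots> = expectation (\<lambda>\<omega>. \<Sum>xs\<in>words I p. monomial (\<lambda>k. e k \<omega>) xs * monomial z xs)"
    by (rule Bochner_Integration.integral_sum[symmetric]) (simp add: intm)
  also have "\<dots> = expectation (\<lambda>\<omega>. (\<theta> * (\<Sum>k\<in>I. z k) + ?s * (\<Sum>k\<in>I. z k * X k \<omega>)) ^ p)"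
  proof (rule Bochner_Integration.integral_cong[OF refl])
    fix \<omega>
    have "(\<Sum>k\<in>I. e k \<omega> * z k) = \<theta> * (\<Sum>k\<in>I. z k) + ?s * (\<Sum>k\<in>I. z k * X k \<omega>)"
      unfolding e_def sum_distrib_left sum.distrib[symmetric] by (intro sum.cong refl) (simp add: algebra_simps)
    then show "(\<Sum>xs\<in>words I p. monomial (\<lambda>k. e k \<omega>) xs * monomial z xs) = (\<theta> * (\<Sum>k\<in>I. z k) + ?s * (\<Sum>k\<in>I. z k * X k \<omega>)) ^ p"
      by (simp only: monomial_mult[symmetric] sum_monomial)
  qed
  also have "\<dots> = (\<integral>x. (\<theta> * (\<Sum>k\<in>I. z k) + ?s * x) ^ p \<partial>distr M borel (\<lambda>\<omega>. \<Sum>k\<in>I. z k * X k \<omega>))"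
    using rv by (subst integral_distr) auto
  also have "\<dots> = limit_moment \<theta> p (\<Sum>k\<in>I. z k) (\<Sum>k\<in>I. (z k)\<^sup>2)"
    unfolding gaussian_linear_combination[OF finI indep std, where a = z, simplified] limit_moment_def
    by (subst integral_distr) (auto simp: mult.assoc)
  finally show ?thesis .
qed

text \<open>The difference between true and model weight meets both demands of
  \<open>polynomial_second_moment\<close>: it is at most \<open>1 + mix_bound \<theta> p\<close> on
  every word, and at most \<open>\<eta>\<close> where the model weight is \<open>\<theta>\<close> to
  the number of letters occurring once.\<close>

lemma (in gaussian_family) moment_deviation:
  assumes \<theta>: "\<bar>\<theta>\<bar> \<le> 1" and w: "\<And>xs. xs \<in> words I p \<Longrightarrow> \<bar>w xs\<bar> \<le> 1"
    and gen: "\<And>xs. xs \<in> words I p \<Longrightarrow> spaced xs \<Longrightarrow> (\<And>x. count_list xs x \<le> 2) \<Longrightarrow>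
      \<bar>w xs - \<theta> ^ card {x. count_list xs x = 1}\<bar> \<le> \<eta>"
    and \<eta>: "0 \<le> \<eta>"
  shows "integrable M (\<lambda>\<omega>. ((\<Sum>xs\<in>words I p. w xs * monomial (y \<omega>) xs) - limit_moment \<theta> p (Y \<omega>) (V \<omega>))\<^sup>2)" (is ?i)
    and "expectation (\<lambda>\<omega>. ((\<Sum>xs\<in>words I p. w xs * monomial (y \<omega>) xs) - limit_moment \<theta> p (Y \<omega>) (V \<omega>))\<^sup>2) \<le>
      (1 + mix_bound \<theta> p) * \<eta> * gauss_moment (2 * p) + (1 + mix_bound \<theta> p)\<^sup>2 * error_constant p / sqrt m" (is ?e)
proof -
  define c where "c xs = w xs - mix_weight \<theta> xs" for xs
  have eq: "(\<Sum>xs\<in>words I p. w xs * monomial (y \<omega>) xs) - limit_moment \<theta> p (Y \<omega>) (V \<omega>) = (\<Sum>xs\<in>words I p. c xs * monomial (y \<omega>) xs)" for \<omega>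
    unfolding Y_def V_def sum_mix_weight[symmetric] c_def by (simp add: sum_subtractf[symmetric] left_diff_distrib)
  have nn: "0 \<le> mix_bound \<theta> p" unfolding mix_bound_def by (intro zero_le_power add_nonneg_nonneg sum_nonneg) auto
  have C: "\<bar>c xs\<bar> \<le> 1 + mix_bound \<theta> p" if "xs \<in> words I p" for xs
    using w[OF that] mix_weight_bound[of xs p \<theta>] that by (simp add: c_def words_def)
  have G: "\<bar>c xs\<bar> \<le> \<eta>" if "xs \<in> words I p" "spaced xs" "\<And>x. count_list xs x \<le> 2" for xs
    using gen[OF that] mix_weight_generic[OF \<theta> that(3)] by (simp only: c_def)
  have nn': "0 \<le> 1 + mix_bound \<theta> p" using nn by simp
  note * = polynomial_second_moment[OF C G \<eta> nn']
  show ?i unfolding eq by (rule *(1))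
  show ?e unfolding eq by (rule *(2))
qed


section \<open>Spectral measures\<close>

lemma upper_triangular_mult:
  assumes A: "A \<in> carrier_mat n n" "upper_triangular A" and B: "B \<in> carrier_mat n n" "upper_triangular (B :: 'a :: comm_ring_1 mat)"
  shows "upper_triangular (A * B)" and "i < n \<Longrightarrow> (A * B) $$ (i, i) = A $$ (i, i) * B $$ (i, i)"
proof -
  have entry: "(A * B) $$ (i, j) = (\<Sum>k<n. A $$ (i, k) * B $$ (k, j))" if "i < n" "j < n" for i j
    using that A B by (simp add: scalar_prod_def atLeast0LessThan)
  have z: "A $$ (i, k) * B $$ (k, j) = 0" if "i < n" "k < n" "k < i \<or> j < k" for i j k
    using that upper_triangularD[OF A(2), of k i] upper_triangularD[OF B(2), of j k] A(1) B(1) by auto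
  show "upper_triangular (A * B)"
  proof (rule upper_triangularI)
    fix i j assume "j < i" "i < dim_row (A * B)"
    then have ij: "j < i" "i < n" "j < n" using A by auto
    show "(A * B) $$ (i, j) = 0"
      unfolding entry[OF ij(2,3)]
    proof (rule sum.neutral, rule ballI)
      fix k assume "k \<in> {..<n}"
      then show "A $$ (i, k) * B $$ (k, j) = 0" using z[of i k j] ij by (cases "k < i") auto
    qed
  qed
  assume i: "i < n"
  have "(A * B) $$ (i, i) = (\<Sum>k<n. if k = i then A $$ (i, i) * B $$ (i, i) else 0)"
    unfolding entry[OF i i]
  proof (rule sum.cong[OF refl])
    fix k assume "k \<in> {..<n}"
    then show "A $$ (i, k) * B $$ (k, i) = (if k = i then A $$ (i, i) * B $$ (i, i) else 0)"
      using z[of i k i] i by (cases "k < i"; cases "i < k") auto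
  qed
  then show "(A * B) $$ (i, i) = A $$ (i, i) * B $$ (i, i)" using i by simp
qed

lemma upper_triangular_pow:
  assumes A: "A \<in> carrier_mat n n" "upper_triangular (A :: 'a :: comm_ring_1 mat)"
  shows "upper_triangular (A ^\<^sub>m k) \<and> (\<forall>i<n. (A ^\<^sub>m k) $$ (i, i) = (A $$ (i, i)) ^ k)"
proof (induction k)
  case 0
  then show ?case using A by simp
next
  case (Suc k)
  have "A ^\<^sub>m k \<in> carrier_mat n n" using A by simp
  with upper_triangular_mult[of "A ^\<^sub>m k" n A] Suc A show ?case by (simp add: mult.commute)
qed

text \<open>By Schur decomposition \<open>A\<close> is similar to a triangular matrix with diagonal
  \<open>es\<close>; powers act on the diagonal entrywise, and the trace is invariant under
  similarity.\<close>

lemma trace_pow_eigenvalues: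
  assumes A: "(A :: complex mat) \<in> carrier_mat n n" and cp: "char_poly A = (\<Prod>a\<leftarrow>es. [:- a, 1:])"
  shows "mat_trace (A ^\<^sub>m k) = (\<Sum>a\<leftarrow>es. a ^ k)"
proof -
  obtain B P Q where "schur_decomposition A es = (B, P, Q)" by (cases "schur_decomposition A es") auto
  from schur_decomposition[OF A cp this]
  have sim: "similar_mat_wit A B P Q" and ut: "upper_triangular B" and dg: "diag_mat B = es" by auto
  note c = similar_mat_witD2[OF A sim]
  have B: "B \<in> carrier_mat n n" and P: "P \<in> carrier_mat n n" and Q: "Q \<in> carrier_mat n n" and QP: "Q * P = 1\<^sub>m n"
    using c by auto
  have Bk: "B ^\<^sub>m k \<in> carrier_mat n n" using B by simp
  have "A ^\<^sub>m k = P * B ^\<^sub>m k * Q" by (rule similar_mat_wit_pow_id[OF sim])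
  also have "mat_trace \<dots> = mat_trace (Q * (P * B ^\<^sub>m k))"
    using P Bk Q by (intro mat_trace_comm) auto
  also have "Q * (P * B ^\<^sub>m k) = B ^\<^sub>m k"
    by (metis QP assoc_mult_mat[OF Q P Bk] left_mult_one_mat[OF Bk])
  also have "mat_trace (B ^\<^sub>m k) = (\<Sum>i<n. (B $$ (i, i)) ^ k)"
    using upper_triangular_pow[OF B ut, of k] Bk B by (simp add: mat_trace_def)
  also have "\<dots> = (\<Sum>a\<leftarrow>es. a ^ k)"
    using B unfolding dg[symmetric] diag_mat_def by (simp add: sum_list_sum_nth atLeast0LessThan)
  finally show ?thesis .
qed

lemma hermitian_eigenvalue_real:
  assumes A: "(A :: complex mat) \<in> carrier_mat n n" and h: "mat_adjoint A = A" and e: "eigenvalue A e"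
  shows "e \<in> \<real>"
proof -
  obtain v where v: "v \<in> carrier_vec n" "v \<noteq> 0\<^sub>v n" "A *\<^sub>v v = e \<cdot>\<^sub>v v"
    using e A by (auto simp: eigenvalue_def eigenvector_def)
  have herm: "A $$ (i, j) = cnj (A $$ (j, i))" if "i < n" "j < n" for i j
    using mat_adjoint_index[OF A that] h by simp
  define q where "q = (\<Sum>i<n. \<Sum>j<n. cnj (v $ i) * A $$ (i, j) * v $ j)"
  define s where "s = (\<Sum>i<n. (norm (v $ i))\<^sup>2)"
  have Av: "(\<Sum>j<n. A $$ (i, j) * v $ j) = e * v $ i" if "i < n" for i
  proof -
    have "(A *\<^sub>v v) $ i = (\<Sum>j<n. A $$ (i, j) * v $ j)"
      using A v(1) that by (simp add: scalar_prod_def atLeast0LessThan)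
    then show ?thesis using v that by simp
  qed
  have "q = (\<Sum>i<n. cnj (v $ i) * (\<Sum>j<n. A $$ (i, j) * v $ j))"
    by (simp add: q_def sum_distrib_left mult.assoc)
  also have "\<dots> = (\<Sum>i<n. e * (v $ i * cnj (v $ i)))" using Av by (intro sum.cong refl) (simp add: mult_ac)
  also have "\<dots> = e * of_real s"
    by (simp add: s_def sum_distrib_left complex_norm_square del: of_real_power)
  finally have q: "q = e * of_real s" .
  have "cnj q = (\<Sum>i<n. \<Sum>j<n. cnj (v $ j) * A $$ (j, i) * v $ i)"
    unfolding q_def cnj_sum
  proof (intro sum.cong refl)
    fix i j assume "i \<in> {..<n}" "j \<in> {..<n}"
    then have "cnj (A $$ (i, j)) = A $$ (j, i)" using herm[of j i] by simp
    then show "cnj (cnj (v $ i) * A $$ (i, j) * v $ j) = cnj (v $ j) * A $$ (j, i) * v $ i"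
      by (simp add: mult_ac)
  qed
  also have "\<dots> = q" unfolding q_def by (rule sum.swap)
  finally have qr: "cnj q = q" .
  have s0: "s \<noteq> 0"
  proof
    assume "s = 0"
    then have "\<forall>i<n. v $ i = 0" unfolding s_def by (subst (asm) sum_nonneg_eq_0_iff) auto
    then have "v = 0\<^sub>v n" using v(1) by auto
    with v show False by simp
  qed
  have "cnj e * of_real s = e * of_real s" using qr unfolding q by simp
  then have "cnj e = e" using s0 by simp
  then show ?thesis by (simp add: Reals_cnj_iff)
qed

lemma hermitian_char_poly_real:
  assumes A: "(A :: complex mat) \<in> carrier_mat n n" and h: "mat_adjoint A = A"
  obtains rs where "length rs = n" "char_poly A = (\<Prod>a\<leftarrow>rs. [:- complex_of_real a, 1:])"
proof -
  obtain es where es: "char_poly A = (\<Prod>a\<leftarrow>es. [:- a, 1:])" "length es = n"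
    using char_poly_factorized[OF A] by blast
  have real: "e \<in> \<real>" if "e \<in> set es" for e
  proof (rule hermitian_eigenvalue_real[OF A h])
    have "poly (char_poly A) e = 0"
      unfolding es(1) poly_prod_list using that by (auto simp: prod_list_zero_iff)
    then show "eigenvalue A e" by (simp add: eigenvalue_root_char_poly[OF A])
  qed
  have m: "map (\<lambda>a. complex_of_real (Re a)) es = es"
    by (rule map_idI) (use real in auto)
  have "(\<Prod>a\<leftarrow>map Re es. [:- complex_of_real a, 1:]) = (\<Prod>a\<leftarrow>map (\<lambda>a. complex_of_real (Re a)) es. [:- a, 1:])"
    by (simp add: comp_def)
  then have "char_poly A = (\<Prod>a\<leftarrow>map Re es. [:- complex_of_real a, 1:])"
    by (simp only: m es(1))
  then show ?thesis using that[of "map Re es"] es(2) by simp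
qed

lemma order_prod_list_linear:
  "Polynomial.order (complex_of_real x) (\<Prod>a\<leftarrow>rs. [:- complex_of_real a, 1:]) = count_list rs x"
proof (induction rs)
  case (Cons a rs)
  have nz: "(\<Prod>a\<leftarrow>rs. [:- complex_of_real a, 1:]) \<noteq> 0"
    by (auto simp: prod_list_zero_iff)
  have "Polynomial.order (complex_of_real x) [:- complex_of_real a, 1:] = (if a = x then 1 else 0)"
    using order_power_n_n[of "complex_of_real x" 1] by (auto intro: order_0I)
  then show ?case using Cons nz by (simp add: order_mult del: mult_pCons_left)
next
  case Nil
  have "Polynomial.order (complex_of_real x) 1 = 0" by (rule order_0I) simp
  then show ?case by simp
qed

lemma sum_list_eq_sum_count:
  "(\<Sum>a\<leftarrow>rs. f a) = (\<Sum>x\<in>set rs. real (count_list rs x) * f x)"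
proof (induction rs)
  case (Cons a rs)
  have "(\<Sum>x\<in>set (a # rs). real (count_list (a # rs) x) * f x) = f a + (\<Sum>x\<in>set (a # rs). real (count_list rs x) * f x)"
  proof -
    have "(\<Sum>x\<in>set (a # rs). real (count_list (a # rs) x) * f x) =
        (\<Sum>x\<in>set (a # rs). (if x = a then f a else 0) + real (count_list rs x) * f x)"
      by (intro sum.cong refl) (auto simp: algebra_simps)
    then show ?thesis by (simp add: sum.distrib del: set_simps) simp
  qed
  also have "(\<Sum>x\<in>set (a # rs). real (count_list rs x) * f x) = (\<Sum>x\<in>set rs. real (count_list rs x) * f x)"
    by (intro sum.mono_neutral_right) (auto simp: count_list_0_iff)
  finally show ?case using Cons by simp
qed simp

text \<open>The law of a uniformly chosen list entry. Multiplicities are carried by repetitions in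
  the list, and that this is a probability measure comes for free.\<close>

definition empirical_measure :: "real list \<Rightarrow> real measure" where
  "empirical_measure rs = distr (measure_pmf (pmf_of_set {..<length rs})) borel (\<lambda>i. rs ! i)"

lemma prob_space_empirical_measure: "prob_space (empirical_measure rs)"
  unfolding empirical_measure_def by (rule prob_space.prob_space_distr[OF prob_space_measure_pmf]) simp

lemma sets_empirical_measure [simp]: "sets (empirical_measure rs) = sets borel"
  by (simp add: empirical_measure_def)

lemma integral_empirical_measure:
  assumes "rs \<noteq> []" and f: "f \<in> borel_measurable borel"
  shows "(\<integral>x. f x \<partial>empirical_measure rs) = (\<Sum>a\<leftarrow>rs. f a) / real (length rs)"
    and "integrable (empirical_measure rs) f"
proof -
  have S: "{..<length rs} \<noteq> {}" "finite {..<length rs}" using assms(1) by auto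
  have "(\<integral>x. f x \<partial>empirical_measure rs) = (\<Sum>i<length rs. f (rs ! i)) / real (length rs)"
    unfolding empirical_measure_def using f
    by (subst integral_distr) (simp_all add: integral_pmf_of_set[OF S])
  also have "(\<Sum>i<length rs. f (rs ! i)) = (\<Sum>a\<leftarrow>rs. f a)"
    by (simp add: sum_list_sum_nth atLeast0LessThan)
  finally show "(\<integral>x. f x \<partial>empirical_measure rs) = (\<Sum>a\<leftarrow>rs. f a) / real (length rs)" .
  show "integrable (empirical_measure rs) f"
  proof -
    have "integrable (measure_pmf (pmf_of_set {..<length rs})) (\<lambda>i. f (rs ! i))"
      by (rule integrable_measure_pmf_finite) (simp add: set_pmf_of_set[OF S])
    then show ?thesis using f by (simp add: empirical_measure_def integrable_distr_eq)
  qed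
qed

lemma spectral_measure_hermitian:
  assumes A: "(A :: complex mat) \<in> carrier_mat d d" and d: "0 < d"
    and rs: "length rs = d" "char_poly A = (\<Prod>a\<leftarrow>rs. [:- complex_of_real a, 1:])"
  shows "spectral_measure d A = empirical_measure rs"
proof -
  let ?E = "empirical_measure rs"
  have ne: "rs \<noteq> []" using rs d by auto
  interpret E: prob_space ?E by (rule prob_space_empirical_measure)
  have ev: "{x. eigenvalue A (complex_of_real x)} = set rs"
    unfolding eigenvalue_root_char_poly[OF A] rs(2) poly_prod_list
    by (auto simp: prod_list_zero_iff)
  have em: "ennreal (\<Sum>x\<in>{x. eigenvalue A (complex_of_real x)}.
       (1 / real d) * real (Polynomial.order (complex_of_real x) (char_poly A)) * indicator B x) = emeasure ?E B"
    if B: "B \<in> sets borel" for B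
  proof -
    have "(\<Sum>x\<in>{x. eigenvalue A (complex_of_real x)}.
       (1 / real d) * real (Polynomial.order (complex_of_real x) (char_poly A)) * indicator B x) =
       (\<Sum>x\<in>set rs. real (count_list rs x) * indicator B x) / real d"
      unfolding ev rs(2) order_prod_list_linear sum_divide_distrib by simp
    also have "\<dots> = (\<integral>x. indicator B x \<partial>?E)"
      using B by (simp only: sum_list_eq_sum_count[symmetric] rs(1)[symmetric])
        (rule integral_empirical_measure(1)[OF ne, symmetric], simp)
    also have "\<dots> = measure ?E B" using B by simp
    finally show ?thesis by (simp only: E.emeasure_eq_measure)
  qed
  \<comment> \<open>Countable additivity of the defining set function need not be checked: it
    suffices that it agrees on Borel sets with a function already known to be a measure.\<close>
  have "spectral_measure d A = measure_of UNIV (sets borel) (emeasure ?E)"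
    unfolding spectral_measure_def
  proof (rule measure_of_eq)
    fix B :: "real set" assume "B \<in> sigma_sets UNIV (sets borel)"
    then have "B \<in> sets borel" by (metis sets.sigma_sets_eq space_borel)
    then show "ennreal (\<Sum>x\<in>{x. eigenvalue A (complex_of_real x)}.
       (1 / real d) * real (Polynomial.order (complex_of_real x) (char_poly A)) * indicator B x) = emeasure ?E B"
      by (rule em)
  qed simp
  also have "\<dots> = measure_of (space ?E) (sets ?E) (emeasure ?E)"
    by (simp add: empirical_measure_def)
  finally show ?thesis by (simp only: measure_of_of_measure)
qed

section \<open>Moments of the random matrix as sums over words\<close>

lemma pow_mat_Suc_left:
  assumes "A \<in> carrier_mat n n"
  shows "A ^\<^sub>m Suc k = A * A ^\<^sub>m k"
proof (induction k)
  case (Suc k)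
  have "A ^\<^sub>m Suc (Suc k) = A ^\<^sub>m Suc k * A" by simp
  also have "\<dots> = A * A ^\<^sub>m k * A" by (simp only: Suc.IH)
  also have "\<dots> = A * (A ^\<^sub>m k * A)" using assms by (intro assoc_mult_mat[of _ n n _ n _ n]) auto
  finally show ?case by simp
qed (use assms in simp)

abbreviation word_moment :: "nat \<Rightarrow> nat \<Rightarrow> ((nat \<Rightarrow> nat) \<Rightarrow> complex mat) \<Rightarrow> (nat \<Rightarrow> real) \<Rightarrow> nat \<Rightarrow> real" where
  "word_moment N d r z k \<equiv> (\<Sum>xs\<in>words {1..N - 1} k.
     normalized_character d r (adjacent_word xs) * monomial (\<lambda>k. 1 / sqrt (real (N - 1)) * z k) xs)"

context
  fixes N d :: nat and r :: "(nat \<Rightarrow> nat) \<Rightarrow> complex mat"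
  assumes r: "unitary_rep N d r"
begin

lemma adjacent_transposition_permutes: "k \<in> {1..N - 1} \<Longrightarrow> swap k (k + 1) permutes {1..N}"
  by (intro permutes_swap_id) auto

lemma transposition_matrix_carrier: "transposition_matrix N d r z \<in> carrier_mat d d"
  by (simp add: transposition_matrix_def)

lemma transposition_matrix_hermitian: "mat_adjoint (transposition_matrix N d r z) = transposition_matrix N d r z"
proof (rule eq_matI)
  fix i j assume "i < dim_row (transposition_matrix N d r z)" "j < dim_col (transposition_matrix N d r z)"
  then have ij: "i < d" "j < d" by (auto simp: transposition_matrix_def)
  have "cnj (r (swap k (k + 1)) $$ (j, i)) = r (swap k (k + 1)) $$ (i, j)"
    if k: "k \<in> {1..N - 1}" for k
  proof -
    note p = adjacent_transposition_permutes[OF k]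
    have "swap k (k + 1) \<circ> swap k (k + 1) = id"
      by (rule transpose_comp_involutory)
    from unitary_rep_involution_hermitian[OF r p this] show ?thesis
      using mat_adjoint_index[OF unitary_rep_carrier[OF r p] ij] by simp
  qed
  then have "(\<Sum>k = 1..N - 1. complex_of_real (z k) * cnj (r (swap k (k + 1)) $$ (j, i))) =
    (\<Sum>k = 1..N - 1. complex_of_real (z k) * r (swap k (k + 1)) $$ (i, j))"
    by (intro sum.cong refl) simp
  then show "mat_adjoint (transposition_matrix N d r z) $$ (i, j) = transposition_matrix N d r z $$ (i, j)"
    using ij unfolding mat_adjoint_index[OF transposition_matrix_carrier ij] by (simp add: transposition_matrix_def)
qed (simp_all add: mat_adjoint_def transposition_matrix_def)

lemma transposition_matrix_pow:
  "i < d \<Longrightarrow> j < d \<Longrightarrow> (transposition_matrix N d r z ^\<^sub>m k) $$ (i, j) =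
    (\<Sum>xs\<in>words {1..N - 1} k. of_real (monomial (\<lambda>k. 1 / sqrt (real (N - 1)) * z k) xs) * r (adjacent_word xs) $$ (i, j))"
proof (induction k arbitrary: i j)
  case 0
  have "(\<Sum>xs\<in>words I 0. f xs) = f []" for I :: "nat set" and f :: "nat list \<Rightarrow> complex" by simp
  with 0 show ?case by (simp only: adjacent_word_Nil unitary_rep_id[OF r]) (simp add: transposition_matrix_def)
next
  case (Suc k)
  let ?A = "transposition_matrix N d r z" and ?I = "{1..N - 1}"
  let ?y = "\<lambda>k. 1 / sqrt (real (N - 1)) * z k"
  let ?t = "\<lambda>k. swap k (Suc k)"
  let ?f = "\<lambda>a l xs. of_real (?y a) * r (?t a) $$ (i, l) * (of_real (monomial ?y xs) * r (adjacent_word xs) $$ (l, j))"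
  note A = transposition_matrix_carrier[of z]
  have e: "?A $$ (i, l) = (\<Sum>a\<in>?I. of_real (?y a) * r (?t a) $$ (i, l))" if "l < d" for l
  proof -
    have "?A $$ (i, l) = of_real (1 / sqrt (real (N - 1))) * (\<Sum>a\<in>?I. of_real (z a) * r (swap a (a + 1)) $$ (i, l))"
      unfolding transposition_matrix_def using that Suc.prems by (simp only: index_mat(1) prod.case)
    then show ?thesis
      by (simp only: sum_distrib_left of_real_mult mult.assoc Suc_eq_plus1)
  qed
  have prod: "r (adjacent_word (a # xs)) $$ (i, j) = (\<Sum>l<d. r (?t a) $$ (i, l) * r (adjacent_word xs) $$ (l, j))"
    if "a \<in> ?I" "xs \<in> words ?I k" for a xs
  proof -
    have p: "?t a permutes {1..N}" using adjacent_transposition_permutes[OF that(1)] by simp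
    have q: "adjacent_word xs permutes {1..N}"
      using that(2) by (intro adjacent_word_permutes) (simp add: words_def)
    have "r (adjacent_word (a # xs)) = r (?t a) * r (adjacent_word xs)"
      unfolding adjacent_word_Cons by (rule unitary_rep_comp[OF r p q])
    then show ?thesis
      using unitary_rep_carrier[OF r p] unitary_rep_carrier[OF r q] Suc.prems
      by (simp add: scalar_prod_def atLeast0LessThan)
  qed
  \<comment> \<open>The factor is split off on the left, since \<open>adjacent_word\<close> puts the
    head of the word leftmost.\<close>
  have "(?A ^\<^sub>m Suc k) $$ (i, j) = (?A * ?A ^\<^sub>m k) $$ (i, j)" by (simp only: pow_mat_Suc_left[OF A])
  also have "\<dots> = (\<Sum>l<d. ?A $$ (i, l) * (?A ^\<^sub>m k) $$ (l, j))"
    using A Suc.prems by (simp add: scalar_prod_def atLeast0LessThan)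
  also have "\<dots> = (\<Sum>l<d. (\<Sum>a\<in>?I. of_real (?y a) * r (?t a) $$ (i, l)) *
      (\<Sum>xs\<in>words ?I k. of_real (monomial ?y xs) * r (adjacent_word xs) $$ (l, j)))"
    by (rule sum.cong[OF refl]) (simp only: e Suc.IH[OF _ Suc.prems(2)] lessThan_iff)
  also have "\<dots> = (\<Sum>l<d. \<Sum>a\<in>?I. \<Sum>xs\<in>words ?I k. ?f a l xs)"
    by (simp only: sum_product)
  also have "\<dots> = (\<Sum>a\<in>?I. \<Sum>l<d. \<Sum>xs\<in>words ?I k. ?f a l xs)"
    by (rule sum.swap)
  also have "\<dots> = (\<Sum>a\<in>?I. \<Sum>xs\<in>words ?I k. \<Sum>l<d. ?f a l xs)"
    by (rule sum.cong[OF refl], rule sum.swap)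
  also have "\<dots> = (\<Sum>a\<in>?I. \<Sum>xs\<in>words ?I k. of_real (monomial ?y (a # xs)) * r (adjacent_word (a # xs)) $$ (i, j))"
  proof (rule sum.cong[OF refl], rule sum.cong[OF refl])
    fix a xs assume a: "a \<in> ?I" "xs \<in> words ?I k"
    show "(\<Sum>l<d. ?f a l xs) =
      of_real (monomial ?y (a # xs)) * r (adjacent_word (a # xs)) $$ (i, j)"
      unfolding prod[OF a] sum_distrib_left monomial_Cons of_real_mult
      by (rule sum.cong[OF refl]) (simp only: mult_ac)
  qed
  also have "\<dots> = (\<Sum>xs\<in>words ?I (Suc k). of_real (monomial ?y xs) * r (adjacent_word xs) $$ (i, j))"
    by (rule sum_words_Suc[symmetric])
  finally show ?case .
qed

lemma transposition_matrix_trace_pow: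
  "mat_trace (transposition_matrix N d r z ^\<^sub>m k) =
    (\<Sum>xs\<in>words {1..N - 1} k. of_real (monomial (\<lambda>k. 1 / sqrt (real (N - 1)) * z k) xs) * mat_trace (r (adjacent_word xs)))"
proof -
  let ?m = "\<lambda>xs. complex_of_real (monomial (\<lambda>k. 1 / sqrt (real (N - 1)) * z k) xs)"
  have "mat_trace (transposition_matrix N d r z ^\<^sub>m k) = (\<Sum>i<d. \<Sum>xs\<in>words {1..N - 1} k. ?m xs * r (adjacent_word xs) $$ (i, i))"
    using transposition_matrix_carrier[of z] by (simp add: mat_trace_def transposition_matrix_pow)
  also have "\<dots> = (\<Sum>xs\<in>words {1..N - 1} k. \<Sum>i<d. ?m xs * r (adjacent_word xs) $$ (i, i))"
    by (rule sum.swap)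
  also have "\<dots> = (\<Sum>xs\<in>words {1..N - 1} k. ?m xs * mat_trace (r (adjacent_word xs)))"
  proof (rule sum.cong[OF refl])
    fix xs assume "xs \<in> words {1..N - 1} k"
    then have "adjacent_word xs permutes {1..N}" by (intro adjacent_word_permutes) (simp add: words_def)
    from unitary_rep_carrier[OF r this]
    show "(\<Sum>i<d. ?m xs * r (adjacent_word xs) $$ (i, i)) = ?m xs * mat_trace (r (adjacent_word xs))"
      by (simp add: mat_trace_def sum_distrib_left)
  qed
  finally show ?thesis .
qed

text \<open>One list serves all \<open>k\<close> at once, so that the full moment sequence of a
  single measure is described.\<close>

lemma spectral_measure_moments:
  assumes d: "0 < d"
  obtains rs where "length rs = d" "spectral_measure d (transposition_matrix N d r z) = empirical_measure rs"
    "\<And>k. (\<Sum>a\<leftarrow>rs. a ^ k) / real d =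
      word_moment N d r z k"
proof -
  let ?A = "transposition_matrix N d r z"
  let ?y = "\<lambda>k. 1 / sqrt (real (N - 1)) * z k"
  obtain rs where rs: "length rs = d" "char_poly ?A = (\<Prod>a\<leftarrow>rs. [:- complex_of_real a, 1:])"
    using hermitian_char_poly_real[OF transposition_matrix_carrier transposition_matrix_hermitian] .
  have cp: "char_poly ?A = (\<Prod>a\<leftarrow>map complex_of_real rs. [:- a, 1:])"
    using rs(2) by (simp add: comp_def)
  have "(\<Sum>a\<leftarrow>rs. a ^ k) / real d = (\<Sum>xs\<in>words {1..N - 1} k. normalized_character d r (adjacent_word xs) * monomial ?y xs)" for k
  proof -
    have "complex_of_real (\<Sum>a\<leftarrow>rs. a ^ k) = (\<Sum>a\<leftarrow>map complex_of_real rs. a ^ k)"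
      by (induction rs) auto
    also have "\<dots> = mat_trace (?A ^\<^sub>m k)"
      by (rule trace_pow_eigenvalues[OF transposition_matrix_carrier cp, symmetric])
    finally have "(\<Sum>a\<leftarrow>rs. a ^ k) = Re (mat_trace (?A ^\<^sub>m k))" by (metis Re_complex_of_real)
    also have "\<dots> = (\<Sum>xs\<in>words {1..N - 1} k. monomial ?y xs * Re (mat_trace (r (adjacent_word xs))))"
      unfolding transposition_matrix_trace_pow Re_sum by (rule sum.cong[OF refl]) (simp only: Re_complex_of_real times_complex.sel Im_complex_of_real mult_zero_left diff_0_right)
    finally show ?thesis
      by (simp add: normalized_character_def sum_divide_distrib mult.commute)
  qed
  then show ?thesis using that[OF rs(1) spectral_measure_hermitian[OF transposition_matrix_carrier d rs]] by blast
qed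

end


section \<open>Weak convergence and the method of moments\<close>

abbreviation weak_subbasis :: "real measure set set" where
  "weak_subbasis \<equiv> {{\<mu>. prob_space \<mu> \<and> sets \<mu> = sets borel \<and> (\<integral>x. f x \<partial>\<mu>) \<in> U} |f U.
     continuous_on UNIV f \<and> bounded (range f) \<and> open (U :: real set)}"

lemma Union_weak_subbasis: "\<Union> weak_subbasis = {\<mu>. prob_space \<mu> \<and> sets \<mu> = sets borel}"
proof (rule subset_antisym)
  have "{\<mu>. prob_space \<mu> \<and> sets \<mu> = sets borel \<and> (\<integral>x. 0 \<partial>\<mu>) \<in> (UNIV :: real set)} \<in> weak_subbasis"
    by (intro CollectI exI[of _ "\<lambda>_. 0"] exI[of _ UNIV] conjI refl) auto
  then have "{\<mu>. prob_space \<mu> \<and> sets \<mu> = sets borel} \<in> weak_subbasis" by (simp only: UNIV_I simp_thms)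
  then show "{\<mu>. prob_space \<mu> \<and> sets \<mu> = sets borel} \<subseteq> \<Union> weak_subbasis" by (rule Union_upper)
  show "\<Union> weak_subbasis \<subseteq> {\<mu>. prob_space \<mu> \<and> sets \<mu> = sets borel}"
    by (rule Union_least) blast
qed

lemma topspace_weak_topology: "topspace weak_topology = {\<mu>. prob_space \<mu> \<and> sets \<mu> = sets borel}"
  unfolding weak_topology_def topology_generated_by_topspace by (rule Union_weak_subbasis)

lemma continuous_map_weak_topology:
  fixes \<Phi> :: "'a :: topological_space \<Rightarrow> real measure"
  assumes "\<And>z. prob_space (\<Phi> z)" "\<And>z. sets (\<Phi> z) = sets borel"
    and cont: "\<And>f :: real \<Rightarrow> real. continuous_on UNIV f \<Longrightarrow> bounded (range f) \<Longrightarrow> continuous_on UNIV (\<lambda>z. \<integral>x. f x \<partial>\<Phi> z)"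
  shows "continuous_map euclidean weak_topology \<Phi>"
  unfolding weak_topology_def
proof (rule continuous_on_generated_topo)
  fix W assume "W \<in> weak_subbasis"
  then obtain f :: "real \<Rightarrow> real" and U :: "real set" where W: "W = {\<mu>. prob_space \<mu> \<and> sets \<mu> = sets borel \<and> (\<integral>x. f x \<partial>\<mu>) \<in> U}"
    and f: "continuous_on UNIV f" "bounded (range f)" and U: "open U" by auto
  have "\<Phi> -` W = (\<lambda>z. \<integral>x. f x \<partial>\<Phi> z) -` U" using assms(1,2) by (auto simp: W)
  moreover have "open ((\<lambda>z. \<integral>x. f x \<partial>\<Phi> z) -` U)"
    using cont[OF f] U by (simp add: continuous_on_open_vimage)
  ultimately show "openin euclidean (\<Phi> -` W \<inter> topspace euclidean)" by simp
next
  show "\<Phi> ` topspace euclidean \<subseteq> \<Union> weak_subbasis"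
    unfolding Union_weak_subbasis using assms(1,2) by auto
qed

lemma limitin_weak_topology:
  assumes \<mu>: "prob_space \<mu>" "sets \<mu> = sets borel"
    and \<nu>: "\<And>k. prob_space (\<nu> k)" "\<And>k. sets (\<nu> k) = sets borel"
    and lim: "\<And>f :: real \<Rightarrow> real. continuous_on UNIV f \<Longrightarrow> bounded (range f) \<Longrightarrow> (\<lambda>k. \<integral>x. f x \<partial>\<nu> k) \<longlonglongrightarrow> (\<integral>x. f x \<partial>\<mu> :: real)"
  shows "limitin weak_topology \<nu> \<mu> sequentially"
proof -
  have "\<mu> \<in> W \<longrightarrow> (\<forall>\<^sub>F k in sequentially. \<nu> k \<in> W)" if "generate_topology_on weak_subbasis W" for W
    using that
  proof (induction W rule: generate_topology_on.induct)
    case (Int a b)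
    then show ?case by (auto intro: eventually_conj)
  next
    case (UN K)
    show ?case
    proof
      assume "\<mu> \<in> \<Union> K"
      then obtain k where "k \<in> K" "\<mu> \<in> k" by auto
      with UN have "\<forall>\<^sub>F j in sequentially. \<nu> j \<in> k" by auto
      then show "\<forall>\<^sub>F j in sequentially. \<nu> j \<in> \<Union> K"
        by (rule eventually_mono) (use \<open>k \<in> K\<close> in auto)
    qed
  next
    case (Basis s)
    then obtain f :: "real \<Rightarrow> real" and U :: "real set" where s: "s = {\<mu>. prob_space \<mu> \<and> sets \<mu> = sets borel \<and> (\<integral>x. f x \<partial>\<mu>) \<in> U}"
      and f: "continuous_on UNIV f" "bounded (range f)" and U: "open U" by auto
    show ?case
    proof
      assume "\<mu> \<in> s"
      then have "(\<integral>x. f x \<partial>\<mu>) \<in> U" by (simp add: s)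
      from topological_tendstoD[OF lim[OF f] U this]
      show "\<forall>\<^sub>F k in sequentially. \<nu> k \<in> s" by (simp add: s \<nu>)
    qed
  qed auto
  then show ?thesis
    unfolding limitin_def topspace_weak_topology using \<mu>
    by (auto simp: weak_topology_def openin_topology_generated_by_iff)
qed

text \<open>The form in which continuity of \<open>F\<close> enters the comparison argument: along
  sequences, tested on bounded continuous functions.\<close>

lemma continuous_functional_tendsto:
  assumes F: "continuous_map weak_topology euclideanreal F"
    and "prob_space \<mu>" "sets \<mu> = sets borel" "\<And>k. prob_space (\<nu> k)" "\<And>k. sets (\<nu> k) = sets borel"
    and "\<And>f :: real \<Rightarrow> real. continuous_on UNIV f \<Longrightarrow> bounded (range f) \<Longrightarrow> (\<lambda>k. \<integral>x. f x \<partial>\<nu> k) \<longlonglongrightarrow> (\<integral>x. f x \<partial>\<mu> :: real)"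
  shows "(\<lambda>k. F (\<nu> k)) \<longlonglongrightarrow> F \<mu>"
proof -
  have "limitin weak_topology \<nu> \<mu> sequentially"
    by (rule limitin_weak_topology) (use assms(2-) in auto)
  from continuous_map_limit[OF F this] show ?thesis by (simp add: comp_def)
qed

text \<open>Continuity in a Borel parameter treats all open sets of \<open>T\<close> at once,
  without a countable base. This is why the random measures are written below as continuous
  functions of real coefficients.\<close>

lemma measurable_borel_algebra_of:
  fixes \<Phi> :: "'a :: topological_space \<Rightarrow> 'c"
  assumes \<Phi>: "continuous_map euclidean T \<Phi>" and Z: "Z \<in> borel_measurable M"
  shows "(\<lambda>\<omega>. \<Phi> (Z \<omega>)) \<in> measurable M (borel_algebra_of T)"
  unfolding borel_algebra_of_def
proof (rule measurable_measure_of)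
  show "{U. openin T U} \<subseteq> Pow (topspace T)" using openin_subset by auto
  show "(\<lambda>\<omega>. \<Phi> (Z \<omega>)) \<in> space M \<rightarrow> topspace T"
    using \<Phi> by (auto simp: continuous_map_def)
  fix U assume "U \<in> {U. openin T U}"
  then have "open (\<Phi> -` U)" using \<Phi> by (auto simp: continuous_map_def vimage_def)
  then have "Z -` (\<Phi> -` U) \<inter> space M \<in> sets M"
    using Z by (intro measurable_sets[OF Z]) auto
  then show "(\<lambda>\<omega>. \<Phi> (Z \<omega>)) -` U \<inter> space M \<in> sets M" by (simp add: vimage_def)
qed

lemma continuous_functional_measurable:
  assumes F: "continuous_map T euclideanreal F"
  shows "F \<in> borel_measurable (borel_algebra_of T)"
proof (rule borel_measurableI)
  fix S :: "real set" assume "open S"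
  then have "openin T {x \<in> topspace T. F x \<in> S}" using F by (simp add: continuous_map_def)
  moreover have sp: "space (borel_algebra_of T) = topspace T"
    unfolding borel_algebra_of_def by (rule space_measure_of) (use openin_subset in auto)
  moreover have "sets (borel_algebra_of T) = sigma_sets (topspace T) {U. openin T U}"
    unfolding borel_algebra_of_def by (rule sets_measure_of) (use openin_subset in auto)
  moreover have "F -` S \<inter> topspace T = {x \<in> topspace T. F x \<in> S}" by auto
  ultimately show "F -` S \<inter> space (borel_algebra_of T) \<in> sets (borel_algebra_of T)" by auto
qed

section \<open>Gaussian measures with possibly vanishing variance\<close>

lemma prob_space_std_normal: "prob_space std_normal_distribution"
  by (rule prob_space_normal_density) simp

text \<open>Affine images of one fixed law describe the point mass and the densities uniformly, so
  that the extreme values of \<open>\<theta>\<close> need no separate treatment later.\<close>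

lemma gaussian_measure_distr:
  assumes "0 \<le> v"
  shows "gaussian_measure a v = distr std_normal_distribution borel (\<lambda>x. a + sqrt v * x)"
proof (cases "v = 0")
  case True
  interpret N: prob_space std_normal_distribution by (rule prob_space_std_normal)
  show ?thesis using True by (simp add: gaussian_measure_def N.distr_const)
next
  case False
  then have v: "0 < sqrt v" using assms by simp
  interpret N: prob_space std_normal_distribution by (rule prob_space_std_normal)
  have "distributed std_normal_distribution lborel (\<lambda>x. x) std_normal_density"
    unfolding distributed_def by (auto simp: distr_id2)
  from N.normal_density_affine[OF this, of "sqrt v" a]
  have "distributed std_normal_distribution lborel (\<lambda>x. a + sqrt v * x) (normal_density a (sqrt v))"
    using v by simp
  then have "distr std_normal_distribution lborel (\<lambda>x. a + sqrt v * x) = density lborel (normal_density a (sqrt v))"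
    by (simp add: distributed_def)
  moreover have "distr std_normal_distribution lborel (\<lambda>x. a + sqrt v * x) = distr std_normal_distribution borel (\<lambda>x. a + sqrt v * x)"
    by (rule distr_cong) auto
  ultimately show ?thesis using False by (simp add: gaussian_measure_def)
qed

lemma prob_space_gaussian_measure: "0 \<le> v \<Longrightarrow> prob_space (gaussian_measure a v)"
  and sets_gaussian_measure: "0 \<le> v \<Longrightarrow> sets (gaussian_measure a v) = sets borel"
  by (simp_all add: gaussian_measure_distr prob_space.prob_space_distr prob_space_std_normal)

lemma integral_gaussian_measure:
  assumes "0 \<le> v" and f: "f \<in> borel_measurable borel"
  shows "(\<integral>x. f x \<partial>gaussian_measure a v) = (\<integral>x. (f (a + sqrt v * x) :: real) \<partial>std_normal_distribution)"
  using f unfolding gaussian_measure_distr[OF assms(1)] by (subst integral_distr) auto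

lemma continuous_gaussian_integral:
  fixes f :: "real \<Rightarrow> real"
  assumes v: "0 \<le> v" and f: "continuous_on UNIV f" "bounded (range f)"
  shows "continuous_on UNIV (\<lambda>a. \<integral>x. f x \<partial>gaussian_measure (\<theta> * a) v)"
proof -
  interpret N: prob_space std_normal_distribution by (rule prob_space_std_normal)
  obtain B where B: "\<And>x. \<bar>f x\<bar> \<le> B" using f(2) by (auto simp: bounded_iff)
  have fm: "f \<in> borel_measurable borel" using f(1) by (rule borel_measurable_continuous_onI)
  have "(\<lambda>k. \<integral>x. f (\<theta> * u k + sqrt v * x) \<partial>std_normal_distribution) \<longlonglongrightarrow> (\<integral>x. f (\<theta> * a + sqrt v * x) \<partial>std_normal_distribution)"
    if u: "u \<longlonglongrightarrow> a" for u a
  proof (rule integral_dominated_convergence[where w = "\<lambda>_. B"])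
    show "AE x in std_normal_distribution. (\<lambda>k. f (\<theta> * u k + sqrt v * x)) \<longlonglongrightarrow> f (\<theta> * a + sqrt v * x)"
    proof (rule AE_I2)
      fix x
      have "isCont f (\<theta> * a + sqrt v * x)" using f(1) by (simp add: continuous_on_eq_continuous_at)
      moreover have "(\<lambda>k. \<theta> * u k + sqrt v * x) \<longlonglongrightarrow> \<theta> * a + sqrt v * x"
        using u by (intro tendsto_intros)
      ultimately show "(\<lambda>k. f (\<theta> * u k + sqrt v * x)) \<longlonglongrightarrow> f (\<theta> * a + sqrt v * x)"
        by (rule isCont_tendsto_compose)
    qed
  qed (use fm B in auto)
  then show ?thesis
    unfolding integral_gaussian_measure[OF v fm] by (auto simp: continuous_on_sequentially comp_def)
qed

lemma continuous_map_gaussian_measure: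
  assumes "0 \<le> v"
  shows "continuous_map euclidean weak_topology (\<lambda>a. gaussian_measure (\<theta> * a) v)"
  by (rule continuous_map_weak_topology)
     (simp_all add: prob_space_gaussian_measure[OF assms] sets_gaussian_measure[OF assms] continuous_gaussian_integral[OF assms])

section \<open>The method of moments\<close>

lemma power_over_fact_tendsto_0: "(\<lambda>q. x ^ q / fact q) \<longlonglongrightarrow> (0 :: real)"
  using summable_LIMSEQ_zero[OF summable_exp[of x]] by (simp add: divide_inverse mult.commute)

lemma abs_power_even: "\<bar>u :: real\<bar> ^ (2 * q) = u ^ (2 * q)"
  by (rule power_even_abs) simp

text \<open>Separating \<open>a\<close> from \<open>b * x\<close> costs \<open>2 ^ (2 * q)\<close>.
  The even moment \<open>fact (2 * q) / (2 ^ q * fact q)\<close> cancels the factorial, and what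
  remains are terms of two convergent exponential series.\<close>

lemma gaussian_moment_growth:
  "(\<lambda>q. \<bar>t\<bar> ^ (2 * q) / fact (2 * q) * (\<integral>x. (a + b * x) ^ (2 * q) \<partial>std_normal_distribution)) \<longlonglongrightarrow> 0"
proof (rule tendsto_sandwich[OF always_eventually always_eventually tendsto_const])
  let ?N = std_normal_distribution
  have nn: "0 \<le> u ^ (2 * q)" for u :: real and q by simp
  show "\<forall>q. 0 \<le> \<bar>t\<bar> ^ (2 * q) / fact (2 * q) * (\<integral>x. (a + b * x) ^ (2 * q) \<partial>?N)"
    by (intro allI mult_nonneg_nonneg divide_nonneg_pos Bochner_Integration.integral_nonneg nn) auto
  let ?g = "\<lambda>q. (2 * \<bar>t\<bar> * \<bar>a\<bar>) ^ (2 * q) / fact (2 * q) + ((2 * t * b)\<^sup>2 / 2) ^ q / fact q"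
  show "\<forall>q. \<bar>t\<bar> ^ (2 * q) / fact (2 * q) * (\<integral>x. (a + b * x) ^ (2 * q) \<partial>?N) \<le> ?g q"
  proof
    fix q
    have pw: "(u + w) ^ (2 * q) \<le> 2 ^ (2 * q) * (u ^ (2 * q) + w ^ (2 * q))" for u w :: real
    proof -
      have "(u + w) ^ (2 * q) = \<bar>u + w\<bar> ^ (2 * q)" by (rule power_even_abs[symmetric]) simp
      also have "\<dots> \<le> (2 * max \<bar>u\<bar> \<bar>w\<bar>) ^ (2 * q)" by (intro power_mono) auto
      also have "\<dots> = 2 ^ (2 * q) * max \<bar>u\<bar> \<bar>w\<bar> ^ (2 * q)" by (simp add: power_mult_distrib)
      also have "max \<bar>u\<bar> \<bar>w\<bar> ^ (2 * q) \<le> u ^ (2 * q) + w ^ (2 * q)"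
        using nn[of u q] nn[of w q] by (auto simp: max_def abs_power_even)
      finally show ?thesis by simp
    qed
    have "(\<integral>x. (a + b * x) ^ (2 * q) \<partial>?N) \<le> (\<integral>x. 2 ^ (2 * q) * (a ^ (2 * q) + b ^ (2 * q) * x ^ (2 * q)) \<partial>?N)"
    proof (rule integral_mono)
      interpret N: prob_space ?N by (rule prob_space_std_normal)
      show "integrable ?N (\<lambda>x. 2 ^ (2 * q) * (a ^ (2 * q) + b ^ (2 * q) * x ^ (2 * q)))"
        by (intro integrable_mult_right Bochner_Integration.integrable_add integrable_std_normal_distribution_moment N.integrable_const)
      show "(a + b * x) ^ (2 * q) \<le> 2 ^ (2 * q) * (a ^ (2 * q) + b ^ (2 * q) * x ^ (2 * q))" for x
        using pw[of a "b * x"] by (simp add: power_mult_distrib)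
    qed (rule integrable_std_normal_affine_power)
    also have "\<dots> = 2 ^ (2 * q) * (a ^ (2 * q) + b ^ (2 * q) * (fact (2 * q) / (2 ^ q * fact q)))"
    proof -
      interpret N: prob_space ?N by (rule prob_space_std_normal)
      have "N.prob UNIV = 1" using N.prob_space by simp
      then show ?thesis
        by (simp add: integrable_std_normal_distribution_moment std_normal_distribution_even_moments(1))
    qed
    finally have "\<bar>t\<bar> ^ (2 * q) / fact (2 * q) * (\<integral>x. (a + b * x) ^ (2 * q) \<partial>?N) \<le>
       \<bar>t\<bar> ^ (2 * q) / fact (2 * q) * (2 ^ (2 * q) * (a ^ (2 * q) + b ^ (2 * q) * (fact (2 * q) / (2 ^ q * fact q))))"
      by (intro mult_left_mono) auto
    also have "\<dots> = ?g q"
    proof -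
      have alg: "T / f * (W * (A + C * (f / (k * g)))) = W * T * A / f + (W * T * C / k) / g"
        if "f \<noteq> 0" "k \<noteq> 0" "g \<noteq> 0" for T f W A C k g :: real
        using that by (simp add: field_simps)
      have e1: "(2 * \<bar>t\<bar> * \<bar>a\<bar>) ^ (2 * q) = 2 ^ (2 * q) * t ^ (2 * q) * a ^ (2 * q)"
        by (simp only: power_mult_distrib abs_power_even)
      have e2: "((2 * t * b)\<^sup>2 / 2) ^ q = 2 ^ (2 * q) * t ^ (2 * q) * b ^ (2 * q) / 2 ^ q"
        by (simp only: power_divide power_mult[symmetric] power_mult_distrib)
      show ?thesis unfolding e1 e2 abs_power_even by (rule alg) simp_all
    qed
    finally show "\<bar>t\<bar> ^ (2 * q) / fact (2 * q) * (\<integral>x. (a + b * x) ^ (2 * q) \<partial>?N) \<le> ?g q" .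
  qed
  have "(\<lambda>q. (2 * \<bar>t\<bar> * \<bar>a\<bar>) ^ (2 * q) / fact (2 * q)) \<longlonglongrightarrow> 0"
    using LIMSEQ_subseq_LIMSEQ[OF power_over_fact_tendsto_0, of "\<lambda>q. 2 * q"] by (simp add: strict_mono_def comp_def)
  from tendsto_add[OF this power_over_fact_tendsto_0[of "(2 * t * b)\<^sup>2 / 2"]]
  show "?g \<longlonglongrightarrow> 0" by simp
qed

text \<open>The method of moments for a limit whose moments grow slowly enough for the Taylor expansion
  of its characteristic function to converge.\<close>

lemma moments_imp_weak_convergence:
  assumes \<nu>: "\<And>k. real_distribution (\<nu> k)" "\<And>k p. integrable (\<nu> k) (\<lambda>x. x ^ p)"
    and \<mu>: "real_distribution \<mu>" "\<And>p. integrable \<mu> (\<lambda>x. x ^ p)"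
    and growth: "\<And>t. (\<lambda>q. \<bar>t\<bar> ^ (2 * q) / fact (2 * q) * (\<integral>x. x ^ (2 * q) \<partial>\<mu>)) \<longlonglongrightarrow> 0"
    and mom: "\<And>p. (\<lambda>k. \<integral>x. x ^ p \<partial>\<nu> k) \<longlonglongrightarrow> (\<integral>x. x ^ p \<partial>\<mu>)"
  shows "weak_conv_m \<nu> \<mu>"
proof (rule levy_continuity[OF \<nu>(1) \<mu>(1)])
  fix t
  define S where "S q \<rho> = (\<Sum>k\<le>2 * q. (\<i> * complex_of_real t) ^ k / fact k * complex_of_real (\<integral>x. x ^ k \<partial>\<rho>))" for q :: nat and \<rho> :: "real measure"
  \<comment> \<open>The factor 2 is that of the error bound \<open>char_approx1\<close>. As the
    order \<open>2 * q\<close> is even, the absolute moment in that bound is an ordinary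
    moment.\<close>
  define c where "c q = 2 * (\<bar>t\<bar> ^ (2 * q) / fact (2 * q))" for q :: nat
  have app: "cmod (char \<rho> t - S q \<rho>) \<le> c q * (\<integral>x. x ^ (2 * q) \<partial>\<rho>)"
    if "real_distribution \<rho>" "\<And>p. integrable \<rho> (\<lambda>x. x ^ p)" for \<rho> q
    using real_distribution.char_approx1[OF that, where n = "2 * q" and t = t] by (simp add: S_def c_def abs_power_even)
  show "(\<lambda>k. char (\<nu> k) t) \<longlonglongrightarrow> char \<mu> t"
  proof (rule tendstoI)
    fix e :: real assume e: "0 < e"
    \<comment> \<open>The order \<open>q\<close> is fixed from \<open>\<mu>\<close> alone; for this
      one \<open>q\<close> the remainder of \<open>\<nu> k\<close> is controlled too, because its
      moment of order \<open>2 * q\<close> converges to that of \<open>\<mu>\<close>.\<close>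
    have "(\<lambda>q. c q * (\<integral>x. x ^ (2 * q) \<partial>\<mu>)) \<longlonglongrightarrow> 0"
      using tendsto_mult[OF tendsto_const[of 2] growth[of t]] by (simp add: c_def mult.assoc)
    then have "\<forall>\<^sub>F q in sequentially. c q * (\<integral>x. x ^ (2 * q) \<partial>\<mu>) < e / 2"
      using e by (intro order_tendstoD(2)) auto
    then obtain q where q: "c q * (\<integral>x. x ^ (2 * q) \<partial>\<mu>) < e / 2"
      using eventually_happens by fastforce
    have "(\<lambda>k. S q (\<nu> k)) \<longlonglongrightarrow> S q \<mu>"
      unfolding S_def by (intro tendsto_intros mom)
    then have "(\<lambda>k. cmod (S q (\<nu> k) - S q \<mu>)) \<longlonglongrightarrow> 0"
      by (simp add: tendsto_norm_zero_iff LIM_zero_iff)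
    then have "(\<lambda>k. c q * (\<integral>x. x ^ (2 * q) \<partial>\<nu> k) + cmod (S q (\<nu> k) - S q \<mu>) + c q * (\<integral>x. x ^ (2 * q) \<partial>\<mu>)) \<longlonglongrightarrow>
        c q * (\<integral>x. x ^ (2 * q) \<partial>\<mu>) + 0 + c q * (\<integral>x. x ^ (2 * q) \<partial>\<mu>)"
      by (intro tendsto_intros mom)
    then have "\<forall>\<^sub>F k in sequentially. c q * (\<integral>x. x ^ (2 * q) \<partial>\<nu> k) + cmod (S q (\<nu> k) - S q \<mu>) + c q * (\<integral>x. x ^ (2 * q) \<partial>\<mu>) < e"
      by (rule order_tendstoD(2)) (use q in linarith)
    then show "\<forall>\<^sub>F k in sequentially. dist (char (\<nu> k) t) (char \<mu> t) < e"
    proof (rule eventually_mono)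
      fix k assume k: "c q * (\<integral>x. x ^ (2 * q) \<partial>\<nu> k) + cmod (S q (\<nu> k) - S q \<mu>) + c q * (\<integral>x. x ^ (2 * q) \<partial>\<mu>) < e"
      have "dist (char (\<nu> k) t) (char \<mu> t) \<le> dist (char (\<nu> k) t) (S q (\<nu> k)) + dist (S q (\<nu> k)) (S q \<mu>) + dist (S q \<mu>) (char \<mu> t)"
        using dist_triangle[of "char (\<nu> k) t" "char \<mu> t" "S q (\<nu> k)"] dist_triangle[of "S q (\<nu> k)" "char \<mu> t" "S q \<mu>"] by linarith
      moreover have "dist (char (\<nu> k) t) (S q (\<nu> k)) \<le> c q * (\<integral>x. x ^ (2 * q) \<partial>\<nu> k)"
        unfolding dist_norm by (rule app[OF \<nu>])
      moreover have "dist (S q \<mu>) (char \<mu> t) \<le> c q * (\<integral>x. x ^ (2 * q) \<partial>\<mu>)"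
        using app[OF \<mu>, of q] by (simp only: dist_norm norm_minus_commute)
      ultimately show "dist (char (\<nu> k) t) (char \<mu> t) < e" using k by (simp add: dist_norm)
    qed
  qed
qed


section \<open>Continuous dependence of empirical measures on a parameter\<close>

lemma abs_sum_list_le:
  fixes h :: "'a \<Rightarrow> real"
  assumes "\<And>a. a \<in> set xs \<Longrightarrow> \<bar>h a\<bar> \<le> e"
  shows "\<bar>\<Sum>a\<leftarrow>xs. h a\<bar> \<le> real (length xs) * e"
  using assms
proof (induction xs)
  case (Cons a xs)
  have "\<bar>h a\<bar> \<le> e" "\<bar>\<Sum>a\<leftarrow>xs. h a\<bar> \<le> real (length xs) * e" using Cons by simp_all
  then show ?case by (simp add: algebra_simps abs_le_iff)
qed simp

lemma sum_list_polynomial: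
  "(\<Sum>a\<leftarrow>xs. \<Sum>i\<le>n. c i * a ^ i) = (\<Sum>i\<le>n. c i * (\<Sum>a\<leftarrow>xs. a ^ i :: real))"
  by (induction xs) (simp_all add: distrib_left sum.distrib)

text \<open>On a neighbourhood where the second moment is bounded, the support stays in a fixed
  compact interval, on which \<open>f\<close> is uniformly approximated by polynomials.\<close>

lemma continuous_empirical_integral:
  fixes rs :: "'a :: topological_space \<Rightarrow> real list"
  assumes len: "\<And>z. length (rs z) = d" and d: "0 < d"
    and mom: "\<And>k. continuous_on UNIV (\<lambda>z. (\<Sum>a\<leftarrow>rs z. a ^ k) / real d)"
    and f: "continuous_on UNIV f"
  shows "continuous_on UNIV (\<lambda>z. \<integral>x. f x \<partial>empirical_measure (rs z) :: real)"
proof -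
  define g where "g h z = (\<Sum>a\<leftarrow>rs z. h a) / real d" for h :: "real \<Rightarrow> real" and z
  have fm: "f \<in> borel_measurable borel" using f by (rule borel_measurable_continuous_onI)
  have ne: "rs z \<noteq> []" for z using len[of z] d by auto
  have eq: "(\<lambda>z. \<integral>x. f x \<partial>empirical_measure (rs z)) = g f"
    unfolding integral_empirical_measure(1)[OF ne fm] len g_def ..
  have "(g f \<longlongrightarrow> g f z0) (at z0)" for z0
  proof (rule tendstoI)
    fix e :: real assume e: "0 < e"
    \<comment> \<open>Through \<open>\<bar>a\<bar> \<le> 1 + a\<^sup>2\<close> this continuous
      function of \<open>z\<close> bounds every entry of the list; adding 1 to its value at
      \<open>z0\<close> leaves room for a neighbourhood.\<close>
    define R where "R z = 1 + (\<Sum>a\<leftarrow>rs z. a ^ 2)" for z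
    define R0 where "R0 = R z0 + 1"
    have Rc: "(R \<longlongrightarrow> R z0) (at z0)"
    proof -
      have "R = (\<lambda>z. 1 + real d * ((\<Sum>a\<leftarrow>rs z. a ^ 2) / real d))" using d by (simp add: R_def[abs_def])
      moreover have "continuous_on UNIV (\<lambda>z. 1 + real d * ((\<Sum>a\<leftarrow>rs z. a ^ 2) / real d))"
        by (intro continuous_intros mom)
      ultimately show ?thesis by (simp add: continuous_on_def)
    qed
    have RR: "\<bar>a\<bar> \<le> R z" if "a \<in> set (rs z)" for a z
    proof -
      have "a ^ 2 \<le> (\<Sum>a\<leftarrow>rs z. a ^ 2)" by (rule member_le_sum_list) (use that in auto)
      moreover have "\<bar>a\<bar> \<le> 1 + a ^ 2"
      proof -
        have "0 \<le> (\<bar>a\<bar> - 1)\<^sup>2" by simp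
        then have "2 * \<bar>a\<bar> \<le> 1 + a ^ 2" by (simp add: power2_diff)
        then show ?thesis using abs_ge_zero[of a] by linarith
      qed
      ultimately show ?thesis by (simp add: R_def)
    qed
    obtain q where q: "real_polynomial_function q" "\<And>x. x \<in> {-R0..R0} \<Longrightarrow> \<bar>f x - q x\<bar> < e / 3"
      using Stone_Weierstrass_real_polynomial_function[of "{-R0..R0}" f "e / 3"] e continuous_on_subset[OF f]
      by auto
    obtain c n where qc: "q = (\<lambda>x. \<Sum>i\<le>n. c i * x ^ i)"
      using q(1) by (auto simp: real_polynomial_function_iff_sum)
    have near: "\<bar>g f z - g q z\<bar> \<le> e / 3" if "R z < R0" for z
    proof -
      have "\<bar>\<Sum>a\<leftarrow>rs z. f a - q a\<bar> \<le> real (length (rs z)) * (e / 3)"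
      proof (rule abs_sum_list_le)
        fix a assume "a \<in> set (rs z)"
        then have "a \<in> {-R0..R0}" using RR[of a z] that by auto
        then show "\<bar>f a - q a\<bar> \<le> e / 3" using q(2) by (simp add: less_imp_le)
      qed
      then have "\<bar>\<Sum>a\<leftarrow>rs z. f a - q a\<bar> / real d \<le> e / 3" using d by (simp add: len field_simps)
      moreover have "g f z - g q z = (\<Sum>a\<leftarrow>rs z. f a - q a) / real d"
        by (simp add: g_def sum_list_subtractf diff_divide_distrib)
      ultimately show ?thesis by simp
    qed
    have "g q = (\<lambda>z. \<Sum>i\<le>n. c i * ((\<Sum>a\<leftarrow>rs z. a ^ i) / real d))"
      unfolding g_def[abs_def] qc sum_list_polynomial by (simp add: sum_divide_distrib)
    moreover have "continuous_on UNIV (\<lambda>z. \<Sum>i\<le>n. c i * ((\<Sum>a\<leftarrow>rs z. a ^ i) / real d))"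
      by (intro continuous_intros mom)
    ultimately have "(g q \<longlongrightarrow> g q z0) (at z0)" by (simp add: continuous_on_def)
    then have "\<forall>\<^sub>F z in at z0. dist (g q z) (g q z0) < e / 3"
      by (rule tendstoD) (use e in simp)
    moreover have "\<forall>\<^sub>F z in at z0. R z < R0"
      by (rule order_tendstoD(2)[OF Rc]) (simp add: R0_def)
    ultimately show "\<forall>\<^sub>F z in at z0. dist (g f z) (g f z0) < e"
    proof eventually_elim
      case (elim z)
      have "\<bar>g f z0 - g q z0\<bar> \<le> e / 3" by (rule near) (simp add: R0_def)
      with near[of z] elim show ?case unfolding dist_real_def by linarith
    qed
  qed
  then show ?thesis unfolding eq by (simp add: continuous_on_def)
qed

lemma continuous_monomial: "continuous_on UNIV (\<lambda>z :: nat \<Rightarrow> real. monomial (\<lambda>k. c * z k) xs)"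
  by (induction xs) (simp_all, intro continuous_intros continuous_on_product_coordinates)

section \<open>From closeness of moments to closeness of functionals\<close>

lemma limit_moment_tendsto:
  assumes "(a \<longlongrightarrow> a0) F" "(v \<longlongrightarrow> v0) F"
  shows "((\<lambda>k. limit_moment \<theta> p (a k) (v k)) \<longlongrightarrow> limit_moment \<theta> p a0 v0) F"
  unfolding limit_moment_def integral_std_normal_affine_power by (intro tendsto_intros assms)

lemma limit_moment_gaussian:
  assumes "\<bar>\<theta>\<bar> \<le> 1"
  shows "(\<integral>x. x ^ p \<partial>gaussian_measure (\<theta> * a) (1 - \<theta>\<^sup>2)) = limit_moment \<theta> p a 1"
  using assms by (subst integral_gaussian_measure) (auto simp: limit_moment_def abs_square_le_1)

lemma weak_convergence_to_gaussian:
  assumes \<theta>: "\<bar>\<theta>\<bar> \<le> 1" and ne: "\<And>k. rs k \<noteq> []"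
    and mom: "\<And>p. (\<lambda>k. (\<Sum>x\<leftarrow>rs k. x ^ p) / real (length (rs k))) \<longlonglongrightarrow> limit_moment \<theta> p a 1"
    and F: "continuous_map weak_topology euclideanreal F"
  shows "(\<lambda>k. F (empirical_measure (rs k))) \<longlonglongrightarrow> F (gaussian_measure (\<theta> * a) (1 - \<theta>\<^sup>2))"
proof -
  let ?\<mu> = "gaussian_measure (\<theta> * a) (1 - \<theta>\<^sup>2)" and ?\<nu> = "\<lambda>k. empirical_measure (rs k)"
  have v: "0 \<le> 1 - \<theta>\<^sup>2" using \<theta> by (simp add: abs_square_le_1)
  have rd: "real_distribution (?\<nu> k)" for k
    unfolding real_distribution_def real_distribution_axioms_def using prob_space_empirical_measure
    by (auto simp: empirical_measure_def)
  have rd\<mu>: "real_distribution ?\<mu>"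
    unfolding real_distribution_def real_distribution_axioms_def
    using prob_space_gaussian_measure[OF v] sets_gaussian_measure[OF v] by (auto dest: sets_eq_imp_space_eq)
  have im: "integrable ?\<mu> (\<lambda>x. x ^ p)" for p
    unfolding gaussian_measure_distr[OF v]
    by (subst integrable_distr_eq) (auto intro: integrable_std_normal_affine_power)
  have wc: "weak_conv_m ?\<nu> ?\<mu>"
  proof (rule moments_imp_weak_convergence[OF rd _ rd\<mu> im])
    show "integrable (?\<nu> k) (\<lambda>x. x ^ p)" for k p by (rule integral_empirical_measure(2)[OF ne]) simp
    show "(\<lambda>q. \<bar>t\<bar> ^ (2 * q) / fact (2 * q) * (\<integral>x. x ^ (2 * q) \<partial>?\<mu>)) \<longlonglongrightarrow> 0" for t
      using gaussian_moment_growth[of t "\<theta> * a" "sqrt (1 - \<theta>\<^sup>2)"]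
      by (subst integral_gaussian_measure[OF v]) auto
    show "(\<lambda>k. \<integral>x. x ^ p \<partial>?\<nu> k) \<longlonglongrightarrow> (\<integral>x. x ^ p \<partial>?\<mu>)" for p
      using mom[of p] by (simp add: integral_empirical_measure(1)[OF ne] limit_moment_gaussian[OF \<theta>])
  qed
  show ?thesis
  proof (rule continuous_functional_tendsto[OF F prob_space_gaussian_measure[OF v] sets_gaussian_measure[OF v]
        prob_space_empirical_measure sets_empirical_measure])
    fix f :: "real \<Rightarrow> real" assume f: "continuous_on UNIV f" "bounded (range f)"
    obtain B where B: "\<And>x. norm (f x) \<le> B" using f(2) by (auto simp: bounded_iff)
    show "(\<lambda>k. \<integral>x. f x \<partial>?\<nu> k) \<longlonglongrightarrow> (\<integral>x. f x \<partial>?\<mu>)"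
      by (rule weak_conv_imp_integral_bdd_continuous_conv[OF rd rd\<mu> wc _ B])
         (use f(1) in \<open>simp add: continuous_on_eq_continuous_at\<close>)
  qed
qed

text \<open>Finitely many moments and one tolerance suffice uniformly for \<open>a\<close> in a
  bounded range; this makes second moment bounds applicable. Otherwise there are counterexamples
  along which \<open>a\<close> converges to some \<open>l\<close>, and then both functionals
  converge to the value at the Gaussian measure with parameter \<open>l\<close>.\<close>

lemma uniform_closeness_to_gaussian:
  assumes \<theta>: "\<bar>\<theta>\<bar> \<le> 1" and F: "continuous_map weak_topology euclideanreal F" and e: "0 < e"
  shows "\<exists>K \<delta>. 0 < \<delta> \<and> (\<forall>rs a v. rs \<noteq> [] \<longrightarrow> \<bar>a\<bar> \<le> R \<longrightarrow> \<bar>v - 1\<bar> \<le> \<delta> \<longrightarrow>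
      (\<forall>p\<le>K. \<bar>(\<Sum>x\<leftarrow>rs. x ^ p) / real (length rs) - limit_moment \<theta> p a v\<bar> \<le> \<delta>) \<longrightarrow>
      \<bar>F (empirical_measure rs) - F (gaussian_measure (\<theta> * a) (1 - \<theta>\<^sup>2))\<bar> < e)"
proof (rule ccontr)
  let ?G = "\<lambda>a. gaussian_measure (\<theta> * a) (1 - \<theta>\<^sup>2)"
  have vv: "0 \<le> 1 - \<theta>\<^sup>2" using \<theta> by (simp add: abs_square_le_1)
  assume contra: "\<not> ?thesis"
  \<comment> \<open>Choosing \<open>K = k\<close> and \<open>\<delta> = 1 / (k + 1)\<close> together
    ensures that every fixed moment is eventually controlled with vanishing error.\<close>
  have "\<exists>rs a v. rs \<noteq> [] \<and> \<bar>a\<bar> \<le> R \<and> \<bar>v - 1\<bar> \<le> 1 / real (Suc k) \<and>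
      (\<forall>p\<le>k. \<bar>(\<Sum>x\<leftarrow>rs. x ^ p) / real (length rs) - limit_moment \<theta> p a v\<bar> \<le> 1 / real (Suc k)) \<and>
      e \<le> \<bar>F (empirical_measure rs) - F (?G a)\<bar>" for k
  proof -
    have "0 < 1 / real (Suc k)" by simp
    with contra show ?thesis by (metis not_less)
  qed
  then obtain rs a v where ne: "\<And>k. rs k \<noteq> []" and a: "\<And>k. \<bar>a k\<bar> \<le> R" and v: "\<And>k. \<bar>v k - 1\<bar> \<le> 1 / real (Suc k)"
    and mom: "\<And>k p. p \<le> k \<Longrightarrow> \<bar>(\<Sum>x\<leftarrow>rs k. x ^ p) / real (length (rs k)) - limit_moment \<theta> p (a k) (v k)\<bar> \<le> 1 / real (Suc k)"
    and far: "\<And>k. e \<le> \<bar>F (empirical_measure (rs k)) - F (?G (a k))\<bar>"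
    by metis
  have inv0: "(\<lambda>k. 1 / real (Suc k)) \<longlonglongrightarrow> 0" by (rule LIMSEQ_Suc[OF lim_1_over_n])
  have "compact {-R..R}" by simp
  moreover have "\<forall>k. a k \<in> {-R..R}" using a by (auto simp: abs_le_iff minus_le_iff)
  ultimately obtain l s where l: "strict_mono s" "(a \<circ> s) \<longlonglongrightarrow> l"
    unfolding compact_def by metis
  have inv: "(\<lambda>k. 1 / real (Suc (s k))) \<longlonglongrightarrow> 0"
    using LIMSEQ_subseq_LIMSEQ[OF inv0 l(1)] by (simp add: comp_def)
  have vs: "(\<lambda>k. v (s k)) \<longlonglongrightarrow> 1"
  proof -
    have "(\<lambda>k. v (s k) - 1) \<longlonglongrightarrow> 0"
      by (rule Lim_null_comparison[OF _ inv]) (use v in simp)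
    then show ?thesis by (simp add: LIM_zero_iff)
  qed
  have as: "(\<lambda>k. a (s k)) \<longlonglongrightarrow> l" using l(2) by (simp add: comp_def)
  have ms: "(\<lambda>k. (\<Sum>x\<leftarrow>rs (s k). x ^ p) / real (length (rs (s k)))) \<longlonglongrightarrow> limit_moment \<theta> p l 1" for p
  proof -
    have "(\<lambda>k. (\<Sum>x\<leftarrow>rs (s k). x ^ p) / real (length (rs (s k))) - limit_moment \<theta> p (a (s k)) (v (s k))) \<longlonglongrightarrow> 0"
    proof (rule Lim_null_comparison[OF _ inv])
      show "\<forall>\<^sub>F k in sequentially. norm ((\<Sum>x\<leftarrow>rs (s k). x ^ p) / real (length (rs (s k))) - limit_moment \<theta> p (a (s k)) (v (s k))) \<le> 1 / real (Suc (s k))"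
        unfolding eventually_sequentially real_norm_def
        using mom seq_suble[OF l(1)] by (meson order_trans)
    qed
    from tendsto_add[OF this limit_moment_tendsto[OF as vs, of \<theta> p]] show ?thesis by simp
  qed
  have "(\<lambda>k. F (empirical_measure (rs (s k)))) \<longlonglongrightarrow> F (?G l)"
    by (rule weak_convergence_to_gaussian[OF \<theta> ne ms F])
  moreover have "(\<lambda>k. F (?G (a (s k)))) \<longlonglongrightarrow> F (?G l)"
  proof -
    have "continuous_map euclidean euclideanreal (F \<circ> ?G)"
      by (rule continuous_map_compose[OF continuous_map_gaussian_measure[OF vv] F])
    then have "isCont (\<lambda>a. F (?G a)) l"
      by (simp add: comp_def continuous_on_eq_continuous_at)
    then show ?thesis using as by (rule isCont_tendsto_compose)
  qed
  ultimately have "(\<lambda>k. \<bar>F (empirical_measure (rs (s k))) - F (?G (a (s k)))\<bar>) \<longlonglongrightarrow> \<bar>F (?G l) - F (?G l)\<bar>"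
    by (intro tendsto_intros)
  then have "\<forall>\<^sub>F k in sequentially. \<bar>F (empirical_measure (rs (s k))) - F (?G (a (s k)))\<bar> < e"
    using e by (intro order_tendstoD(2)) auto
  then obtain k where "\<bar>F (empirical_measure (rs (s k))) - F (?G (a (s k)))\<bar> < e"
    using eventually_happens by fastforce
  then show False using far[of "s k"] by simp
qed

section \<open>The expected measure of the limit\<close>

lemma gaussian_kernel_measurable:
  assumes "0 \<le> v"
  shows "(\<lambda>a. gaussian_measure (\<theta> * a) v) \<in> borel \<rightarrow>\<^sub>M subprob_algebra borel"
proof -
  interpret N: prob_space std_normal_distribution by (rule prob_space_std_normal)
  have "(\<lambda>_ :: real. std_normal_distribution) \<in> borel \<rightarrow>\<^sub>M subprob_algebra borel"
    by (rule measurable_const) (auto simp: space_subprob_algebra N.subprob_space_axioms)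
  then show ?thesis
    unfolding gaussian_measure_distr[OF assms]
    by (intro measurable_distr2[where M = borel]) simp_all
qed

text \<open>The mixture is the law of \<open>\<theta> * a + sqrt (1 - \<theta>\<^sup>2) * x\<close>
  for independent standard Gaussian \<open>a\<close> and \<open>x\<close>; the characteristic
  function factorizes and the two variances add up to 1.\<close>

lemma bind_gaussian_measure:
  assumes P: "prob_space P" and G: "distributed P lborel G std_normal_density" and \<theta>: "\<bar>\<theta>\<bar> \<le> 1"
  shows "bind P (\<lambda>\<omega>. gaussian_measure (\<theta> * G \<omega>) (1 - \<theta>\<^sup>2)) = std_normal_distribution"
proof -
  let ?N = std_normal_distribution and ?s = "sqrt (1 - \<theta>\<^sup>2)"
  let ?K = "\<lambda>a. gaussian_measure (\<theta> * a) (1 - \<theta>\<^sup>2)"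
  interpret P: prob_space P by (rule P)
  interpret N: prob_space ?N by (rule prob_space_std_normal)
  interpret NN: pair_prob_space ?N ?N ..
  have v: "0 \<le> 1 - \<theta>\<^sup>2" using \<theta> by (simp add: abs_square_le_1)
  have Gm: "G \<in> P \<rightarrow>\<^sub>M borel" using G by (auto simp: distributed_def)
  have Gd: "distr P borel G = ?N"
  proof -
    have "distr P borel G = distr P lborel G" by (rule distr_cong) auto
    then show ?thesis using G by (simp add: distributed_def)
  qed
  note K = gaussian_kernel_measurable[OF v, of \<theta>]
  have KN: "?K \<in> ?N \<rightarrow>\<^sub>M subprob_algebra borel"
    using K by (subst measurable_cong_sets[of ?N borel]) auto
  have meas: "(\<lambda>(a, x). \<theta> * a + ?s * x) \<in> borel_measurable (?N \<Otimes>\<^sub>M ?N)" by measurable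
  have "bind P (\<lambda>\<omega>. ?K (G \<omega>)) = bind (distr P borel G) ?K"
    by (rule bind_distr[OF Gm K, symmetric]) (rule P.not_empty)
  also have "\<dots> = bind ?N ?K" unfolding Gd ..
  also have "\<dots> = distr (?N \<Otimes>\<^sub>M ?N) borel (\<lambda>(a, x). \<theta> * a + ?s * x)"
  proof (rule measure_eqI)
    have sb: "sets (bind ?N ?K) = sets borel"
      by (rule sets_bind) (auto simp: sets_gaussian_measure[OF v])
    then show "sets (bind ?N ?K) = sets (distr (?N \<Otimes>\<^sub>M ?N) borel (\<lambda>(a, x). \<theta> * a + ?s * x))" by simp
    fix A assume "A \<in> sets (bind ?N ?K)"
    then have A: "A \<in> sets borel" using sb by simp
    have "emeasure (bind ?N ?K) A = (\<integral>\<^sup>+a. emeasure (?K a) A \<partial>?N)"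
      by (rule emeasure_bind[OF _ KN A]) simp
    also have "\<dots> = (\<integral>\<^sup>+a. (\<integral>\<^sup>+x. indicator A (\<theta> * a + ?s * x) \<partial>?N) \<partial>?N)"
    proof (rule nn_integral_cong)
      fix a
      have "emeasure (?K a) A = (\<integral>\<^sup>+x. indicator A x \<partial>?K a)"
        using A by (simp add: sets_gaussian_measure[OF v])
      also have "\<dots> = (\<integral>\<^sup>+x. indicator A (\<theta> * a + ?s * x) \<partial>?N)"
        unfolding gaussian_measure_distr[OF v] using A by (subst nn_integral_distr) auto
      finally show "emeasure (?K a) A = (\<integral>\<^sup>+x. indicator A (\<theta> * a + ?s * x) \<partial>?N)" .
    qed
    also have "\<dots> = (\<integral>\<^sup>+z. indicator A ((\<lambda>(a, x). \<theta> * a + ?s * x) z) \<partial>(?N \<Otimes>\<^sub>M ?N))"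
      using A by (subst N.nn_integral_fst[symmetric]) (auto intro!: measurable_compose[OF meas])
    also have "\<dots> = (\<integral>\<^sup>+x. indicator A x \<partial>distr (?N \<Otimes>\<^sub>M ?N) borel (\<lambda>(a, x). \<theta> * a + ?s * x))"
      using A meas by (subst nn_integral_distr) auto
    also have "\<dots> = emeasure (distr (?N \<Otimes>\<^sub>M ?N) borel (\<lambda>(a, x). \<theta> * a + ?s * x)) A"
      using A by simp
    finally show "emeasure (bind ?N ?K) A = emeasure (distr (?N \<Otimes>\<^sub>M ?N) borel (\<lambda>(a, x). \<theta> * a + ?s * x)) A" .
  qed
  also have "\<dots> = ?N"
  proof (rule Levy_uniqueness)
    show "real_distribution (distr (?N \<Otimes>\<^sub>M ?N) borel (\<lambda>(a, x). \<theta> * a + ?s * x))"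
      using meas by (rule NN.real_distribution_distr)
    show "real_distribution ?N" by (rule real_dist_normal_dist)
    show "char (distr (?N \<Otimes>\<^sub>M ?N) borel (\<lambda>(a, x). \<theta> * a + ?s * x)) = char ?N"
    proof
      fix t
      have int: "integrable (?N \<Otimes>\<^sub>M ?N) (\<lambda>(a, x). iexp (t * (\<theta> * a + ?s * x)))"
        by (rule NN.integrable_const_bound[where B = 1]) (auto simp: split_beta')
      have "char (distr (?N \<Otimes>\<^sub>M ?N) borel (\<lambda>(a, x). \<theta> * a + ?s * x)) t =
          (\<integral>z. (case z of (a, x) \<Rightarrow> iexp (t * (\<theta> * a + ?s * x))) \<partial>(?N \<Otimes>\<^sub>M ?N))"
        unfolding char_def using meas by (subst integral_distr) (auto simp: split_beta')
      also have "\<dots> = (\<integral>a. (\<integral>x. iexp (t * (\<theta> * a + ?s * x)) \<partial>?N) \<partial>?N)"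
        using NN.integral_fst'[OF int] by simp
      also have "\<dots> = (\<integral>a. (\<integral>x. iexp (t * \<theta> * a) * iexp (t * ?s * x) \<partial>?N) \<partial>?N)"
        by (simp add: exp_add[symmetric] algebra_simps)
      also have "\<dots> = char ?N (t * \<theta>) * char ?N (t * ?s)"
        by (simp add: char_def)
      also have "\<dots> = of_real (exp (- ((t * \<theta>)\<^sup>2) / 2 + - ((t * ?s)\<^sup>2) / 2))"
        by (simp only: char_std_normal_distribution exp_add of_real_mult)
      also have "- ((t * \<theta>)\<^sup>2) / 2 + - ((t * ?s)\<^sup>2) / 2 = - (t\<^sup>2) / 2"
        using v by (simp add: power_mult_distrib field_simps)
      finally show "char (distr (?N \<Otimes>\<^sub>M ?N) borel (\<lambda>(a, x). \<theta> * a + ?s * x)) t = char ?N t"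
        by (simp only: char_std_normal_distribution)
    qed
  qed
  finally show ?thesis .
qed


section \<open>Convergence of the spectral measures\<close>

lemma transposition_matrix_cong:
  "(\<And>k. k \<in> {1..N - 1} \<Longrightarrow> z k = z' k) \<Longrightarrow> transposition_matrix N d r z = transposition_matrix N d r z'"
  unfolding transposition_matrix_def
  by (rule arg_cong[where f = "Matrix.mat d d"], rule ext) (auto intro!: sum.cong)

lemma spectral_measure_empirical:
  assumes r: "unitary_rep N d r" and d: "0 < d"
  shows "\<exists>rs. length rs = d \<and> spectral_measure d (transposition_matrix N d r z) = empirical_measure rs \<and>
      (\<forall>k. (\<Sum>a\<leftarrow>rs. a ^ k) / real d =
        word_moment N d r z k)"
  using spectral_measure_moments[OF r d, of z] by metis

text \<open>Each moment is a polynomial in the coefficients. Continuity of the measure follows from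
  that of its moments, so the eigenvalues need not be chosen continuously in
  \<open>z\<close>.\<close>

lemma continuous_map_spectral_measure:
  assumes r: "unitary_rep N d r" and d: "0 < d"
  shows "continuous_map euclidean weak_topology (\<lambda>z. spectral_measure d (transposition_matrix N d r z))"
proof -
  obtain rs where len: "\<And>z. length (rs z) = d"
    and sm: "\<And>z. spectral_measure d (transposition_matrix N d r z) = empirical_measure (rs z)"
    and mom: "\<And>z k. (\<Sum>a\<leftarrow>rs z. a ^ k) / real d = word_moment N d r z k"
    using spectral_measure_empirical[OF r d] by metis
  have "continuous_on UNIV (\<lambda>z. (\<Sum>a\<leftarrow>rs z. a ^ k) / real d)" for k
    unfolding mom by (intro continuous_intros continuous_monomial)
  then show ?thesis
    unfolding sm
    by (intro continuous_map_weak_topology prob_space_empirical_measure sets_empirical_measure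
        continuous_empirical_integral[OF len d])
qed

lemma spectral_measure_measurable:
  assumes r: "unitary_rep N d r" and d: "0 < d" and Z: "\<And>k. k \<in> {1..N - 1} \<Longrightarrow> Z k \<in> borel_measurable M"
  shows "(\<lambda>\<omega>. spectral_measure d (transposition_matrix N d r (\<lambda>k. Z k \<omega>))) \<in> measurable M (borel_algebra_of weak_topology)"
proof -
  \<comment> \<open>Nothing is known about \<open>Z k\<close> for indices outside the range. Setting
    those coordinates to 0 makes the whole family measurable and leaves the matrix
    unchanged.\<close>
  let ?Z = "\<lambda>\<omega> k. if k \<in> {1..N - 1} then Z k \<omega> else 0"
  have "?Z \<in> borel_measurable M"
  proof (rule measurable_coordinatewise_then_product)
    show "(\<lambda>\<omega>. ?Z \<omega> k) \<in> borel_measurable M" for k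
    proof (cases "k \<in> {1..N - 1}")
      case True
      then have "(\<lambda>\<omega>. ?Z \<omega> k) = Z k" by (simp only: if_True)
      then show ?thesis using Z[OF True] by (simp only:)
    next
      case False
      then have "(\<lambda>\<omega>. ?Z \<omega> k) = (\<lambda>_. 0)" by (simp only: if_False)
      then show ?thesis by (simp only: measurable_const space_borel UNIV_I)
    qed
  qed
  note meas = measurable_borel_algebra_of[OF continuous_map_spectral_measure[OF r d] this]
  have "transposition_matrix N d r (\<lambda>k. Z k \<omega>) = transposition_matrix N d r (?Z \<omega>)" for \<omega>
    by (rule transposition_matrix_cong) (simp only: if_True)
  then show ?thesis using meas by (simp only:)
qed

lemma central_trace_normalized_character:
  assumes "is_partition N l" "unitary_rep N d r" "corresponds_to_partition N d r l" "0 < d"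
  shows "central_trace N (normalized_character d r) (content_sum l)"
  using assms normalized_character_bound normalized_character_comm normalized_character_id normalized_character_class_sum
  by unfold_locales auto

text \<open>Here \<open>k\<close> stands for \<open>\<kappa>\<close>. The bracket bounds the error
  on a good word: \<open>generic_word\<close> replaces the character by a power of
  \<open>\<kappa>\<close>, and passing to the same power of \<open>\<theta>\<close> costs at most
  \<open>p\<close> times the difference, as both lie in \<open>[-1, 1]\<close>.\<close>

abbreviation deviation_bound :: "real \<Rightarrow> nat \<Rightarrow> real \<Rightarrow> nat \<Rightarrow> real" where
  "deviation_bound \<theta> N k p \<equiv> (1 + mix_bound \<theta> p) * (8 * (real p)\<^sup>2 / real N + real p * \<bar>k - \<theta>\<bar>) * gauss_moment (2 * p) +
     (1 + mix_bound \<theta> p)\<^sup>2 * error_constant p / sqrt (real (N - 1))"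

text \<open>The spectral measure and the Gaussian measure of mean \<open>\<theta> * Y\<close> live
  on the same space. They are close up to \<open>e\<close> on a good event; off it their values
  under \<open>F\<close> differ by at most \<open>2 * B\<close>, and Chebyshev bounds the failure by
  a large \<open>Y\<close>, by \<open>V\<close> away from 1, or by one of the moments up to
  \<open>K\<close>.\<close>

lemma spectral_expectation_bound:
  fixes M :: "'a measure" and B R e \<delta> :: real and K :: nat
  assumes M: "prob_space M" and ind: "prob_space.indep_vars M (\<lambda>_. borel) Z {1..N - 1}"
    and Z: "\<And>k. k \<in> {1..N - 1} \<Longrightarrow> distributed M lborel (Z k) std_normal_density"
    and N: "2 \<le> N" and P: "is_partition N l" and r: "unitary_rep N d r"
    and co: "corresponds_to_partition N d r l" and d: "0 < d" and \<theta>: "\<bar>\<theta>\<bar> \<le> 1"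
    and F: "continuous_map weak_topology euclideanreal F" and B: "\<And>\<mu>. \<mu> \<in> topspace weak_topology \<Longrightarrow> \<bar>F \<mu>\<bar> \<le> B"
    and e: "0 < e" and R: "0 < R" and \<delta>: "0 < \<delta>"
    and close: "\<And>rs a v. rs \<noteq> [] \<Longrightarrow> \<bar>a\<bar> \<le> R \<Longrightarrow> \<bar>v - 1\<bar> \<le> \<delta> \<Longrightarrow>
      (\<And>p. p \<le> K \<Longrightarrow> \<bar>(\<Sum>x\<leftarrow>rs. x ^ p) / real (length rs) - limit_moment \<theta> p a v\<bar> \<le> \<delta>) \<Longrightarrow>
      \<bar>F (empirical_measure rs) - F (gaussian_measure (\<theta> * a) (1 - \<theta>\<^sup>2))\<bar> < e"
  shows "\<bar>(\<integral>\<omega>. F (spectral_measure d (transposition_matrix N d r (\<lambda>k. Z k \<omega>))) \<partial>M) -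
      (\<integral>x. F (gaussian_measure (\<theta> * x) (1 - \<theta>\<^sup>2)) \<partial>std_normal_distribution)\<bar> \<le>
    e + 2 * B * (1 / R\<^sup>2 + 2 / real (N - 1) / \<delta>\<^sup>2 +
      (\<Sum>p\<le>K. deviation_bound \<theta> N (content_sum l / real (N choose 2)) p) / \<delta>\<^sup>2)"
proof -
  interpret prob_space M by (rule M)
  let ?I = "{1..N - 1}"
  interpret gaussian_family M ?I Z
  proof unfold_locales
    show "?I \<noteq> {}" using N by auto
    show "distr M borel (Z k) = std_normal_distribution" if "k \<in> ?I" for k
    proof -
      have "distr M borel (Z k) = distr M lborel (Z k)" by (rule distr_cong) auto
      then show ?thesis using Z[OF that] by (simp add: distributed_def)
    qed
  qed (use ind in auto)
  interpret central_trace N "normalized_character d r" "content_sum l"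
    by (rule central_trace_normalized_character[OF P r co d])
  have m: "m = real (N - 1)" by simp
  let ?G = "\<lambda>a. gaussian_measure (\<theta> * a) (1 - \<theta>\<^sup>2)"
  let ?X = "\<lambda>\<omega>. spectral_measure d (transposition_matrix N d r (\<lambda>k. Z k \<omega>))"
  have vv: "0 \<le> 1 - \<theta>\<^sup>2" using \<theta> by (simp add: abs_square_le_1)
  define w where "w xs = normalized_character d r (adjacent_word xs)" for xs
  define D where "D p \<omega> = (\<Sum>xs\<in>words ?I p. w xs * monomial (y \<omega>) xs) - limit_moment \<theta> p (Y \<omega>) (V \<omega>)" for p \<omega>
  have perm: "adjacent_word xs permutes {1..N}" if "xs \<in> words ?I p" for xs p
    using that by (intro adjacent_word_permutes) (simp add: words_def)
  have w1: "\<bar>w xs\<bar> \<le> 1" if "xs \<in> words ?I p" for xs p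
    unfolding w_def by (rule bound[OF perm[OF that]])
  have wg: "\<bar>w xs - \<theta> ^ card {x. count_list xs x = 1}\<bar> \<le> 8 * (real p)\<^sup>2 / real N + real p * \<bar>\<kappa> - \<theta>\<bar>"
    if xs: "xs \<in> words ?I p" "spaced xs" "\<And>x. count_list xs x \<le> 2" for xs p
  proof -
    let ?c = "card {x. count_list xs x = 1}"
    have "\<bar>w xs - \<kappa> ^ ?c\<bar> \<le> 8 * (real p)\<^sup>2 / real N"
      using generic_word[OF N xs(2,3)] xs(1) by (simp add: w_def words_def)
    moreover have "\<bar>\<kappa> ^ ?c - \<theta> ^ ?c\<bar> \<le> real ?c * \<bar>\<kappa> - \<theta>\<bar>"
      using norm_power_diff[of \<kappa> \<theta> ?c] \<kappa>_bound[OF N] \<theta> by simp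
    moreover have "real ?c * \<bar>\<kappa> - \<theta>\<bar> \<le> real p * \<bar>\<kappa> - \<theta>\<bar>"
    proof (rule mult_right_mono)
      have "{x. count_list xs x = 1} \<subseteq> set xs" using count_notin by force
      then have "?c \<le> card (set xs)" by (intro card_mono) auto
      also have "\<dots> \<le> p" using xs(1) card_length[of xs] by (simp add: words_def)
      finally show "real ?c \<le> real p" by simp
    qed simp
    ultimately show ?thesis by linarith
  qed
  have \<eta>0: "0 \<le> 8 * (real p)\<^sup>2 / real N + real p * \<bar>\<kappa> - \<theta>\<bar>" for p by simp
  have Di: "integrable M (\<lambda>\<omega>. (D p \<omega>)\<^sup>2)" for p
    unfolding D_def by (rule moment_deviation(1)[OF \<theta> w1 wg \<eta>0])
  have DE: "expectation (\<lambda>\<omega>. (D p \<omega>)\<^sup>2) \<le> deviation_bound \<theta> N \<kappa> p" for p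
    unfolding D_def m[symmetric] by (rule moment_deviation(2)[OF \<theta> w1 wg \<eta>0])
  have B0: "0 \<le> B"
    using B[of "?G 0"] prob_space_gaussian_measure[OF vv] sets_gaussian_measure[OF vv]
    by (force simp: topspace_weak_topology)
  have BG: "\<bar>F (?G a)\<bar> \<le> B" for a
    by (rule B) (simp add: topspace_weak_topology prob_space_gaussian_measure[OF vv] sets_gaussian_measure[OF vv])
  have Gm: "(\<lambda>a. F (?G a)) \<in> borel_measurable borel"
  proof -
    have "(\<lambda>a. ?G a) \<in> measurable borel (borel_algebra_of weak_topology)"
      by (rule measurable_borel_algebra_of[OF continuous_map_gaussian_measure[OF vv]]) simp
    from measurable_compose[OF this continuous_functional_measurable[OF F]] show ?thesis .
  qed
  have Xm: "(\<lambda>\<omega>. F (?X \<omega>)) \<in> borel_measurable M"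
    by (rule measurable_compose[OF spectral_measure_measurable[OF r d rv] continuous_functional_measurable[OF F]])
  \<comment> \<open>Chebyshev's inequality in pointwise form: a deviation beyond its threshold makes
    its quotient at least 1, so no events have to be measured and integrating \<open>H\<close> needs
    second moments only.\<close>
  define H where "H \<omega> = e + 2 * B * ((Y \<omega>)\<^sup>2 / R\<^sup>2 + (V \<omega> - 1)\<^sup>2 / \<delta>\<^sup>2 + (\<Sum>p\<le>K. (D p \<omega>)\<^sup>2) / \<delta>\<^sup>2)" for \<omega>
  have pointwise: "\<bar>F (?X \<omega>)\<bar> \<le> B \<and> \<bar>F (?X \<omega>) - F (?G (Y \<omega>))\<bar> \<le> H \<omega>" for \<omega>
  proof -
    obtain rs where len: "length rs = d" and sm: "?X \<omega> = empirical_measure rs"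
      and mom: "\<And>k. (\<Sum>a\<leftarrow>rs. a ^ k) / real d = word_moment N d r (\<lambda>k. Z k \<omega>) k"
      using spectral_measure_empirical[OF r d, of "\<lambda>k. Z k \<omega>"] by blast
    have ne: "rs \<noteq> []" using len d by auto
    have yy: "y \<omega> = (\<lambda>k. 1 / sqrt (real (N - 1)) * Z k \<omega>)" by (rule ext) (simp only: y_def m)
    have dev: "(\<Sum>x\<leftarrow>rs. x ^ p) / real (length rs) - limit_moment \<theta> p (Y \<omega>) (V \<omega>) = D p \<omega>" for p
      unfolding len mom D_def yy w_def ..
    have XB: "\<bar>F (?X \<omega>)\<bar> \<le> B"
      unfolding sm by (rule B) (simp add: topspace_weak_topology prob_space_empirical_measure)
    let ?E = "(Y \<omega>)\<^sup>2 / R\<^sup>2 + (V \<omega> - 1)\<^sup>2 / \<delta>\<^sup>2 + (\<Sum>p\<le>K. (D p \<omega>)\<^sup>2) / \<delta>\<^sup>2"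
    have t: "0 \<le> (Y \<omega>)\<^sup>2 / R\<^sup>2" "0 \<le> (V \<omega> - 1)\<^sup>2 / \<delta>\<^sup>2" "0 \<le> (\<Sum>p\<le>K. (D p \<omega>)\<^sup>2) / \<delta>\<^sup>2"
      by (intro divide_nonneg_nonneg sum_nonneg zero_le_power2)+
    have big: "1 \<le> u\<^sup>2 / s\<^sup>2" if "0 < s" "\<not> \<bar>u\<bar> \<le> s" for u s :: real
    proof -
      have "s\<^sup>2 \<le> \<bar>u\<bar>\<^sup>2" using that by (intro power_mono) auto
      then show ?thesis using that by simp
    qed
    have "\<bar>F (?X \<omega>) - F (?G (Y \<omega>))\<bar> \<le> H \<omega>"
    proof (cases "\<bar>Y \<omega>\<bar> \<le> R \<and> \<bar>V \<omega> - 1\<bar> \<le> \<delta> \<and> (\<forall>p\<le>K. \<bar>D p \<omega>\<bar> \<le> \<delta>)")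
      case True
      have "\<bar>F (empirical_measure rs) - F (?G (Y \<omega>))\<bar> < e"
      proof (rule close[OF ne, of _ "V \<omega>"])
        show "\<bar>(\<Sum>x\<leftarrow>rs. x ^ p) / real (length rs) - limit_moment \<theta> p (Y \<omega>) (V \<omega>)\<bar> \<le> \<delta>" if "p \<le> K" for p
          unfolding dev using True that by blast
      qed (use True in blast)+
      moreover have "0 \<le> 2 * B * ?E" using B0 t by (intro mult_nonneg_nonneg add_nonneg_nonneg) auto
      ultimately show ?thesis unfolding H_def sm by linarith
    next
      case False
      then consider "\<not> \<bar>Y \<omega>\<bar> \<le> R" | "\<not> \<bar>V \<omega> - 1\<bar> \<le> \<delta>" | p where "p \<le> K" "\<not> \<bar>D p \<omega>\<bar> \<le> \<delta>" by blast
      then have "1 \<le> ?E"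
      proof cases
        case 1
        then show ?thesis using big[OF R 1] t by linarith
      next
        case 2
        then show ?thesis using big[OF \<delta> 2] t by linarith
      next
        case 3
        have "1 \<le> (D p \<omega>)\<^sup>2 / \<delta>\<^sup>2" by (rule big[OF \<delta> 3(2)])
        also have "\<dots> \<le> (\<Sum>p\<le>K. (D p \<omega>)\<^sup>2) / \<delta>\<^sup>2"
          by (intro divide_right_mono member_le_sum) (use 3 in auto)
        finally show ?thesis using t by linarith
      qed
      then have "2 * B * 1 \<le> 2 * B * ?E" using B0 by (intro mult_left_mono) auto
      then show ?thesis using XB BG[of "Y \<omega>"] e unfolding H_def by linarith
    qed
    with XB show ?thesis ..
  qed
  have iX: "integrable M (\<lambda>\<omega>. F (?X \<omega>))"
    by (rule integrable_const_bound[where B = B]) (use pointwise Xm in auto)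
  have YG: "(\<lambda>\<omega>. F (?G (Y \<omega>))) \<in> borel_measurable M" by (rule measurable_compose[OF Y_measurable Gm])
  have iG: "integrable M (\<lambda>\<omega>. F (?G (Y \<omega>)))"
    by (rule integrable_const_bound[where B = B]) (use BG YG in auto)
  have iY: "integrable M (\<lambda>\<omega>. (Y \<omega>)\<^sup>2)" and EY: "expectation (\<lambda>\<omega>. (Y \<omega>)\<^sup>2) = 1"
    using integrable_Y_power[of 2] expectation_Y_power[of 2] gauss_moment_values by simp_all
  have iH: "integrable M H"
    unfolding H_def[abs_def] using iY V_second_moment(1) Di by simp
  \<comment> \<open>The law of \<open>Y\<close> is standard Gaussian for each \<open>N\<close>, so
    replacing the limiting variable by \<open>Y\<close> costs nothing.\<close>
  have "(\<integral>x. F (?G x) \<partial>std_normal_distribution) = expectation (\<lambda>\<omega>. F (?G (Y \<omega>)))"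
    by (rule expectation_std_normal(1)[OF Y_measurable distr_Y Gm, symmetric])
  then have "\<bar>expectation (\<lambda>\<omega>. F (?X \<omega>)) - (\<integral>x. F (?G x) \<partial>std_normal_distribution)\<bar> =
      \<bar>expectation (\<lambda>\<omega>. F (?X \<omega>) - F (?G (Y \<omega>)))\<bar>"
    using iX iG by simp
  also have "\<dots> \<le> expectation (\<lambda>\<omega>. \<bar>F (?X \<omega>) - F (?G (Y \<omega>))\<bar>)"
    by (rule integral_abs_bound)
  also have "\<dots> \<le> expectation H"
    by (rule integral_mono) (use iX iG iH pointwise in auto)
  also have "\<dots> = e + 2 * B * (1 / R\<^sup>2 + 2 / real (N - 1) / \<delta>\<^sup>2 + (\<Sum>p\<le>K. expectation (\<lambda>\<omega>. (D p \<omega>)\<^sup>2)) / \<delta>\<^sup>2)"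
    unfolding H_def[abs_def] using iY EY V_second_moment Di by (simp add: prob_space)
  also have "\<dots> \<le> e + 2 * B * (1 / R\<^sup>2 + 2 / real (N - 1) / \<delta>\<^sup>2 + (\<Sum>p\<le>K. deviation_bound \<theta> N \<kappa> p) / \<delta>\<^sup>2)"
    by (intro add_left_mono mult_left_mono divide_right_mono sum_mono DE) (use B0 in auto)
  finally show ?thesis by (simp only: \<kappa>_def)
qed

lemma deviation_bound_tendsto_0:
  assumes N: "filterlim N at_top sequentially" and k: "k \<longlonglongrightarrow> \<theta>"
  shows "(\<lambda>n. deviation_bound \<theta> (N n) (k n) p) \<longlonglongrightarrow> 0"
    and "(\<lambda>n. 2 / real (N n - 1)) \<longlonglongrightarrow> 0"
proof -
  have rN: "filterlim (\<lambda>n. real (N n)) at_top sequentially"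
    by (rule filterlim_compose[OF filterlim_real_sequentially N])
  have rN1: "filterlim (\<lambda>n. real (N n - 1)) at_top sequentially"
    by (rule filterlim_compose[OF filterlim_real_sequentially filterlim_compose[OF filterlim_minus_const_nat_at_top N]])
  have inf: "filterlim f at_infinity sequentially" if "filterlim f at_top sequentially" for f :: "nat \<Rightarrow> real"
    using that by (rule filterlim_at_top_imp_at_infinity)
  have 1: "(\<lambda>n. 8 * (real p)\<^sup>2 / real (N n)) \<longlonglongrightarrow> 0"
    by (rule tendsto_divide_0[OF tendsto_const inf[OF rN]])
  have 2: "(\<lambda>n. real p * \<bar>k n - \<theta>\<bar>) \<longlonglongrightarrow> 0"
    using tendsto_mult[OF tendsto_const[of "real p"] tendsto_rabs[OF tendsto_diff[OF k tendsto_const[of \<theta>]]]] by simp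
  have 3: "(\<lambda>n. (1 + mix_bound \<theta> p)\<^sup>2 * error_constant p / sqrt (real (N n - 1))) \<longlonglongrightarrow> 0"
    by (rule tendsto_divide_0[OF tendsto_const inf[OF filterlim_compose[OF sqrt_at_top rN1]]])
  have "(\<lambda>n. deviation_bound \<theta> (N n) (k n) p) \<longlonglongrightarrow> (1 + mix_bound \<theta> p) * (0 + 0) * gauss_moment (2 * p) + 0"
    by (intro tendsto_add[OF tendsto_mult[OF tendsto_mult[OF tendsto_const tendsto_add[OF 1 2]] tendsto_const] 3])
  then show "(\<lambda>n. deviation_bound \<theta> (N n) (k n) p) \<longlonglongrightarrow> 0" by simp
  show "(\<lambda>n. 2 / real (N n - 1)) \<longlonglongrightarrow> 0"
    by (rule tendsto_divide_0[OF tendsto_const inf[OF rN1]])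
qed

section \<open>Convergence in distribution to the random Gaussian measure\<close>

theorem theorem1p1:
  fixes N :: "nat \<Rightarrow> nat"
    and lam lam' :: "nat \<Rightarrow> nat list"
    and rho :: "nat \<Rightarrow> (nat \<Rightarrow> nat) \<Rightarrow> complex mat"
    and M :: "nat \<Rightarrow> 'a measure"
    and Z :: "nat \<Rightarrow> nat \<Rightarrow> 'a \<Rightarrow> real"
    and theta :: real
    and P :: "'b measure"
    and G :: "'b \<Rightarrow> real"
  defines "Xi \<equiv> \<lambda>n \<omega>. spectral_measure (partition_dim (lam n))
             (transposition_matrix (N n) (partition_dim (lam n)) (rho n) (\<lambda>k. Z n k \<omega>))"
    and "Xi_inf \<equiv> \<lambda>\<omega>. gaussian_measure (theta * G \<omega>) (1 - theta\<^sup>2)"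
  assumes "\<And>n. n \<ge> 1 \<Longrightarrow> N n > 0"
    and "\<And>n. n \<ge> 1 \<Longrightarrow> is_partition (N n) (lam n)"
    and "\<And>n. n \<ge> 1 \<Longrightarrow> is_conjugate_partition (N n) (lam n) (lam' n)"
    and "\<And>n. n \<ge> 1 \<Longrightarrow> unitary_rep (N n) (partition_dim (lam n)) (rho n)"
    and "\<And>n. n \<ge> 1 \<Longrightarrow> irreducible_rep (N n) (partition_dim (lam n)) (rho n)"
    and "\<And>n. n \<ge> 1 \<Longrightarrow> corresponds_to_partition (N n) (partition_dim (lam n)) (rho n) (lam n)"
    and "\<And>n. n \<ge> 1 \<Longrightarrow> prob_space (M n)"
    and "\<And>n. n \<ge> 1 \<Longrightarrow> prob_space.indep_vars (M n) (\<lambda>_. borel) (Z n) {1..N n - 1}"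
    and "\<And>n k. n \<ge> 1 \<Longrightarrow> k \<in> {1..N n - 1} \<Longrightarrow>
           distributed (M n) lborel (Z n k) std_normal_density"
    and "prob_space P"
    and "distributed P lborel G std_normal_density"
    and "filterlim N at_top sequentially"
    and "(\<lambda>n. (\<Sum>(i, j)\<in>young_diagram (lam n). real j - real i) / real (N n choose 2))
           \<longlonglongrightarrow> theta"
  shows "(\<forall>n\<ge>1. (\<Sum>(i, j)\<in>young_diagram (lam n). real j - real i) =
                 (\<Sum>p\<leftarrow>lam n. real (p choose 2)) - (\<Sum>p\<leftarrow>lam' n. real (p choose 2))) \<and>
         converges_in_distribution weak_topology M Xi P Xi_inf \<and>
         bind P Xi_inf = std_normal_distribution"
proof (intro conjI allI impI)
  fix n :: nat assume "n \<ge> 1"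
  then show "content_sum (lam n) = (\<Sum>p\<leftarrow>lam n. real (p choose 2)) - (\<Sum>p\<leftarrow>lam' n. real (p choose 2))"
    by (intro content_sum_eq_binomials[OF assms(4) assms(5)])
next
  define d where "d n = partition_dim (lam n)" for n
  define k where "k n = content_sum (lam n) / real (N n choose 2)" for n
  note Npos = assms(3) and part = assms(4) and conj = assms(5) and rep = assms(6) and irr = assms(7)
    and corr = assms(8) and prob = assms(9) and ind = assms(10) and std = assms(11) and P = assms(12)
    and G = assms(13) and Ninf = assms(14) and lim = assms(15)
  \<comment> \<open>\<open>partition_dim\<close> is a truncating division; its positivity is read
    off from irreducibility instead of the hook length formula.\<close>
  have d: "0 < d n" if "n \<ge> 1" for n using irr[OF that] by (simp add: irreducible_rep_def d_def)
  have k: "k \<longlonglongrightarrow> theta" using lim by (simp add: k_def[abs_def])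
  have N2: "\<forall>\<^sub>F n in sequentially. 1 \<le> n \<and> 2 \<le> N n"
    using Ninf eventually_ge_at_top[of "1 :: nat"] by (auto simp: filterlim_at_top intro: eventually_conj)
  \<comment> \<open>The ratio \<open>k n\<close> is the normalized character of a transposition once
    \<open>N n\<close> is at least 2, so it lies in \<open>[-1, 1]\<close>, and so does its
    limit.\<close>
  have theta: "\<bar>theta\<bar> \<le> 1"
  proof (rule tendsto_upperbound[OF tendsto_rabs[OF k]])
    show "\<forall>\<^sub>F n in sequentially. \<bar>k n\<bar> \<le> 1"
      using N2
    proof eventually_elim
      case (elim n)
      interpret central_trace "N n" "normalized_character (d n) (rho n)" "content_sum (lam n)"
        by (rule central_trace_normalized_character) (use elim part rep corr d in \<open>auto simp: d_def\<close>)
      show ?case using \<kappa>_bound elim by (simp add: \<kappa>_def k_def)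
    qed
  qed simp
  then have v: "0 \<le> 1 - theta\<^sup>2" by (simp add: abs_square_le_1)
  let ?\<Gamma> = "\<lambda>a. gaussian_measure (theta * a) (1 - theta\<^sup>2)"
  show "bind P Xi_inf = std_normal_distribution"
    unfolding Xi_inf_def by (rule bind_gaussian_measure[OF P G theta])
  have Gm: "G \<in> P \<rightarrow>\<^sub>M borel" and Gd: "distr P borel G = std_normal_distribution"
  proof -
    have "distr P borel G = distr P lborel G" by (rule distr_cong) auto
    then show "G \<in> P \<rightarrow>\<^sub>M borel" "distr P borel G = std_normal_distribution" using G by (auto simp: distributed_def)
  qed
  show "converges_in_distribution weak_topology M Xi P Xi_inf"
    unfolding converges_in_distribution_def
  proof (intro conjI allI impI)
    show "Xi n \<in> measurable (M n) (borel_algebra_of weak_topology)" if n: "n \<ge> 1" for n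
      unfolding Xi_def
    proof (rule spectral_measure_measurable[OF rep[OF n] d[OF n, unfolded d_def]])
      show "Z n j \<in> borel_measurable (M n)" if "j \<in> {1..N n - 1}" for j
        using std[OF n that] by (simp add: distributed_def)
    qed
    show "Xi_inf \<in> measurable P (borel_algebra_of weak_topology)"
      unfolding Xi_inf_def by (rule measurable_borel_algebra_of[OF continuous_map_gaussian_measure[OF v] Gm])
    fix F assume "continuous_map weak_topology euclideanreal F \<and> bounded (F ` topspace weak_topology)"
    then have F: "continuous_map weak_topology euclideanreal F" and bF: "bounded (F ` topspace weak_topology)" by auto
    obtain B where B: "\<And>\<mu>. \<mu> \<in> topspace weak_topology \<Longrightarrow> \<bar>F \<mu>\<bar> \<le> B" and B0: "0 < B"
      using bF by (auto simp: bounded_pos)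
    have Fm: "(\<lambda>a. F (?\<Gamma> a)) \<in> borel_measurable borel"
      by (rule measurable_compose[OF measurable_borel_algebra_of[OF continuous_map_gaussian_measure[OF v] measurable_ident_sets[OF refl]]
            continuous_functional_measurable[OF F]])
    have lim_eq: "(\<integral>\<omega>. F (Xi_inf \<omega>) \<partial>P) = (\<integral>x. F (?\<Gamma> x) \<partial>std_normal_distribution)"
      unfolding Xi_inf_def by (rule prob_space.expectation_std_normal(1)[OF P Gm Gd Fm])
    show "(\<lambda>n. \<integral>\<omega>. F (Xi n \<omega>) \<partial>M n) \<longlonglongrightarrow> (\<integral>\<omega>. F (Xi_inf \<omega>) \<partial>P)"
      unfolding lim_eq
    proof (rule tendstoI)
      fix e :: real assume e: "0 < e"
      \<comment> \<open>Chosen so that \<open>R \<ge> 1\<close> and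
        \<open>R \<ge> 8 * B / e\<close>; then \<open>R\<^sup>2 \<ge> R\<close> makes the
        contribution of large \<open>Y\<close> at most \<open>e / 4\<close>.\<close>
      define R where "R = 1 + 8 * B / e"
      have R1: "1 \<le> R" using B0 e by (simp add: R_def)
      have RB: "2 * B / R\<^sup>2 \<le> e / 4"
      proof -
        have "8 * B / e \<le> R * 1" by (simp add: R_def)
        also have "\<dots> \<le> R\<^sup>2" using R1 by (simp add: power2_eq_square)
        finally have "8 * B \<le> e * R\<^sup>2" using e by (simp add: field_simps)
        then show ?thesis using R1 by (simp add: divide_simps)
      qed
      have "0 < e / 4" using e by simp
      from uniform_closeness_to_gaussian[OF theta F this, of R]
      obtain K \<delta> where \<delta>: "0 < \<delta>" and close: "\<And>rs a v. rs \<noteq> [] \<Longrightarrow> \<bar>a\<bar> \<le> R \<Longrightarrow> \<bar>v - 1\<bar> \<le> \<delta> \<Longrightarrow>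
          (\<And>p. p \<le> K \<Longrightarrow> \<bar>(\<Sum>x\<leftarrow>rs. x ^ p) / real (length rs) - limit_moment theta p a v\<bar> \<le> \<delta>) \<Longrightarrow>
          \<bar>F (empirical_measure rs) - F (?\<Gamma> a)\<bar> < e / 4"
        by metis
      \<comment> \<open>\<open>K\<close> and \<open>\<delta>\<close> depend on \<open>R\<close> but
        not on \<open>n\<close>, so these remaining terms vanish as \<open>N n\<close> grows.
        Together with \<open>e / 4\<close> from closeness and \<open>e / 4\<close> from large
        \<open>Y\<close> the total stays below \<open>e\<close>.\<close>
      define E where "E n = 2 * B * (2 / real (N n - 1) / \<delta>\<^sup>2 + (\<Sum>p\<le>K. deviation_bound theta (N n) (k n) p) / \<delta>\<^sup>2)" for n
      have "E \<longlonglongrightarrow> 2 * B * (0 / \<delta>\<^sup>2 + (\<Sum>p\<le>K. 0) / \<delta>\<^sup>2)"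
        unfolding E_def
        by (intro tendsto_mult[OF tendsto_const] tendsto_add tendsto_divide[OF _ tendsto_const] tendsto_sum
            deviation_bound_tendsto_0[OF Ninf k]) (use \<delta> in auto)
      then have "\<forall>\<^sub>F n in sequentially. E n < e / 4"
        by (rule order_tendstoD(2)) (use e in simp)
      with N2 show "\<forall>\<^sub>F n in sequentially. dist (\<integral>\<omega>. F (Xi n \<omega>) \<partial>M n) (\<integral>x. F (?\<Gamma> x) \<partial>std_normal_distribution) < e"
      proof eventually_elim
        case (elim n)
        then have n: "1 \<le> n" and Nn: "2 \<le> N n" by auto
        have "\<bar>(\<integral>\<omega>. F (Xi n \<omega>) \<partial>M n) - (\<integral>x. F (?\<Gamma> x) \<partial>std_normal_distribution)\<bar> \<le>
            e / 4 + 2 * B * (1 / R\<^sup>2 + 2 / real (N n - 1) / \<delta>\<^sup>2 + (\<Sum>p\<le>K. deviation_bound theta (N n) (k n) p) / \<delta>\<^sup>2)"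
          unfolding Xi_def k_def
          by (rule spectral_expectation_bound[OF prob[OF n] ind[OF n] std[OF n] Nn part[OF n] rep[OF n] corr[OF n]
                d[OF n, unfolded d_def] theta F B _ _ \<delta> close]) (use e R1 in auto)
        also have "\<dots> = e / 4 + 2 * B / R\<^sup>2 + E n" unfolding E_def by (simp add: algebra_simps)
        also have "\<dots> < e" using RB elim e by linarith
        finally show ?case by (simp add: dist_real_def)
      qed
    qed
  qed
qed

end
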